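(* Let $q\ge 1$, let $X_1,X_2,\dots\in\mathbb{R}^q$ be non-random, let $\epsilon_1,\epsilon_2,\dots$ be i.i.d. real random variables (not necessarily stable), and let $Y_j=X_j\cdot\mu_0+\sigma_0\epsilon_j$ with true values $\sigma_0>0$ and $\mu_0\in\Theta_\mu$, where $\Theta_\mu\subset\mathbb{R}^q$ is a bounded convex domain. Suppose that conditions (1)–(5) listed in the context hold, and let $\hat\mu_n$ be any Cauchy quasi-maximum likelihood estimator (defined in the context). Then, as $n\to\infty$, $$\sqrt{n}\,(\hat\mu_n-\mu_0)\ \xrightarrow{\ \mathcal{L}\ }\ N\big(0,\Gamma_0^{-1}\Sigma_0\Gamma_0^{-1}\big),$$ where $\Gamma_0$ and $\Sigma_0$ are the matrices defined in the context. Furthermore, for any $L>0$, $$\sup_{r>0}\ \sup_{n}\ P_{\theta_0}\big[\,|\sqrt{n}(\hat\mu_n-\mu_0)|>r\,\big]\,r^{L}<\infty .$$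
   Context: Notation: $P_{\theta_0}$, $E_{\theta_0}$ denote probability and expectation under the true parameter; $\Delta_j\zeta:=\zeta_j-\zeta_{j-1}$ for $\zeta=X,Y,\epsilon$; $A^{\otimes 2}:=AA^\top$; $\xrightarrow{\mathcal{L}}$ is convergence in law; sample sizes are $n\ge 2$. Put $S_j:=\sigma_0\Delta_j\epsilon=\sigma_0(\epsilon_j-\epsilon_{j-1})$ for $j\ge2$. Estimator: let $$H_n(\mu):=\sum_{j=2}^n\log\frac{1}{1+(\Delta_jY-\Delta_jX\cdot\mu)^2}.$$ The Cauchy quasi-maximum likelihood estimator (CQMLE) $\hat\mu_n$ is any (measurable) maximizer of $H_n$ over the closure of $\Theta_\mu$. Conditions: (1) There is $C_X>0$ with $\sup_j|\Delta_jX|<C_X$. (2) There are a positive definite matrix $C_0$ and a constant $\beta_1\in(0,1/2)$ such that $\sup_{n}\big|n^{\beta_1}\big(\frac1n\sum_{j=2}^n(\Delta_jX)^{\otimes2}-C_0\big)\big|<\infty$. (3) There is a matrix $D_0$ such that $\lim_{n\to\infty}\frac{1}{n-2}\sum_{j=2}^{n-1}(\Delta_jX)(\Delta_{j+1}X)^{\top}=D_0$. (4) There are a continuous function $\mu\mapsto\mathbb{Y}(\mu)$ on $\Theta_\mu$ and a constant $\beta_2\in[0,1/2)$ such that $\sup_n\sup_{\mu\in\Theta_\mu}\big|n^{1/2-\beta_2}(\mathbb{Y}^\star_n(\mu)-\mathbb{Y}(\mu))\big|<\infty$, where $$\mathbb{Y}^\star_n(\mu):=-\frac1n\sum_{j=2}^nE_{\theta_0}\Big[\log\big(1+\{\sigma_0\Delta_2\epsilon-\Delta_jX\cdot(\mu-\mu_0)\}^2\big)-\log\big(1+(\sigma_0\Delta_2\epsilon)^2\big)\Big],$$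 and there is $\lambda>0$ with $\mathbb{Y}(\mu)=\mathbb{Y}(\mu)-\mathbb{Y}(\mu_0)\le-\lambda|\mu-\mu_0|^2$ for all $\mu\in\Theta_\mu$. (5) $E_{\theta_0}[|\log(1+\epsilon_1^2)|^K]<\infty$ for every $K>0$; the symmetric distribution of $S_2=\sigma_0(\epsilon_2-\epsilon_1)$ admits an (even) Lebesgue density $\mathfrak{f}$ with $\mathfrak{f}(1)>0$ and $\sup_{x\ge1}\mathfrak{f}(x)\le\mathfrak{f}(1)\le\inf_{0\le x\le1}\mathfrak{f}(x)$; and there are constants $0<\mathfrak{c}_1<\mathfrak{c}_2<1$ and $\mathfrak{b}>0$ with $\inf_{\mathfrak{c}_1\le x\le\mathfrak{c}_2}\mathfrak{f}(x)\ge(1+\mathfrak{b})\mathfrak{f}(1)$. Matrices: $$\Sigma_0:=4E_{\theta_0}\Big[\Big(\frac{S_2}{1+S_2^2}\Big)^2\Big]C_0+4E_{\theta_0}\Big[\frac{S_2}{1+S_2^2}\cdot\frac{S_3}{1+S_3^2}\Big](D_0+D_0^{\top}),\qquad \Gamma_0:=2E_{\theta_0}\Big[\frac{1-S_2^2}{(1+S_2^2)^2}\Big]C_0 .$$ *)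

theory Defs
  imports "HOL-Probability.Probability"
begin

text \<open>
  The dimension \<open>q \<ge> 1\<close> is \<open>CARD('q)\<close>. Sequences \<open>X\<close>, \<open>Y\<close>, \<open>\<epsilon>\<close> are indexed from 1 (the value
  at index 0 is irrelevant), so increments are only ever taken at indices \<open>j \<ge> 2\<close>. The norm on
  \<open>real ^ 'q ^ 'q\<close> is the Frobenius norm. Suprema that may be infinite are taken in \<open>ereal\<close>.
\<close>

definition \<Delta> :: "(nat \<Rightarrow> 'b::minus) \<Rightarrow> nat \<Rightarrow> 'b" where
  "\<Delta> \<zeta> j = \<zeta> j - \<zeta> (j - 1)"

definition outer :: "real ^ 'q \<Rightarrow> real ^ 'q \<Rightarrow> real ^ 'q ^ 'q" where
  "outer x y = columnvector x ** (rowvector y :: real ^ 'q ^ 1)"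

definition positive_definite :: "real ^ 'q ^ 'q \<Rightarrow> bool" where
  "positive_definite A \<longleftrightarrow> transpose A = A \<and> (\<forall>x. x \<noteq> 0 \<longrightarrow> x \<bullet> (A *v x) > 0)"

definition H :: "(nat \<Rightarrow> real ^ 'q) \<Rightarrow> (nat \<Rightarrow> real) \<Rightarrow> nat \<Rightarrow> real ^ 'q \<Rightarrow> real" where
  "H X y n \<mu> = (\<Sum>j=2..n. ln (1 / (1 + (\<Delta> y j - \<Delta> X j \<bullet> \<mu>)\<^sup>2)))"

definition CQMLE ::
  "'a measure \<Rightarrow> (real ^ 'q) set \<Rightarrow> (nat \<Rightarrow> real ^ 'q) \<Rightarrow> (nat \<Rightarrow> 'a \<Rightarrow> real) \<Rightarrow> nat \<Rightarrow> ('a \<Rightarrow> real ^ 'q) \<Rightarrow> bool"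
where
  "CQMLE M \<Theta> X Y n \<mu>h \<longleftrightarrow>
     \<mu>h \<in> borel_measurable M \<and>
     (\<forall>\<omega>\<in>space M. \<mu>h \<omega> \<in> closure \<Theta> \<and>
        (\<forall>\<mu>\<in>closure \<Theta>. H X (\<lambda>j. Y j \<omega>) n \<mu> \<le> H X (\<lambda>j. Y j \<omega>) n (\<mu>h \<omega>)))"

definition S :: "real \<Rightarrow> (nat \<Rightarrow> 'a \<Rightarrow> real) \<Rightarrow> nat \<Rightarrow> 'a \<Rightarrow> real" where
  "S \<sigma>\<^sub>0 \<epsilon> j \<omega> = \<sigma>\<^sub>0 * \<Delta> (\<lambda>i. \<epsilon> i \<omega>) j"

definition Ystar ::
  "'a measure \<Rightarrow> (nat \<Rightarrow> real ^ 'q) \<Rightarrow> (nat \<Rightarrow> 'a \<Rightarrow> real) \<Rightarrow> real \<Rightarrow> real ^ 'q \<Rightarrow> nat \<Rightarrow> real ^ 'q \<Rightarrow> real"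
where
  "Ystar M X \<epsilon> \<sigma>\<^sub>0 \<mu>\<^sub>0 n \<mu> =
     - (1 / real n) * (\<Sum>j=2..n. \<integral>\<omega>. (ln (1 + (S \<sigma>\<^sub>0 \<epsilon> 2 \<omega> - \<Delta> X j \<bullet> (\<mu> - \<mu>\<^sub>0))\<^sup>2)
                                     - ln (1 + (S \<sigma>\<^sub>0 \<epsilon> 2 \<omega>)\<^sup>2)) \<partial>M)"

definition Sigma0 ::
  "'a measure \<Rightarrow> (nat \<Rightarrow> 'a \<Rightarrow> real) \<Rightarrow> real \<Rightarrow> real ^ 'q ^ 'q \<Rightarrow> real ^ 'q ^ 'q \<Rightarrow> real ^ 'q ^ 'q"
where
  "Sigma0 M \<epsilon> \<sigma>\<^sub>0 C\<^sub>0 D\<^sub>0 =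
     (4 * (\<integral>\<omega>. (S \<sigma>\<^sub>0 \<epsilon> 2 \<omega> / (1 + (S \<sigma>\<^sub>0 \<epsilon> 2 \<omega>)\<^sup>2))\<^sup>2 \<partial>M)) *\<^sub>R C\<^sub>0
     + (4 * (\<integral>\<omega>. S \<sigma>\<^sub>0 \<epsilon> 2 \<omega> / (1 + (S \<sigma>\<^sub>0 \<epsilon> 2 \<omega>)\<^sup>2) * (S \<sigma>\<^sub>0 \<epsilon> 3 \<omega> / (1 + (S \<sigma>\<^sub>0 \<epsilon> 3 \<omega>)\<^sup>2)) \<partial>M))
         *\<^sub>R (D\<^sub>0 + transpose D\<^sub>0)"

definition Gamma0 ::
  "'a measure \<Rightarrow> (nat \<Rightarrow> 'a \<Rightarrow> real) \<Rightarrow> real \<Rightarrow> real ^ 'q ^ 'q \<Rightarrow> real ^ 'q ^ 'q"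
where
  "Gamma0 M \<epsilon> \<sigma>\<^sub>0 C\<^sub>0 =
     (2 * (\<integral>\<omega>. (1 - (S \<sigma>\<^sub>0 \<epsilon> 2 \<omega>)\<^sup>2) / (1 + (S \<sigma>\<^sub>0 \<epsilon> 2 \<omega>)\<^sup>2)\<^sup>2 \<partial>M)) *\<^sub>R C\<^sub>0"

definition std_normal_vec :: "(real ^ 'q) measure" where
  "std_normal_vec = density lborel (\<lambda>z. ennreal (\<Prod>i\<in>UNIV. std_normal_density (z $ i)))"

text \<open>
  \<open>N\<close> is the law \<open>N(m, V)\<close>, i.e.\ the law of \<open>m + A Z\<close> with \<open>Z\<close> standard normal and
  \<open>A A\<^sup>T = V\<close>. Singular \<open>V\<close> are allowed, and no \<open>N\<close> qualifies unless \<open>V\<close> is symmetric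
  positive semidefinite.
\<close>
definition normal_law :: "real ^ 'q \<Rightarrow> real ^ 'q ^ 'q \<Rightarrow> (real ^ 'q) measure \<Rightarrow> bool" where
  "normal_law m V N \<longleftrightarrow>
     (\<exists>A :: real ^ 'q ^ 'q. A ** transpose A = V \<and> N = distr std_normal_vec borel (\<lambda>z. m + A *v z))"

definition converges_in_law ::
  "'a measure \<Rightarrow> (nat \<Rightarrow> 'a \<Rightarrow> 'b::topological_space) \<Rightarrow> 'b measure \<Rightarrow> bool"
where
  "converges_in_law M Z N \<longleftrightarrow>
     (\<forall>g :: 'b \<Rightarrow> real. continuous_on UNIV g \<and> bounded (range g) \<longrightarrow>
        (\<lambda>n. \<integral>\<omega>. g (Z n \<omega>) \<partial>M) \<longlonglongrightarrow> (\<integral>x. g x \<partial>N))"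

end

theory Submission
  imports Defs "HOL-Real_Asymp.Real_Asymp"
begin

text \<open>
  Put \<open>a\<^sub>j = \<Delta> X j\<close> and let \<open>S\<^sub>j\<close> be the noise increments. Inserting the model turns \<open>H\<^sub>n(\<mu>)\<close>, up to
  a term free of \<open>\<mu>\<close>, into minus the sum of \<open>l(S\<^sub>j - a\<^sub>j \<bullet> (\<mu> - \<mu>\<^sub>0))\<close> with \<open>l(x) = ln (1 + x\<^sup>2)\<close>. The
  derivative \<open>l'\<close> is bounded by \<open>1\<close>, and \<open>l''\<close> is bounded and Lipschitz. So, however heavy the tails of
  the noise, everything that occurs is an average of bounded random variables, and these are
  one-dependent because \<open>S\<^sub>j\<close> involves only \<open>\<epsilon>\<^sub>j\<close> and \<open>\<epsilon>\<^sub>j\<^sub>-\<^sub>1\<close>. Separating even from odd indices leaves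
  independent summands, hence Hoeffding's inequality (\<open>Hoeffding_one_dependent\<close>).

  Tails. Hoeffding at the points of a finite net, with the Lipschitz continuity of the loss and the
  quadratic separation of the expected loss, shows that \<open>\<mu>h\<close> leaves a fixed neighbourhood of \<open>\<mu>\<^sub>0\<close> with
  exponentially small probability (\<open>estimator_exponentially_consistent\<close>). Inside the neighbourhood
  the estimator solves the score equation. Expanding that equation to first order gives
  \<open>W\<^sub>n = G\<^sub>n u\<^sub>n\<close> up to an error of order \<open>norm (\<mu>h - \<mu>\<^sub>0) * norm u\<^sub>n\<close>, where \<open>u\<^sub>n\<close> is the rescaled error, \<open>W\<^sub>n\<close> the
  normalised score and \<open>G\<^sub>n\<close> the empirical curvature matrix; the latter is close to
  \<open>\<Gamma>\<^sub>0\<close> off an exponentially small event (\<open>curvature_concentration\<close>). The shape conditions on the density \<open>f\<close> make \<open>\<Gamma>\<^sub>0\<close> positive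
  definite: \<open>l''\<close> integrates to \<open>0\<close> and is positive exactly on \<open>(-1, 1)\<close>, where \<open>f \<ge> f 1\<close>, while \<open>f \<le> f 1\<close> elsewhere, so that
  \<open>l'' * (f - f 1)\<close> is nonnegative, and positive on \<open>[c\<^sub>1, c\<^sub>2]\<close>. Consequently \<open>norm u\<^sub>n\<close> is at most a multiple
  of \<open>norm W\<^sub>n\<close> off an exponentially small event, and \<open>W\<^sub>n\<close> is sub-Gaussian, again by Hoeffding. As \<open>u\<^sub>n\<close>
  is at most of order \<open>sqrt n\<close>, the rare event is absorbed into the same Gaussian bound
  (\<open>subgaussian_tail\<close>), which dominates every power.

  Limit law. The same expansion gives \<open>W\<^sub>n - \<Gamma>\<^sub>0 u\<^sub>n \<rightarrow> 0\<close> in probability. For the score, fix a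
  direction and let \<open>T\<close> be the projected score, with variance \<open>V\<close>. The function
  \<open>F s = E cos (s T + c)\<close> nearly satisfies \<open>F' s = - s V F s\<close>, since each summand interacts
  only with its neighbours; this gives \<open>F 1 = exp (- V / 2) * cos c\<close> up to an error of order
  \<open>1 / sqrt n\<close> (\<open>one_dependent_cos_bound\<close>). The limits of these cosine expectations determine the limit
  in law: on a large cube a bounded continuous function is uniformly close to a polynomial in sines of
  the coordinates that stays bounded globally, and the mass outside the cube is controlled by the tail
  bound (\<open>converges_in_law_cosI\<close>). A Cholesky factor of \<open>\<Sigma>\<^sub>0\<close>, which may be singular, produces the
  normal law.
\<close>

section \<open>Linear algebra\<close>

text \<open>
  The form need not be definite, so \<open>y\<close> may be a null vector; then the quadratic in \<open>t\<close> obtained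
  from \<open>x + t y\<close> is affine and, being nonnegative, constant.
\<close>
lemma psd_Cauchy_Schwarz:
  fixes V :: "real ^ 'q ^ 'q"
  assumes sym: "transpose V = V" and psd: "\<And>x. 0 \<le> x \<bullet> (V *v x)"
  shows "(x \<bullet> (V *v y))\<^sup>2 \<le> (x \<bullet> (V *v x)) * (y \<bullet> (V *v y))"
proof -
  define a b c where "a = x \<bullet> (V *v x)" and "b = x \<bullet> (V *v y)" and "c = y \<bullet> (V *v y)"
  have b': "y \<bullet> (V *v x) = b"
    unfolding b_def by (metis dot_lmul_matrix sym inner_commute vector_transpose_matrix)
  have q: "0 \<le> a + 2 * b * t + c * t\<^sup>2" for t
  proof -
    have "(x + t *\<^sub>R y) \<bullet> (V *v (x + t *\<^sub>R y)) = a + 2 * b * t + c * t\<^sup>2"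
      by (simp add: matrix_vector_right_distrib inner_add_left inner_add_right a_def b'
          matrix_vector_mult_scaleR power2_eq_square c_def)
         (simp add: b_def algebra_simps)
    then show ?thesis using psd by metis
  qed
  show ?thesis
  proof (cases "c = 0")
    case True
    have "b = 0"
    proof (rule ccontr)
      assume "b \<noteq> 0"
      then show False using q[of "- (a + 1) / (2 * b)"] True by (simp add: field_simps)
    qed
    then show ?thesis using True by (simp add: a_def b_def c_def)
  next
    case False
    then have "c > 0" using psd[of y] by (simp add: c_def)
    have "0 \<le> a + 2 * b * (- b / c) + c * (- b / c)\<^sup>2" by (rule q)
    also have "\<dots> = a - b\<^sup>2 / c" using \<open>c > 0\<close> by (simp add: power2_eq_square field_simps)
    finally show ?thesis using \<open>c > 0\<close> by (simp add: field_simps flip: a_def b_def c_def)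
  qed
qed

text \<open>
  One step of Cholesky elimination subtracts the rank-one matrix of the pivot column. By
  Cauchy-Schwarz the remainder is positive semidefinite again, and its pivot column vanishes, so that the
  set of active indices shrinks.
\<close>
lemma psd_gram_on:
  fixes I :: "'q::finite set" and V :: "real ^ 'q ^ 'q"
  assumes "finite I" "transpose V = V" "\<And>x. 0 \<le> x \<bullet> (V *v x)"
    "\<And>j k. k \<notin> I \<Longrightarrow> V $ j $ k = 0"
  shows "\<exists>w :: 'q \<Rightarrow> 'q \<Rightarrow> real. \<forall>j k. V $ j $ k = (\<Sum>i\<in>I. w i j * w i k)"
  using assms
proof (induction I arbitrary: V rule: finite_induct)
  case empty
  then show ?case by simp
next
  case (insert i I V)
  define d where "d = V $ i $ i"
  have Vs: "V $ j $ k = V $ k $ j" for j k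
    using insert.prems(1) by (metis transpose_def vec_lambda_beta)
  have dx: "x \<bullet> (V *v axis i 1) = (\<Sum>j\<in>UNIV. x $ j * V $ j $ i)" for x
    by (simp add: matrix_vector_mult_basis column_def inner_vec_def)
  have d: "d = axis i 1 \<bullet> (V *v axis i 1)"
    by (simp add: d_def inner_axis' matrix_vector_mult_basis column_def)
  then have "d \<ge> 0" using insert.prems(2) by metis
  have CS: "(x \<bullet> (V *v axis i 1))\<^sup>2 \<le> (x \<bullet> (V *v x)) * d" for x
    unfolding d by (rule psd_Cauchy_Schwarz[OF insert.prems(1,2)])
  \<comment> \<open>A zero pivot forces a zero column, so that division by \<open>d = 0\<close>, which yields \<open>0\<close>, is harmless.\<close>
  have col0: "V $ j $ i = 0" if "d = 0" for j
    using CS[of "axis j 1"] that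
    by (simp add: inner_axis' matrix_vector_mult_basis column_def)
  define V' :: "real ^ 'q ^ 'q" where "V' = (\<chi> j k. V $ j $ k - V $ j $ i * V $ k $ i / d)"
  have "\<exists>w :: 'q \<Rightarrow> 'q \<Rightarrow> real. \<forall>j k. V' $ j $ k = (\<Sum>i\<in>I. w i j * w i k)"
  proof (rule insert.IH)
    show "transpose V' = V'"
      by (simp add: V'_def transpose_def vec_eq_iff Vs mult.commute)
    fix x
    have "(\<Sum>j\<in>UNIV. \<Sum>k\<in>UNIV. x $ j * (V $ j $ i * V $ k $ i / d) * x $ k)
        = (x \<bullet> (V *v axis i 1))\<^sup>2 / d"
      unfolding dx power2_eq_square sum_product sum_divide_distrib
      by (intro sum.cong refl) (simp add: field_simps)
    then have "x \<bullet> (V' *v x) = x \<bullet> (V *v x) - (x \<bullet> (V *v axis i 1))\<^sup>2 / d"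
      by (simp add: inner_vec_def V'_def matrix_vector_mult_def algebra_simps sum_subtractf
          sum_distrib_left)
    also have "\<dots> \<ge> 0" using CS[of x] \<open>d \<ge> 0\<close> insert.prems(2)[of x]
      by (cases "d = 0") (auto simp: field_simps)
    finally show "0 \<le> x \<bullet> (V' *v x)" .
  next
    fix j k assume "k \<notin> I"
    have "V $ j $ k = 0 \<and> V $ k $ i = 0" if "k \<noteq> i"
      using insert.prems(3)[of k] \<open>k \<notin> I\<close> that Vs[of k i] by simp
    then show "V' $ j $ k = 0"
      using col0 by (cases "k = i"; cases "d = 0") (simp_all add: V'_def flip: d_def)
  qed
  then obtain w where w: "\<And>j k. V' $ j $ k = (\<Sum>i\<in>I. w i j * w i k)" by blast
  show ?case
  proof (intro exI allI)
    fix j k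
    have "V $ j $ k = V' $ j $ k + V $ j $ i / sqrt d * (V $ k $ i / sqrt d)"
      using \<open>d \<ge> 0\<close> by (simp add: V'_def)
    then show "V $ j $ k = (\<Sum>l\<in>insert i I. (w(i := \<lambda>j. V $ j $ i / sqrt d)) l j
        * (w(i := \<lambda>j. V $ j $ i / sqrt d)) l k)"
      using insert.hyps w by (simp add: sum.insert_if) (intro sum.cong, auto)
  qed
qed

lemma psd_factorization:
  fixes V :: "real ^ 'q ^ 'q"
  assumes "transpose V = V" "\<And>x. 0 \<le> x \<bullet> (V *v x)"
  obtains A :: "real ^ 'q ^ 'q" where "A ** transpose A = V"
proof -
  obtain w :: "'q \<Rightarrow> 'q \<Rightarrow> real" where w: "\<And>j k. V $ j $ k = (\<Sum>i\<in>UNIV. w i j * w i k)"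
    using psd_gram_on[of UNIV V] assms by auto
  have "(\<chi> j i. w i j) ** transpose (\<chi> j i. w i j) = V"
    by (simp add: vec_eq_iff matrix_matrix_mult_def transpose_def w)
  then show ?thesis by (rule that)
qed

lemma outer_nth [simp]: "outer x y $ i $ k = x $ i * y $ k"
  by (simp add: outer_def matrix_matrix_mult_def columnvector_def rowvector_def)

lemma outer_mult_vec: "outer x y *v z = (y \<bullet> z) *\<^sub>R x"
  by (simp add: vec_eq_iff matrix_vector_mult_def inner_vec_def sum_distrib_left mult_ac)

lemma linear_matrix_mult_left: "linear (\<lambda>A :: real ^ 'n ^ 'm. A *v x)"
  by (rule linearI) (simp_all add: matrix_vector_mult_add_rdistrib scaleR_matrix_vector_assoc)

lemma bounded_linear_quadratic_form:
  "bounded_linear (\<lambda>A :: real ^ 'q ^ 'q. x \<bullet> (A *v x))"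
proof (rule linear_conv_bounded_linear[THEN iffD1])
  show "linear (\<lambda>A :: real ^ 'q ^ 'q. x \<bullet> (A *v x))"
    by (auto intro!: linearI simp: matrix_vector_mult_add_rdistrib scaleR_matrix_vector_assoc[symmetric]
        inner_add_right)
qed

lemma positive_definite_lower_bound:
  fixes A :: "real ^ 'q ^ 'q"
  assumes "positive_definite A"
  obtains \<rho> where "\<rho> > 0" "\<And>x. \<rho> * (norm x)\<^sup>2 \<le> x \<bullet> (A *v x)"
proof -
  have "continuous_on (sphere (0 :: real ^ 'q) 1) (\<lambda>x. x \<bullet> (A *v x))"
    by (intro continuous_intros linear_continuous_on linear_conv_bounded_linear[THEN iffD1] matrix_vector_mul_linear)
  moreover have "sphere (0 :: real ^ 'q) 1 \<noteq> {}" by simp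
  ultimately have "\<exists>x0\<in>sphere (0 :: real ^ 'q) 1. \<forall>x\<in>sphere 0 1. x0 \<bullet> (A *v x0) \<le> x \<bullet> (A *v x)"
    by (intro continuous_attains_inf) (rule compact_sphere)
  then obtain x0 where x0: "x0 \<in> sphere 0 1" "\<And>x. x \<in> sphere 0 1 \<Longrightarrow> x0 \<bullet> (A *v x0) \<le> x \<bullet> (A *v x)"
    by blast
  show ?thesis
  proof (rule that)
    have "x0 \<noteq> 0" using x0(1) by auto
    then show "0 < x0 \<bullet> (A *v x0)" using assms by (simp add: positive_definite_def)
    fix x :: "real ^ 'q"
    show "x0 \<bullet> (A *v x0) * (norm x)\<^sup>2 \<le> x \<bullet> (A *v x)"
    proof (cases "x = 0")
      case False
      let ?y = "(1 / norm x) *\<^sub>R x"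
      have "x0 \<bullet> (A *v x0) \<le> ?y \<bullet> (A *v ?y)" using False by (intro x0(2)) simp
      also have "\<dots> = (x \<bullet> (A *v x)) / (norm x)\<^sup>2"
        by (simp add: matrix_vector_mult_scaleR power2_eq_square)
      finally show ?thesis using False by (simp add: field_simps)
    qed simp
  qed
qed

text \<open>
  Concentration is proved entry by entry; this turns entrywise control into control of the
  operator.
\<close>
lemma norm_matrix_mult_le:
  fixes A :: "real ^ 'n ^ 'm"
  assumes "\<And>i k. \<bar>A $ i $ k\<bar> \<le> \<eta>"
  shows "norm (A *v x) \<le> real CARD('m) * real CARD('n) * \<eta> * norm x"
proof -
  have "0 \<le> \<eta>" using assms[of undefined undefined] by linarith
  have "norm (A *v x) \<le> (\<Sum>i\<in>UNIV. \<bar>(A *v x) $ i\<bar>)" by (rule norm_le_l1_cart)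
  also have "\<dots> \<le> (\<Sum>i\<in>(UNIV :: 'm set). \<Sum>k\<in>(UNIV :: 'n set). \<eta> * norm x)"
  proof (rule sum_mono)
    fix i
    have "\<bar>(A *v x) $ i\<bar> \<le> (\<Sum>k\<in>UNIV. \<bar>A $ i $ k * x $ k\<bar>)"
      unfolding matrix_vector_mult_def by (simp add: sum_abs)
    also have "\<dots> \<le> (\<Sum>k\<in>(UNIV :: 'n set). \<eta> * norm x)"
      using assms \<open>0 \<le> \<eta>\<close> component_le_norm_cart
      by (intro sum_mono) (auto simp: abs_mult intro!: mult_mono)
    finally show "\<bar>(A *v x) $ i\<bar> \<le> (\<Sum>k\<in>(UNIV :: 'n set). \<eta> * norm x)" .
  qed
  finally show ?thesis by simp
qed

lemma inner_transpose_mult: "x \<bullet> (transpose A *v y) = (A *v x) \<bullet> y"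
  for A :: "real ^ 'n ^ 'm"
  by (metis dot_lmul_matrix inner_commute vector_transpose_matrix)

section \<open>The standard normal vector\<close>

text \<open>
  Lebesgue measure on vectors is a product measure over the Basis; indexing by coordinates matches the
  product form of the density of the standard normal vector.
\<close>
lemma integral_lborel_prod:
  fixes h :: "'q::finite \<Rightarrow> real \<Rightarrow> complex"
  assumes int: "\<And>i. integrable lborel (h i)"
  shows "(\<integral>z. (\<Prod>i\<in>UNIV. h i (z $ i)) \<partial>(lborel :: (real ^ 'q) measure))
       = (\<Prod>i\<in>UNIV. \<integral>x. h i x \<partial>lborel)"
    and "integrable (lborel :: (real ^ 'q) measure) (\<lambda>z. \<Prod>i\<in>UNIV. h i (z $ i))"
proof -
  interpret product_sigma_finite "\<lambda>_::real ^ 'q. lborel :: real measure" ..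
  have [measurable]: "h i \<in> borel_measurable borel" for i
    using int[of i] by (auto dest: borel_measurable_integrable)
  have B: "(Basis :: (real ^ 'q) set) = (\<lambda>i. axis i 1) ` UNIV"
    by (auto simp: Basis_vec_def)
  have inj: "inj (\<lambda>i::'q. axis i (1::real))" by (auto simp: inj_on_def axis_eq_axis)
  define g where "g b = h (inv (\<lambda>i::'q. axis i (1::real)) b)" for b
  have g: "g (axis i 1) = h i" for i by (simp add: g_def inv_f_f[OF inj])
  have prodB: "(\<Prod>b\<in>Basis. r b) = (\<Prod>i\<in>UNIV. r (axis i 1))" for r :: "real ^ 'q \<Rightarrow> complex"
    unfolding B by (subst prod.reindex) (auto simp: inj)
  have intg: "integrable lborel (g b)" for b unfolding g_def by (rule int)
  have [measurable]: "g b \<in> borel_measurable borel" for b by (simp add: g_def)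
  have eq: "(\<Prod>i\<in>UNIV. h i (z $ i)) = (\<Prod>b\<in>Basis. g b (z \<bullet> b))" for z :: "real ^ 'q"
    by (simp add: prodB g inner_axis)
  have m: "(\<lambda>f. \<Sum>b\<in>Basis. f b *\<^sub>R b) \<in> (\<Pi>\<^sub>M b\<in>(Basis :: (real ^ 'q) set). lborel) \<rightarrow>\<^sub>M borel"
    by measurable
  have e2: "(\<Prod>b\<in>Basis. g b ((\<Sum>b\<in>Basis. f b *\<^sub>R b) \<bullet> b)) = (\<Prod>b\<in>Basis. g b (f b))" for f
    by (intro prod.cong refl) simp
  have "(\<integral>z. (\<Prod>b\<in>Basis. g b (z \<bullet> b)) \<partial>(lborel :: (real ^ 'q) measure))
      = (\<integral>f. (\<Prod>b\<in>Basis. g b (f b)) \<partial>(\<Pi>\<^sub>M b\<in>Basis. lborel))"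
    by (subst lborel_eq, subst integral_distr[OF m]) (simp_all add: e2)
  also have "\<dots> = (\<Prod>b\<in>Basis. \<integral>x. g b x \<partial>lborel)"
    by (rule product_integral_prod) (auto intro: intg)
  finally show "(\<integral>z. (\<Prod>i\<in>UNIV. h i (z $ i)) \<partial>(lborel :: (real ^ 'q) measure))
       = (\<Prod>i\<in>UNIV. \<integral>x. h i x \<partial>lborel)"
    by (simp add: eq prodB g)
  have "integrable (\<Pi>\<^sub>M b\<in>(Basis :: (real ^ 'q) set). lborel) (\<lambda>f. \<Prod>b\<in>Basis. g b (f b))"
    by (rule product_integrable_prod) (auto intro: intg)
  then have "integrable (lborel :: (real ^ 'q) measure) (\<lambda>z. \<Prod>b\<in>Basis. g b (z \<bullet> b))"
    by (subst lborel_eq, subst integrable_distr_eq[OF m]) (simp_all add: e2)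
  then show "integrable (lborel :: (real ^ 'q) measure) (\<lambda>z. \<Prod>i\<in>UNIV. h i (z $ i))"
    by (simp add: eq)
qed

lemma std_normal_vec_iexp:
  fixes s :: "real ^ 'q"
  shows "(\<integral>z. iexp (s \<bullet> z) \<partial>std_normal_vec) = exp (- (norm s)\<^sup>2 / 2)"
    and "integrable std_normal_vec (\<lambda>z. iexp (s \<bullet> z))"
proof -
  let ?h = "\<lambda>i x. std_normal_density x *\<^sub>R iexp (s $ i * x)"
  have int: "integrable lborel (?h i)" for i
  proof -
    interpret real_distribution std_normal_distribution by (rule real_dist_normal_dist)
    have "integrable std_normal_distribution (\<lambda>x. iexp (s $ i * x))"
      by (rule integrable_const_bound[where B=1]) auto
    then show ?thesis by (subst (asm) integrable_density) auto
  qed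
  have val: "(\<integral>x. ?h i x \<partial>lborel) = exp (- (s $ i)\<^sup>2 / 2)" for i
  proof -
    have "(\<integral>x. ?h i x \<partial>lborel) = char std_normal_distribution (s $ i)"
      unfolding char_def by (subst integral_density) auto
    then show ?thesis by (simp add: char_std_normal_distribution)
  qed
  have eq: "(\<Prod>i\<in>UNIV. std_normal_density (z $ i)) *\<^sub>R iexp (s \<bullet> z) = (\<Prod>i\<in>UNIV. ?h i (z $ i))"
    for z :: "real ^ 'q"
    by (simp add: inner_vec_def scaleR_conv_of_real prod.distrib exp_sum sum_distrib_left)
  have "(\<integral>z. iexp (s \<bullet> z) \<partial>std_normal_vec) = (\<integral>z. (\<Prod>i\<in>UNIV. ?h i (z $ i)) \<partial>lborel)"
    unfolding std_normal_vec_def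
    by (subst integral_density) (auto simp: eq intro!: prod_nonneg)
  also have "\<dots> = (\<Prod>i\<in>UNIV. complex_of_real (exp (- (s $ i)\<^sup>2 / 2)))"
    by (subst integral_lborel_prod(1)[OF int]) (simp only: val)
  also have "\<dots> = complex_of_real (exp (\<Sum>i\<in>UNIV. - (s $ i)\<^sup>2 / 2))" by (simp add: exp_sum)
  also have "(\<Sum>i\<in>UNIV. - (s $ i)\<^sup>2 / 2) = - (norm s)\<^sup>2 / 2"
    unfolding power2_norm_eq_inner inner_vec_def sum_divide_distrib[symmetric] sum_negf
    by (simp add: power2_eq_square)
  finally show "(\<integral>z. iexp (s \<bullet> z) \<partial>std_normal_vec) = exp (- (norm s)\<^sup>2 / 2)" .
  show "integrable std_normal_vec (\<lambda>z. iexp (s \<bullet> z))"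
    unfolding std_normal_vec_def
    by (subst integrable_density)
      (auto simp: eq simp del: scaleR_conv_of_real intro!: prod_nonneg
        integral_lborel_prod(2)[OF int, simplified])
qed

lemma sets_std_normal_vec [simp, measurable_cong]: "sets std_normal_vec = sets borel"
  and space_std_normal_vec [simp]: "space std_normal_vec = UNIV"
  by (simp_all add: std_normal_vec_def)

lemma prob_space_std_normal_vec: "prob_space (std_normal_vec :: (real ^ 'q) measure)"
proof
  have 1: "integrable (std_normal_vec :: (real ^ 'q) measure) (\<lambda>z. 1::complex)"
    using std_normal_vec_iexp(2)[of 0] by simp
  then have fin: "finite_measure (std_normal_vec :: (real ^ 'q) measure)"
    by (intro finite_measureI) (auto simp: integrable_iff_bounded)
  have "(\<integral>z. 1 \<partial>(std_normal_vec :: (real ^ 'q) measure)) = (1::complex)"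
    using std_normal_vec_iexp(1)[of 0] by simp
  then have "measure (std_normal_vec :: (real ^ 'q) measure) UNIV = 1"
    by (simp add: complex_eq_iff scaleR_conv_of_real)
  then show "emeasure (std_normal_vec :: (real ^ 'q) measure) (space std_normal_vec) = 1"
    using finite_measure.emeasure_eq_measure[OF fin] by simp
qed

text \<open>
  Cosines with an arbitrary phase carry the same information as the complex characteristic
  function, and keep the whole argument real.
\<close>
lemma std_normal_vec_cos:
  fixes s :: "real ^ 'q"
  shows "(\<integral>z. cos (s \<bullet> z + c) \<partial>std_normal_vec) = exp (- (norm s)\<^sup>2 / 2) * cos c"
proof -
  have eq: "cos (s \<bullet> z + c) = Re (iexp (s \<bullet> z) * iexp c)" for z :: "real ^ 'q"
    by (simp add: cis_conv_exp[symmetric] cos_add)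
  have "(\<integral>z. cos (s \<bullet> z + c) \<partial>std_normal_vec) = Re (\<integral>z. iexp (s \<bullet> z) * iexp c \<partial>std_normal_vec)"
    unfolding eq by (intro integral_Re integrable_mult_left std_normal_vec_iexp(2))
  also have "\<dots> = Re (of_real (exp (- (norm s)\<^sup>2 / 2)) * iexp c)"
    by (simp add: std_normal_vec_iexp)
  finally show ?thesis by (simp add: cis_conv_exp[symmetric])
qed

section \<open>Real analysis\<close>

text \<open>
  By the mean value theorem the increment is \<open>d\<close> times the derivative at an intermediate point, which
  the Lipschitz condition moves back to \<open>x\<close>.
\<close>
lemma taylor_remainder_Lipschitz:
  fixes f f' :: "real \<Rightarrow> real"
  assumes "\<And>x. (f has_real_derivative f' x) (at x)" "\<And>x y. \<bar>f' x - f' y\<bar> \<le> C * \<bar>x - y\<bar>"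
  shows "\<bar>f (x + d) - f x - d * f' x\<bar> \<le> C * d\<^sup>2"
proof -
  have "\<exists>z. f (x + d) - f x = d * f' z \<and> \<bar>z - x\<bar> \<le> \<bar>d\<bar>"
  proof (cases "d = 0")
    case False
    then consider "x < x + d" | "x + d < x" by linarith
    then show ?thesis
    proof cases
      case 1
      from MVT2[OF this, of f f'] assms(1)
      obtain z where "x < z" "z < x + d" "f (x + d) - f x = (x + d - x) * f' z" by blast
      then show ?thesis by (intro exI[of _ z]) auto
    next
      case 2
      from MVT2[OF this, of f f'] assms(1)
      obtain z where "x + d < z" "z < x" "f x - f (x + d) = (x - (x + d)) * f' z" by blast
      then show ?thesis by (intro exI[of _ z]) auto
    qed
  qed (auto intro!: exI[of _ x])
  then obtain z where z: "f (x + d) - f x = d * f' z" "\<bar>z - x\<bar> \<le> \<bar>d\<bar>" by blast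
  have "0 \<le> C" using assms(2)[of 1 0] by simp
  have "\<bar>f (x + d) - f x - d * f' x\<bar> = \<bar>d\<bar> * \<bar>f' z - f' x\<bar>"
    by (simp only: z(1) abs_mult[symmetric] right_diff_distrib)
  also have "\<dots> \<le> \<bar>d\<bar> * (C * \<bar>d\<bar>)"
    using assms(2)[of z x] z(2) \<open>0 \<le> C\<close> by (intro mult_left_mono order_trans[OF assms(2)]) auto
  finally show ?thesis by (simp add: power2_eq_square mult.left_commute abs_mult_self_eq)
qed

lemma Lipschitz_if_bounded_deriv:
  fixes f f' :: "real \<Rightarrow> real"
  assumes "\<And>x. (f has_real_derivative f' x) (at x)" "\<And>x. \<bar>f' x\<bar> \<le> C"
  shows "\<bar>f x - f y\<bar> \<le> C * \<bar>x - y\<bar>"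
  using field_differentiable_bound[of UNIV f f' C x y] assms by simp

lemma sin_Lipschitz: "\<bar>sin x - sin y\<bar> \<le> \<bar>x - y\<bar>" for x y :: real
  using Lipschitz_if_bounded_deriv[of sin cos 1 x y] by (auto intro: derivative_eq_intros)

lemma cos_Lipschitz: "\<bar>cos x - cos y\<bar> \<le> \<bar>x - y\<bar>" for x y :: real
  using Lipschitz_if_bounded_deriv[of cos "\<lambda>x. - sin x" 1 x y] by (auto intro: derivative_eq_intros)

lemma sin_remainder: "\<bar>sin b - sin (b - d) - d * cos b\<bar> \<le> d\<^sup>2" for b d :: real
  using taylor_remainder_Lipschitz[of sin cos 1 b "- d"] cos_Lipschitz
  by (auto intro: derivative_eq_intros simp: abs_minus_commute)

lemma cos_remainder: "\<bar>cos (b + d) - cos b - d * (- sin b)\<bar> \<le> d\<^sup>2" for b d :: real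
  using taylor_remainder_Lipschitz[of cos "\<lambda>x. - sin x" 1 b d] sin_Lipschitz
  by (auto intro: derivative_eq_intros simp: abs_minus_commute)

lemma deriv_if_quadratic_remainder:
  fixes F :: "real \<Rightarrow> real"
  assumes "\<And>h. \<bar>F (s + h) - F s - h * D\<bar> \<le> C * h\<^sup>2"
  shows "(F has_real_derivative D) (at s)"
proof -
  have "(\<lambda>h. (F (s + h) - F s) / h - D) \<midarrow>0\<rightarrow> 0"
  proof (rule Lim_null_comparison[where g="\<lambda>h. C * \<bar>h\<bar>"])
    show "\<forall>\<^sub>F h in at 0. norm ((F (s + h) - F s) / h - D) \<le> C * \<bar>h\<bar>"
    proof (rule eventually_at_filter[THEN iffD2], rule always_eventually, intro allI impI)
      fix h :: real assume "h \<noteq> 0"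
      then have "norm ((F (s + h) - F s) / h - D) = \<bar>F (s + h) - F s - h * D\<bar> / \<bar>h\<bar>"
        by (simp add: field_simps abs_divide[symmetric] del: abs_divide)
      also have "\<dots> \<le> C * h\<^sup>2 / \<bar>h\<bar>" using assms by (intro divide_right_mono) auto
      also have "\<dots> = C * \<bar>h\<bar>" using \<open>h \<noteq> 0\<close>
        by (simp add: field_simps power2_eq_square abs_mult_self_eq)
      finally show "norm ((F (s + h) - F s) / h - D) \<le> C * \<bar>h\<bar>" .
    qed
    show "(\<lambda>h. C * \<bar>h\<bar>) \<midarrow>0\<rightarrow> 0" by (auto intro!: tendsto_eq_intros)
  qed
  then show ?thesis by (simp add: DERIV_def LIM_zero_iff)
qed

text \<open>
  The equation \<open>F' s = - s V F s\<close> has the solution \<open>F s = exp (- V s\<^sup>2 / 2) * F 0\<close>. The integrating factor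
  is at most \<open>exp (V / 2)\<close> on the unit interval and is divided out at \<open>s = 1\<close>, so a perturbation \<open>D\<close> of the
  equation costs at most \<open>D\<close>.
\<close>
lemma gaussian_ode_stability:
  fixes F F' :: "real \<Rightarrow> real"
  assumes F: "\<And>s. (F has_real_derivative F' s) (at s)" and "V \<ge> 0"
    and err: "\<And>s. 0 \<le> s \<Longrightarrow> s \<le> 1 \<Longrightarrow> \<bar>F' s + s * V * F s\<bar> \<le> D"
  shows "\<bar>F 1 - exp (- V / 2) * F 0\<bar> \<le> D"
proof -
  define G where "G s = exp (V * s\<^sup>2 / 2) * F s" for s
  have "(G has_real_derivative exp (V * s\<^sup>2 / 2) * (F' s + s * V * F s)) (at s)" for s
    unfolding G_def by (auto intro!: derivative_eq_intros F simp: algebra_simps)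
  from MVT2[OF zero_less_one this]
  obtain z where z: "0 < z" "z < 1" "G 1 - G 0 = exp (V * z\<^sup>2 / 2) * (F' z + z * V * F z)" by auto
  have "\<bar>G 1 - G 0\<bar> \<le> exp (V / 2) * D"
    unfolding z(3) abs_mult
  proof (intro mult_mono)
    have "V * z\<^sup>2 \<le> V * 1" using z \<open>V \<ge> 0\<close> by (intro mult_left_mono) (auto simp: power_le_one)
    then show "\<bar>exp (V * z\<^sup>2 / 2)\<bar> \<le> exp (V / 2)" by simp
  qed (use err[of z] z in auto)
  moreover have "F 1 - exp (- V / 2) * F 0 = exp (- V / 2) * (G 1 - G 0)"
    by (simp add: G_def algebra_simps exp_minus)
  ultimately have "\<bar>F 1 - exp (- V / 2) * F 0\<bar> \<le> exp (- V / 2) * (exp (V / 2) * D)"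
    by (simp add: abs_mult)
  also have "\<dots> = D" by (simp add: exp_minus)
  finally show ?thesis .
qed

section \<open>Convergence in law from cosine expectations\<close>

text \<open>
  The linear span of the waves \<open>cos (t \<bullet> x + c)\<close>. Sines are included through the phase.
\<close>
inductive trig_polynomial :: "('b::real_inner \<Rightarrow> real) \<Rightarrow> bool" where
  wave: "trig_polynomial (\<lambda>x. cos (t \<bullet> x + c))"
| scale: "trig_polynomial f \<Longrightarrow> trig_polynomial (\<lambda>x. a * f x)"
| add: "trig_polynomial f \<Longrightarrow> trig_polynomial g \<Longrightarrow> trig_polynomial (\<lambda>x. f x + g x)"

lemma trig_polynomial_const: "trig_polynomial (\<lambda>x. a)"
  using trig_polynomial.scale[OF trig_polynomial.wave[of 0 0], of a] by simp

lemma trig_polynomial_sum: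
  "finite I \<Longrightarrow> (\<And>i. i \<in> I \<Longrightarrow> trig_polynomial (f i)) \<Longrightarrow> trig_polynomial (\<lambda>x. \<Sum>i\<in>I. f i x)"
  by (induction I rule: finite_induct) (auto intro: trig_polynomial.add trig_polynomial_const)

text \<open>
  By the product-to-sum formula the span is an algebra. This is what lets polynomial approximation
  be transferred to waves.
\<close>
lemma trig_polynomial_mult:
  "trig_polynomial f \<Longrightarrow> trig_polynomial g \<Longrightarrow> trig_polynomial (\<lambda>x. f x * g x)"
proof (induction rule: trig_polynomial.induct)
  case (wave t c)
  from wave show ?case
  proof (induction rule: trig_polynomial.induct)
    case (wave t' c')
    have "cos (t \<bullet> x + c) * cos (t' \<bullet> x + c')
        = (1/2) * cos ((t + t') \<bullet> x + (c + c')) + (1/2) * cos ((t - t') \<bullet> x + (c - c'))" for x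
      by (subst cos_times_cos) (simp add: inner_add_left inner_diff_left algebra_simps)
    then show ?case
      by (simp only:) (intro trig_polynomial.intros)
  next
    case (scale f a)
    then show ?case using trig_polynomial.scale[of _ a] by (simp add: mult.left_commute)
  next
    case (add f g)
    then show ?case using trig_polynomial.add by (simp add: distrib_left)
  qed
next
  case (scale f a)
  then show ?case using trig_polynomial.scale[of _ a] by (simp add: mult.assoc)
next
  case (add f g)
  then show ?case using trig_polynomial.add by (simp add: distrib_right)
qed

lemma trig_polynomial_of_polynomial:
  fixes p :: "real ^ 'q \<Rightarrow> real"
  shows "real_polynomial_function p \<Longrightarrow> trig_polynomial (\<lambda>x. p (\<chi> i. sin (x $ i / R)))"
proof (induction rule: real_polynomial_function.induct)
  case (linear f)
  then have lin: "linear f" by (rule bounded_linear.linear)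
  have s: "sin (x $ i / R) = cos (axis i (1 / R) \<bullet> x + - (pi / 2))" for x :: "real ^ 'q" and i
    by (subst cos_add) (simp add: inner_axis')
  have f: "f y = (\<Sum>i\<in>UNIV. f (axis i 1) * y $ i)" for y :: "real ^ 'q"
  proof -
    have "f y = f (\<Sum>i\<in>UNIV. y $ i *\<^sub>R axis i 1)" 
      by (simp only: basis_expansion scalar_mult_eq_scaleR[symmetric])
    also have "\<dots> = (\<Sum>i\<in>UNIV. y $ i * f (axis i 1))"
      by (simp add: linear_sum[OF lin] linear_scale[OF lin])
    finally show ?thesis by (simp only: mult.commute)
  qed
  have eq: "(\<lambda>x :: real ^ 'q. f (\<chi> i. sin (x $ i / R)))
      = (\<lambda>x. \<Sum>i\<in>UNIV. f (axis i 1) * cos (axis i (1 / R) \<bullet> x + - (pi / 2)))"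
    by (rule ext, subst f) (simp only: s vec_lambda_beta)
  show ?case unfolding eq
    by (intro trig_polynomial_sum trig_polynomial.scale trig_polynomial.wave) simp
next
  case (const c)
  show ?case by (rule trig_polynomial_const)
next
  case (add f g)
  then show ?case by (intro trig_polynomial.add)
next
  case (mult f g)
  then show ?case by (intro trig_polynomial_mult)
qed

lemma trig_polynomial_continuous: "trig_polynomial f \<Longrightarrow> continuous_on UNIV f"
  by (induction rule: trig_polynomial.induct) (auto intro!: continuous_intros)

lemma trig_polynomial_bounded: "trig_polynomial f \<Longrightarrow> \<exists>B. \<forall>x. \<bar>f x\<bar> \<le> B"
proof (induction rule: trig_polynomial.induct)
  case (wave t c)
  show ?case by (intro exI[of _ 1]) simp
next
  case (scale f a)
  then obtain B where "\<And>x. \<bar>f x\<bar> \<le> B" by blast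
  then show ?case by (intro exI[of _ "\<bar>a\<bar> * B"]) (simp add: abs_mult mult_left_mono)
next
  case (add f g)
  then obtain B B' where "\<And>x. \<bar>f x\<bar> \<le> B" "\<And>x. \<bar>g x\<bar> \<le> B'" by blast
  then show ?case
    by (intro exI[of _ "B + B'"] allI order_trans[OF abs_triangle_ineq] add_mono)
qed

text \<open>
  Approximating \<open>g\<close> by waves on a ball gives no control outside of it. Composing a polynomial with
  the sines of the coordinates does: the argument stays in the cube on which the polynomial is close to the
  bounded function \<open>g (r arcsin y)\<close>, so the approximant is bounded by \<open>B + e\<close> everywhere.
\<close>
lemma trig_approximation:
  fixes g :: "real ^ 'q \<Rightarrow> real"
  assumes g: "continuous_on UNIV g" "\<And>x. \<bar>g x\<bar> \<le> B" and "r > 0" "e > 0"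
  obtains f where "trig_polynomial f" "\<And>x. \<bar>f x\<bar> \<le> B + e" "\<And>x. norm x \<le> r \<Longrightarrow> \<bar>g x - f x\<bar> \<le> e"
proof -
  let ?C = "cbox (\<chi> i. - 1) (\<chi> i. 1) :: (real ^ 'q) set"
  \<comment> \<open>If \<open>norm x \<le> r\<close>, then \<open>x i / r\<close> lies in \<open>[-1, 1]\<close>, where the arcsine inverts the sine.\<close>
  let ?h = "\<lambda>y :: real ^ 'q. g (\<chi> i. r * arcsin (y $ i))"
  have "continuous_on ?C ?h"
    by (rule continuous_on_compose2[OF g(1)])
       (auto intro!: continuous_intros simp: mem_box_cart)
  then obtain p where p: "real_polynomial_function p" "\<And>y. y \<in> ?C \<Longrightarrow> \<bar>?h y - p y\<bar> < e"
    using Stone_Weierstrass_real_polynomial_function[of ?C ?h e] \<open>e > 0\<close> by auto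
  let ?f = "\<lambda>x. p (\<chi> i. sin (x $ i / r))"
  have C: "(\<chi> i. sin (x $ i / r)) \<in> ?C" for x :: "real ^ 'q"
    by (simp add: mem_box_cart)
  show ?thesis
  proof
    show "trig_polynomial ?f" by (rule trig_polynomial_of_polynomial[OF p(1)])
    fix x :: "real ^ 'q"
    show "\<bar>?f x\<bar> \<le> B + e"
      using p(2)[OF C[of x]] g(2)[of "\<chi> i. r * arcsin ((\<chi> i. sin (x $ i / r)) $ i)"] by linarith
    assume "norm x \<le> r"
    have "r * arcsin (sin (x $ i / r)) = x $ i" for i
    proof -
      have "\<bar>x $ i\<bar> \<le> r" using component_le_norm_cart[of x i] \<open>norm x \<le> r\<close> by linarith
      then have "\<bar>x $ i / r\<bar> \<le> 1" using \<open>r > 0\<close> by simp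
      moreover have "1 \<le> pi / 2" using pi_ge_two by simp
      ultimately have "arcsin (sin (x $ i / r)) = x $ i / r" by (intro arcsin_sin) linarith+
      then show ?thesis using \<open>r > 0\<close> by simp
    qed
    then have "(\<chi> i. r * arcsin ((\<chi> i. sin (x $ i / r)) $ i)) = x" by (simp add: vec_eq_iff)
    then show "\<bar>g x - ?f x\<bar> \<le> e" using p(2)[OF C[of x]] by simp
  qed
qed

text \<open>
  On the ball the two integrands differ by at most \<open>e\<close>, off the ball by at most \<open>2 B + e\<close>.
\<close>
lemma (in prob_space) expectation_close_off_tail:
  fixes Z :: "'a \<Rightarrow> real ^ 'q"
  assumes [measurable]: "Z \<in> borel_measurable M" "f \<in> borel_measurable borel" "g \<in> borel_measurable borel"
    and bd: "\<And>x. \<bar>g x\<bar> \<le> B" "\<And>x. \<bar>f x\<bar> \<le> B + e" "\<And>x. norm x \<le> r \<Longrightarrow> \<bar>g x - f x\<bar> \<le> e" and "e > 0"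
  shows "\<bar>expectation (\<lambda>w. g (Z w)) - expectation (\<lambda>w. f (Z w))\<bar>
         \<le> e + (2 * B + e) * prob {w\<in>space M. r < norm (Z w)}"
proof -
  let ?A = "{w\<in>space M. r < norm (Z w)}"
  have "B \<ge> 0" using bd(1)[of 0] by linarith
  have ig: "integrable M (\<lambda>w. g (Z w))" by (rule integrable_const_bound[where B=B]) (simp_all add: bd(1))
  have "integrable M (\<lambda>w. f (Z w))" by (rule integrable_const_bound[where B="B + e"]) (simp_all add: bd(2))
  note int = ig this
  have "\<bar>expectation (\<lambda>w. g (Z w)) - expectation (\<lambda>w. f (Z w))\<bar>
      = \<bar>expectation (\<lambda>w. g (Z w) - f (Z w))\<bar>" using int by simp
  also have "\<dots> \<le> expectation (\<lambda>w. \<bar>g (Z w) - f (Z w)\<bar>)" by (rule integral_abs_bound)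
  also have "\<dots> \<le> expectation (\<lambda>w. e + (2 * B + e) * indicator ?A w)"
  proof (rule integral_mono)
    fix w assume "w \<in> space M"
    show "\<bar>g (Z w) - f (Z w)\<bar> \<le> e + (2 * B + e) * indicator ?A w"
      using bd(1,2)[of "Z w"] bd(3)[of "Z w"] \<open>w \<in> space M\<close> \<open>e > 0\<close>
      by (cases "norm (Z w) \<le> r") (auto split: split_indicator)
  next
    show "integrable M (\<lambda>w. \<bar>g (Z w) - f (Z w)\<bar>)" using int by simp
    show "integrable M (\<lambda>w. e + (2 * B + e) * indicator ?A w)"
      by (simp add: integrable_indicator_iff less_top[symmetric])
  qed
  also have "\<dots> = e + (2 * B + e) * prob ?A"
  proof -
    have "integrable M (\<lambda>w. indicator ?A w :: real)" by (simp add: less_top[symmetric])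
    moreover have "?A \<inter> space M = ?A" by blast
    ultimately show ?thesis by (simp add: prob_space)
  qed
  finally show ?thesis .
qed

text \<open>
  The limits of cosine expectations extend by linearity to all trigonometric polynomials. Tightness
  makes up for the fact that these approximate a given function only on balls.
\<close>
lemma converges_in_law_cosI:
  fixes Z :: "nat \<Rightarrow> 'a \<Rightarrow> real ^ 'q"
  assumes M: "prob_space M" and N: "prob_space N" and sN[measurable_cong]: "sets N = sets borel"
    and Z: "\<forall>\<^sub>F n in sequentially. Z n \<in> borel_measurable M"
    and lim: "\<And>t c. (\<lambda>n. \<integral>w. cos (t \<bullet> Z n w + c) \<partial>M) \<longlonglongrightarrow> (\<integral>x. cos (t \<bullet> x + c) \<partial>N)"
    and tight: "\<And>e. e > 0 \<Longrightarrow> \<exists>r. \<forall>\<^sub>F n in sequentially. measure M {w\<in>space M. r < norm (Z n w)} \<le> e"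
  shows "converges_in_law M Z N"
  unfolding converges_in_law_def
proof (intro allI impI)
  interpret M: prob_space M by fact
  interpret N: prob_space N by fact
  fix g :: "real ^ 'q \<Rightarrow> real"
  assume g: "continuous_on UNIV g \<and> bounded (range g)"
  then obtain B0 where "\<And>x. norm (g x) \<le> B0" by (auto simp: bounded_iff)
  then obtain B where B: "\<And>x. \<bar>g x\<bar> \<le> B" "B \<ge> 0" by (metis abs_ge_zero order_trans real_norm_def)
  have [measurable]: "g \<in> borel_measurable borel" using g by (intro borel_measurable_continuous_onI) simp
  have limT: "(\<lambda>n. \<integral>w. f (Z n w) \<partial>M) \<longlonglongrightarrow> (\<integral>x. f x \<partial>N)" if "trig_polynomial f" for f
    using that
  proof (induction rule: trig_polynomial.induct)
    case (wave t c)
    show ?case by (rule lim)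
  next
    case (scale f a)
    then show ?case by (auto intro!: tendsto_intros)
  next
    case (add f h)
    have i: "integrable M (\<lambda>w. k (W w))"
      if k: "trig_polynomial k" and [measurable]: "W \<in> borel_measurable M" for k W
    proof -
      have [measurable]: "k \<in> borel_measurable borel"
        using trig_polynomial_continuous[OF k] by (intro borel_measurable_continuous_onI)
      obtain b where "\<And>x. \<bar>k x\<bar> \<le> b" using trig_polynomial_bounded[OF k] by blast
      then show ?thesis by (intro M.integrable_const_bound[where B=b]) auto
    qed
    have i1: "integrable N (\<lambda>x. k x)" if k: "trig_polynomial k" for k
    proof -
      have [measurable]: "k \<in> borel_measurable borel"
        using trig_polynomial_continuous[OF k] by (intro borel_measurable_continuous_onI)
      obtain b where "\<And>x. \<bar>k x\<bar> \<le> b" using trig_polynomial_bounded[OF k] by blast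
      then show ?thesis by (intro N.integrable_const_bound[where B=b]) auto
    qed
    have "(\<lambda>n. (\<integral>w. f (Z n w) \<partial>M) + (\<integral>w. h (Z n w) \<partial>M)) \<longlonglongrightarrow> (\<integral>x. f x \<partial>N) + (\<integral>x. h x \<partial>N)"
      by (intro tendsto_add add.IH)
    also have "(\<integral>x. f x \<partial>N) + (\<integral>x. h x \<partial>N) = (\<integral>x. f x + h x \<partial>N)"
      using i1 add.hyps by simp
    finally have L: "(\<lambda>n. (\<integral>w. f (Z n w) \<partial>M) + (\<integral>w. h (Z n w) \<partial>M))
        \<longlonglongrightarrow> (\<integral>x. f x + h x \<partial>N)" .
    have "\<forall>\<^sub>F n in sequentially. (\<integral>w. f (Z n w) \<partial>M) + (\<integral>w. h (Z n w) \<partial>M)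
        = (\<integral>w. f (Z n w) + h (Z n w) \<partial>M)"
      using Z by eventually_elim (simp add: i add.hyps)
    with L show ?case by (rule Lim_transform_eventually)
  qed
  show "(\<lambda>n. \<integral>w. g (Z n w) \<partial>M) \<longlonglongrightarrow> (\<integral>x. g x \<partial>N)"
  proof (rule tendstoI)
    fix \<eta> :: real assume "\<eta> > 0"
    define e where "e = min 1 (\<eta> / (2 * (5 + 4 * B)))"
    have e: "e > 0" "e \<le> 1" "(5 + 4 * B) * e < \<eta>"
    proof -
      show "e > 0" "e \<le> 1" using \<open>\<eta> > 0\<close> \<open>B \<ge> 0\<close> by (auto simp: e_def)
      have "(5 + 4 * B) * e \<le> (5 + 4 * B) * (\<eta> / (2 * (5 + 4 * B)))"
        using \<open>B \<ge> 0\<close> by (intro mult_left_mono) (auto simp: e_def)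
      also have "\<dots> = \<eta> / 2" using \<open>B \<ge> 0\<close> by (simp add: field_simps)
      finally show "(5 + 4 * B) * e < \<eta>" using \<open>\<eta> > 0\<close> by simp
    qed
    obtain r1 where r1: "\<forall>\<^sub>F n in sequentially. measure M {w\<in>space M. r1 < norm (Z n w)} \<le> e"
      using tight \<open>e > 0\<close> by blast
    have "\<exists>r2 :: nat. measure N {x \<in> space N. real r2 < norm x} < e"
    proof -
      have "(\<lambda>k. measure N {x \<in> space N. real k < norm x}) \<longlonglongrightarrow> measure N (\<Inter>k. {x \<in> space N. real k < norm x})"
        by (intro N.finite_Lim_measure_decseq) (auto simp: decseq_def)
      moreover have "(\<Inter>k. {x \<in> space N. real k < norm x}) = {}"
      proof (intro equals0I)
        fix x assume "x \<in> (\<Inter>k. {x \<in> space N. real k < norm x})"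
        moreover obtain k where "norm x \<le> real k" using real_arch_simple by blast
        ultimately show False by (auto dest!: spec[of _ k])
      qed
      ultimately have "(\<lambda>k. measure N {x \<in> space N. real k < norm x}) \<longlonglongrightarrow> 0" by simp
      from order_tendstoD(2)[OF this \<open>e > 0\<close>] show ?thesis
        by (auto simp: eventually_sequentially)
    qed
    then obtain r2 :: nat where r2: "measure N {x \<in> space N. real r2 < norm x} < e" ..
    define r where "r = max 1 (max r1 r2)"
    have "r > 0" by (simp add: r_def)
    obtain f where f: "trig_polynomial f" "\<And>x. \<bar>f x\<bar> \<le> B + e" "\<And>x. norm x \<le> r \<Longrightarrow> \<bar>g x - f x\<bar> \<le> e"
      using trig_approximation[of g B r e] g B \<open>r > 0\<close> \<open>e > 0\<close> by metis
    have [measurable]: "f \<in> borel_measurable borel"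
      using trig_polynomial_continuous[OF f(1)] by (intro borel_measurable_continuous_onI)
    have small: "e + (2 * B + e) * p \<le> (2 + 2 * B) * e" if "p \<le> e" "0 \<le> p" for p
    proof -
      have "(2 * B + e) * p \<le> (2 * B + 1) * e"
        using that e B(2) by (intro mult_mono) auto
      then show ?thesis by (simp add: algebra_simps)
    qed
    have gN: "\<bar>(\<integral>x. g x \<partial>N) - (\<integral>x. f x \<partial>N)\<bar> \<le> (2 + 2 * B) * e"
    proof -
      have "measure N {x \<in> space N. r < norm x} \<le> measure N {x \<in> space N. real r2 < norm x}"
        by (intro N.finite_measure_mono) (auto simp: r_def)
      then have "measure N {x \<in> space N. r < norm x} \<le> e" using r2 by linarith
      from small[OF this] show ?thesis
        using N.expectation_close_off_tail[of "\<lambda>x. x" f g B e r] B f e by auto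
    qed
    have "\<forall>\<^sub>F n in sequentially. \<bar>(\<integral>w. f (Z n w) \<partial>M) - (\<integral>x. f x \<partial>N)\<bar> < e"
      using tendstoD[OF limT[OF f(1)] \<open>e > 0\<close>] by (simp add: dist_real_def)
    with r1 Z show "\<forall>\<^sub>F n in sequentially. dist (\<integral>w. g (Z n w) \<partial>M) (\<integral>x. g x \<partial>N) < \<eta>"
    proof eventually_elim
      case (elim n)
      note [measurable] = \<open>Z n \<in> borel_measurable M\<close>
      have "measure M {w \<in> space M. r < norm (Z n w)} \<le> measure M {w \<in> space M. r1 < norm (Z n w)}"
        by (intro M.finite_measure_mono) (auto simp: r_def)
      then have "measure M {w \<in> space M. r < norm (Z n w)} \<le> e" using elim by linarith
      from small[OF this] have "\<bar>(\<integral>w. g (Z n w) \<partial>M) - (\<integral>w. f (Z n w) \<partial>M)\<bar> \<le> (2 + 2 * B) * e"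
        using M.expectation_close_off_tail[of "Z n" f g B e r] B f e by auto
      then have "\<bar>(\<integral>w. g (Z n w) \<partial>M) - (\<integral>x. g x \<partial>N)\<bar> < (2 + 2 * B) * e + (2 + 2 * B) * e + e"
        using gN elim by linarith
      also have "\<dots> = (5 + 4 * B) * e" by (simp add: algebra_simps)
      finally show ?case using e by (simp add: dist_real_def)
    qed
  qed
qed

lemma tight_from_tail_bound:
  fixes p :: "'i \<Rightarrow> real \<Rightarrow> real"
  assumes "\<And>i r. i \<in> I \<Longrightarrow> r > 0 \<Longrightarrow> p i r * r powr 1 \<le> C" "e > 0"
  obtains r where "r > 0" "\<And>i. i \<in> I \<Longrightarrow> p i r \<le> e"
proof -
  define r where "r = (\<bar>C\<bar> + 1) / e"
  have r: "r > 0" using \<open>e > 0\<close> by (simp add: r_def add_nonneg_pos)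
  have "p i r \<le> e" if "i \<in> I" for i
  proof -
    have "p i r * r \<le> C" using assms(1)[OF that r] r by simp
    also have "\<dots> \<le> e * r" using \<open>e > 0\<close> by (simp add: r_def)
    finally show ?thesis using r by simp
  qed
  then show ?thesis by (rule that[OF r])
qed

lemma cos_min_bound: "\<bar>cos x - cos y\<bar> \<le> 2" for x y :: real
  using cos_le_one[of x] cos_ge_minus_one[of x] cos_le_one[of y] cos_ge_minus_one[of y] by linarith

text \<open>
  Slutsky's theorem at the level of cosines: closeness in probability suffices because the cosine
  is Lipschitz and bounded.
\<close>
lemma (in prob_space) cos_expectation_close:
  assumes [measurable]: "U \<in> borel_measurable M" "W \<in> borel_measurable M" and "e > 0"
    and close: "\<And>w. w \<in> space M \<Longrightarrow> w \<notin> A \<Longrightarrow> \<bar>U w - W w\<bar> \<le> e" and A: "A \<in> sets M"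
  shows "\<bar>expectation (\<lambda>w. cos (U w)) - expectation (\<lambda>w. cos (W w))\<bar> \<le> e + 2 * prob A"
proof -
  have int: "integrable M (\<lambda>w. cos (Z w))" if [measurable]: "Z \<in> borel_measurable M" for Z :: "'a \<Rightarrow> real"
  proof (rule integrable_const_bound[where B=1])
    show "(\<lambda>w. cos (Z w)) \<in> borel_measurable M" by measurable
  qed simp
  have intA: "integrable M (\<lambda>w. indicator A w :: real)"
    using A by (simp add: less_top[symmetric])
  have "\<bar>expectation (\<lambda>w. cos (U w)) - expectation (\<lambda>w. cos (W w))\<bar>
      = \<bar>expectation (\<lambda>w. cos (U w) - cos (W w))\<bar>" using int assms(1,2) by simp
  also have "\<dots> \<le> expectation (\<lambda>w. \<bar>cos (U w) - cos (W w)\<bar>)" by (rule integral_abs_bound)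
  also have "\<dots> \<le> expectation (\<lambda>w. e + 2 * indicator A w)"
  proof (rule integral_mono)
    show "integrable M (\<lambda>w. \<bar>cos (U w) - cos (W w)\<bar>)" using int assms(1,2) by simp
    show "integrable M (\<lambda>w. e + 2 * indicator A w)" using intA by simp
    fix w assume "w \<in> space M"
    then show "\<bar>cos (U w) - cos (W w)\<bar> \<le> e + 2 * indicator A w"
      using close[of w] cos_Lipschitz[of "U w" "W w"] cos_min_bound[of "U w" "W w"] \<open>e > 0\<close>
      by (cases "w \<in> A") auto
  qed
  also have "\<dots> = e + 2 * prob A"
    using intA A sets.sets_into_space[OF A] by (simp add: prob_space Int_absorb2)
  finally show ?thesis .
qed

section \<open>Functions of finitely many independent variables\<close>

locale independent_sequence = prob_space M for M :: "'a measure" +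
  fixes \<epsilon> :: "nat \<Rightarrow> 'a \<Rightarrow> real"
  assumes indep: "indep_vars (\<lambda>_. borel) \<epsilon> {1..}"
begin

text \<open>
  Being a Borel function of the coordinates in \<open>A\<close> is used in place of measurability with
  respect to a generated sigma-algebra, because closure properties and independence then reduce to
  facts about product spaces.
\<close>
definition depends_on :: "nat set \<Rightarrow> ('a \<Rightarrow> real) \<Rightarrow> bool" where
  "depends_on A U \<longleftrightarrow> A \<subseteq> {1..} \<and>
    (\<exists>F\<in>borel_measurable (PiM A (\<lambda>_. borel)). \<forall>w. U w = F (restrict (\<lambda>i. \<epsilon> i w) A))"

lemma measurable_noise: "i \<ge> 1 \<Longrightarrow> \<epsilon> i \<in> borel_measurable M"
  using indep by (auto simp: indep_vars_def)

lemma depends_onD: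
  "depends_on A U \<Longrightarrow> \<exists>F. F \<in> borel_measurable (PiM A (\<lambda>_. borel)) \<and>
    (\<forall>w. U w = F (restrict (\<lambda>i. \<epsilon> i w) A))"
  unfolding depends_on_def by blast

lemma depends_on_mono:
  assumes "depends_on A U" "A \<subseteq> B" "B \<subseteq> {1..}"
  shows "depends_on B U"
proof -
  obtain F where F[measurable]: "F \<in> borel_measurable (PiM A (\<lambda>_. borel))"
    and U: "\<And>w. U w = F (restrict (\<lambda>i. \<epsilon> i w) A)"
    using depends_onD[OF assms(1)] by blast
  have [measurable]: "(\<lambda>x. restrict x A) \<in> measurable (PiM B (\<lambda>_. borel)) (PiM A (\<lambda>_. borel))"
    using assms(2) by (rule measurable_restrict_subset)
  show ?thesis
    unfolding depends_on_def
  proof (intro conjI bexI[of _ "\<lambda>x. F (restrict x A)"] allI)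
    show "U w = F (restrict (restrict (\<lambda>i. \<epsilon> i w) B) A)" for w
      using assms(2) by (simp add: U restrict_restrict Int_absorb1)
  qed (use assms in measurable)
qed

lemma depends_on_noise: "i \<in> A \<Longrightarrow> A \<subseteq> {1..} \<Longrightarrow> depends_on A (\<epsilon> i)"
  unfolding depends_on_def by (intro conjI bexI[of _ "\<lambda>x. x i"]) auto

lemma depends_on_const: "A \<subseteq> {1..} \<Longrightarrow> depends_on A (\<lambda>_. c)"
  unfolding depends_on_def by (intro conjI bexI[of _ "\<lambda>x. c"]) auto

lemma depends_on_op:
  fixes g :: "real \<times> real \<Rightarrow> real"
  assumes "depends_on A U" "depends_on A W" and [measurable]: "g \<in> borel_measurable borel"
  shows "depends_on A (\<lambda>w. g (U w, W w))"
proof -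
  obtain F where F[measurable]: "F \<in> borel_measurable (PiM A (\<lambda>_. borel))"
    and U: "\<And>w. U w = F (restrict (\<lambda>i. \<epsilon> i w) A)"
    using depends_onD[OF assms(1)] by blast
  obtain G where G[measurable]: "G \<in> borel_measurable (PiM A (\<lambda>_. borel))"
    and W: "\<And>w. W w = G (restrict (\<lambda>i. \<epsilon> i w) A)"
    using depends_onD[OF assms(2)] by blast
  have A: "A \<subseteq> {1..}" using assms(1) by (simp add: depends_on_def)
  have m: "(\<lambda>x. g (F x, G x)) \<in> borel_measurable (PiM A (\<lambda>_. borel))"
    by (rule measurable_compose[OF _ assms(3)]) (simp add: borel_prod[symmetric])
  show ?thesis
    unfolding depends_on_def using A m U W by (intro conjI bexI[of _ "\<lambda>x. g (F x, G x)"] allI) simp_all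
qed

lemma depends_on_comp:
  assumes "depends_on A U" and [measurable]: "g \<in> borel_measurable borel"
  shows "depends_on A (\<lambda>w. g (U w))"
  using depends_on_op[OF assms(1) assms(1), of "\<lambda>p. g (fst p)"] by (simp add: borel_prod[symmetric])

lemma depends_on_diff: "depends_on A U \<Longrightarrow> depends_on A W \<Longrightarrow> depends_on A (\<lambda>w. U w - W w)"
  and depends_on_add: "depends_on A U \<Longrightarrow> depends_on A W \<Longrightarrow> depends_on A (\<lambda>w. U w + W w)"
  and depends_on_mult: "depends_on A U \<Longrightarrow> depends_on A W \<Longrightarrow> depends_on A (\<lambda>w. U w * W w)"
  using depends_on_op[of A U W "\<lambda>(x, y). x - y"] depends_on_op[of A U W "\<lambda>(x, y). x + y"]
    depends_on_op[of A U W "\<lambda>(x, y). x * y"]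
  by (simp_all add: borel_prod[symmetric])

lemma depends_on_sum:
  assumes "finite J" "\<And>j. j \<in> J \<Longrightarrow> depends_on A (U j)" "A \<subseteq> {1..}"
  shows "depends_on A (\<lambda>w. \<Sum>j\<in>J. U j w)"
  using assms(1,2)
  by (induction J rule: finite_induct) (use depends_on_const[OF assms(3), of 0] depends_on_add in simp_all)

lemma indep_vars_depends_on:
  assumes "\<And>j. j \<in> L \<Longrightarrow> depends_on (K j) (U j)" "disjoint_family_on K L"
  shows "indep_vars (\<lambda>_. borel) U L"
proof -
  define F where "F j = (SOME F. F \<in> borel_measurable (PiM (K j) (\<lambda>_. borel)) \<and>
    (\<forall>w. U j w = F (restrict (\<lambda>i. \<epsilon> i w) (K j))))" for j
  have F: "F j \<in> borel_measurable (PiM (K j) (\<lambda>_. borel)) \<and>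
      (\<forall>w. U j w = F j (restrict (\<lambda>i. \<epsilon> i w) (K j)))" if "j \<in> L" for j
    unfolding F_def by (rule someI_ex[OF depends_onD[OF assms(1)[OF that]]])
  have K: "K j \<subseteq> {1..}" if "j \<in> L" for j using assms(1)[OF that] by (simp add: depends_on_def)
  have r: "indep_vars (\<lambda>j. PiM (K j) (\<lambda>_. borel)) (\<lambda>j w. restrict (\<lambda>i. \<epsilon> i w) (K j)) L"
    by (rule indep_vars_restrict[OF indep K assms(2)])
  have "indep_vars (\<lambda>_. borel) (\<lambda>j w. F j (restrict (\<lambda>i. \<epsilon> i w) (K j))) L"
    by (rule indep_vars_compose2[OF r]) (use F in blast)
  moreover have "U j = (\<lambda>w. F j (restrict (\<lambda>i. \<epsilon> i w) (K j)))" if "j \<in> L" for j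
    using F[OF that] by blast
  ultimately show ?thesis by (simp cong: indep_vars_cong)
qed

lemma measurable_depends_on:
  assumes "depends_on A U" shows "U \<in> borel_measurable M"
proof -
  have "indep_vars (\<lambda>_. borel) (\<lambda>_::unit. U) UNIV"
    by (rule indep_vars_depends_on[where K="\<lambda>_. A"]) (auto simp: assms disjoint_family_on_def)
  then show ?thesis by (auto simp: indep_vars_def)
qed

lemma expectation_mult_depends_on:
  assumes "depends_on A U" "depends_on B W" "A \<inter> B = {}" "\<And>w. \<bar>U w\<bar> \<le> a" "\<And>w. \<bar>W w\<bar> \<le> b"
  shows "expectation (\<lambda>w. U w * W w) = expectation U * expectation W"
proof (rule indep_var_lebesgue_integral)
  have "indep_vars (\<lambda>_. borel) (case_bool U W) UNIV"
    by (rule indep_vars_depends_on[where K="case_bool A B"])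
       (use assms in \<open>auto simp: disjoint_family_on_def split: bool.splits\<close>)
  moreover have "case_bool borel borel = (\<lambda>_. borel :: real measure)" by (auto split: bool.splits)
  ultimately show "indep_var borel U borel W" unfolding indep_var_def by (simp only:)
  show "integrable M U"
    using assms(1,4) measurable_depends_on by (intro integrable_const_bound[where B=a]) simp_all
  show "integrable M W"
    using assms(2,5) measurable_depends_on by (intro integrable_const_bound[where B=b]) simp_all
qed

text \<open>
  Summands whose indices have the same parity involve disjoint sets of noise variables, so Hoeffding's
  inequality for independent variables applies to each parity class separately.
\<close>
lemma Hoeffding_one_dependent:
  assumes dep: "\<And>j. j \<in> {2..n} \<Longrightarrow> depends_on {j - 1, j} (\<zeta> j)"
    and bd: "\<And>j w. j \<in> {2..n} \<Longrightarrow> \<bar>\<zeta> j w\<bar> \<le> K" and "K > 0" "s > 0"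
  shows "prob {w\<in>space M. s \<le> \<bar>(\<Sum>j=2..n. \<zeta> j w) - (\<Sum>j=2..n. expectation (\<zeta> j))\<bar>}
         \<le> 4 * exp (- s\<^sup>2 / (8 * K\<^sup>2 * n))"
proof -
  let ?D = "\<lambda>J w. \<bar>(\<Sum>j\<in>J. \<zeta> j w) - (\<Sum>j\<in>J. expectation (\<zeta> j))\<bar>"
  have half: "prob {w\<in>space M. s / 2 \<le> ?D J w}
      \<le> 2 * exp (- s\<^sup>2 / (8 * K\<^sup>2 * n))"
    if J: "J \<subseteq> {2..n}" "\<And>i j. i \<in> J \<Longrightarrow> j \<in> J \<Longrightarrow> even i = even j" for J
  proof (cases "J = {}")
    case True
    have "prob {w\<in>space M. s / 2 \<le> ?D J w} = 0"
      using True \<open>s > 0\<close> by simp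
    then show ?thesis by (simp only:) simp
  next
    case False
    have fJ: "finite J" using J finite_subset by blast
    have cJ: "0 < card J" "card J \<le> n"
      using False fJ card_mono[OF _ J(1)] by (auto simp: card_gt_0_iff)
    have disj: "disjoint_family_on (\<lambda>j. {j - 1, j}) J"
      unfolding disjoint_family_on_def
    proof (intro ballI impI)
      fix i j assume ij: "i \<in> J" "j \<in> J" "i \<noteq> j"
      then have "i \<ge> 2" "j \<ge> 2" using J(1) by auto
      moreover have "even i = even j" using J(2) ij by blast
      ultimately have "i \<noteq> j - 1" "j \<noteq> i - 1" "i - 1 \<noteq> j - 1" using ij(3) by presburger+
      then show "{i - 1, i} \<inter> {j - 1, j} = {}" using ij(3) by auto
    qed
    interpret Hoeffding_ineq M J \<zeta> "\<lambda>_. - K" "\<lambda>_. K" "\<Sum>j\<in>J. expectation (\<zeta> j)"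
    proof unfold_locales
      show "indep_vars (\<lambda>_. borel) \<zeta> J"
        by (rule indep_vars_depends_on[OF _ disj]) (use dep J in auto)
      show "AE x in M. \<zeta> i x \<in> {- K..K}" if "i \<in> J" for i
        using bd[of i] that J by (intro AE_I2) (auto simp: abs_le_iff minus_le_iff)
    qed (use fJ in auto)
    have "prob {w\<in>space M. s / 2 \<le> ?D J w}
        \<le> 2 * exp (- 2 * (s / 2)\<^sup>2 / (\<Sum>i\<in>J. (K - - K)\<^sup>2))"
      by (rule Hoeffding_ineq_abs_ge) (use \<open>s > 0\<close> \<open>K > 0\<close> cJ fJ False in \<open>auto intro!: sum_pos\<close>)
    also have "- 2 * (s / 2)\<^sup>2 / (\<Sum>i\<in>J. (K - - K)\<^sup>2) = - (s\<^sup>2 / (8 * K\<^sup>2 * card J))"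
      using \<open>K > 0\<close> cJ by (simp add: power2_eq_square field_simps)
    also have "2 * exp (- (s\<^sup>2 / (8 * K\<^sup>2 * card J))) \<le> 2 * exp (- s\<^sup>2 / (8 * K\<^sup>2 * n))"
      using cJ \<open>K > 0\<close> by (auto intro!: divide_left_mono mult_pos_pos)
    finally show ?thesis by simp
  qed
  let ?E = "{j\<in>{2..n}. even j}" and ?O = "{j\<in>{2..n}. odd j}"
  have [measurable]: "(\<lambda>w. \<Sum>j\<in>J. \<zeta> j w) \<in> borel_measurable M" if "J \<subseteq> {2..n}" for J
    using dep measurable_depends_on that by (intro borel_measurable_sum) blast
  have split: "sum h {2..n} = sum h ?E + sum h ?O" for h :: "nat \<Rightarrow> real"
    by (subst sum.union_disjoint[symmetric]) (auto intro: sum.cong)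
  have m: "{w\<in>space M. s / 2 \<le> ?D J w} \<in> sets M" if "J \<subseteq> {2..n}" for J
    using that by measurable
  have "prob {w\<in>space M. s \<le> ?D {2..n} w}
      \<le> prob ({w\<in>space M. s / 2 \<le> ?D ?E w} \<union> {w\<in>space M. s / 2 \<le> ?D ?O w})"
  proof (rule finite_measure_mono)
    show "{w\<in>space M. s / 2 \<le> ?D ?E w} \<union> {w\<in>space M. s / 2 \<le> ?D ?O w} \<in> sets M"
      by (intro sets.Un m) blast+
    have "s / 2 \<le> ?D ?E w \<or> s / 2 \<le> ?D ?O w" if "s \<le> ?D {2..n} w" for w
      using that unfolding split by linarith
    then show "{w\<in>space M. s \<le> ?D {2..n} w}
      \<subseteq> {w\<in>space M. s / 2 \<le> ?D ?E w} \<union> {w\<in>space M. s / 2 \<le> ?D ?O w}" by blast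
  qed
  also have "\<dots> \<le> prob {w\<in>space M. s / 2 \<le> ?D ?E w} + prob {w\<in>space M. s / 2 \<le> ?D ?O w}"
    by (rule measure_Un_le) (rule m, blast)+
  also have "\<dots> \<le> 2 * exp (- s\<^sup>2 / (8 * K\<^sup>2 * n)) + 2 * exp (- s\<^sup>2 / (8 * K\<^sup>2 * n))"
    by (intro add_mono half) auto
  finally show ?thesis by simp
qed

end

section \<open>Bounded random variables and a central limit theorem under one-dependence\<close>

text \<open>
  The covariance of a one-dependent sum lives on the diagonal and the two adjacent diagonals.
\<close>
lemma sum_neighbours:
  fixes g :: "nat \<Rightarrow> nat \<Rightarrow> real"
  shows "(\<Sum>j=2..n. \<Sum>k\<in>{k\<in>{2..n}. k \<le> j + 1 \<and> j \<le> k + 1}. g j k)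
       = (\<Sum>j=2..n. g j j) + (\<Sum>j=2..n-1. g j (j + 1) + g (j + 1) j)"
proof -
  have inner: "(\<Sum>k\<in>{k\<in>{2..n}. k \<le> j + 1 \<and> j \<le> k + 1}. g j k)
      = g j j + (if j + 1 \<le> n then g j (j + 1) else 0) + (if 3 \<le> j then g j (j - 1) else 0)"
    if j: "j \<in> {2..n}" for j
  proof -
    have "{k\<in>{2..n}. k \<le> j + 1 \<and> j \<le> k + 1}
        = {j} \<union> (if j + 1 \<le> n then {j + 1} else {}) \<union> (if 3 \<le> j then {j - 1} else {})"
      using j by auto
    then show ?thesis using j by auto
  qed
  have up: "(\<Sum>j=2..n. if j + 1 \<le> n then g j (j + 1) else 0) = (\<Sum>j=2..n-1. g j (j + 1))"
    by (rule sum.mono_neutral_cong_right) auto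
  have "(\<Sum>j=2..n. if 3 \<le> j then g j (j - 1) else 0) = (\<Sum>j=3..n. g j (j - 1))"
    by (rule sum.mono_neutral_cong_right) auto
  also have "\<dots> = (\<Sum>j=2..n-1. g (j + 1) j)"
    by (rule sum.reindex_bij_witness[of _ "\<lambda>j. j + 1" "\<lambda>j. j - 1"]) auto
  finally have down: "(\<Sum>j=2..n. if 3 \<le> j then g j (j - 1) else 0) = (\<Sum>j=2..n-1. g (j + 1) j)" .
  have "(\<Sum>j=2..n. \<Sum>k\<in>{k\<in>{2..n}. k \<le> j + 1 \<and> j \<le> k + 1}. g j k)
      = (\<Sum>j=2..n. g j j + (if j + 1 \<le> n then g j (j + 1) else 0) + (if 3 \<le> j then g j (j - 1) else 0))"
    by (rule sum.cong[OF refl inner])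
  also have "\<dots> = (\<Sum>j=2..n. g j j) + (\<Sum>j=2..n-1. g j (j + 1) + g (j + 1) j)"
    unfolding sum.distrib up down by simp
  finally show ?thesis .
qed

context prob_space begin

definition bounded_rv :: "('a \<Rightarrow> real) \<Rightarrow> bool" where
  "bounded_rv U \<longleftrightarrow> U \<in> borel_measurable M \<and> (\<exists>b. \<forall>w. \<bar>U w\<bar> \<le> b)"

lemma bounded_rvI: "U \<in> borel_measurable M \<Longrightarrow> (\<And>w. \<bar>U w\<bar> \<le> b) \<Longrightarrow> bounded_rv U"
  unfolding bounded_rv_def by blast

lemma bounded_rv_integrable: "bounded_rv U \<Longrightarrow> integrable M U"
proof -
  assume "bounded_rv U"
  then obtain b where "U \<in> borel_measurable M" "\<And>w. \<bar>U w\<bar> \<le> b" unfolding bounded_rv_def by blast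
  then show "integrable M U" by (intro integrable_const_bound[where B=b]) simp_all
qed

lemma bounded_rv_const: "bounded_rv (\<lambda>_. c)"
  by (rule bounded_rvI[where b="\<bar>c\<bar>"]) simp_all

lemma bounded_rv_add: "bounded_rv U \<Longrightarrow> bounded_rv W \<Longrightarrow> bounded_rv (\<lambda>w. U w + W w)"
proof -
  assume "bounded_rv U" "bounded_rv W"
  then obtain a b where "U \<in> borel_measurable M" "\<And>w. \<bar>U w\<bar> \<le> a"
    "W \<in> borel_measurable M" "\<And>w. \<bar>W w\<bar> \<le> b" unfolding bounded_rv_def by blast
  then show ?thesis
    by (intro bounded_rvI[where b="a + b"] borel_measurable_add order_trans[OF abs_triangle_ineq] add_mono)
qed

lemma bounded_rv_mult: "bounded_rv U \<Longrightarrow> bounded_rv W \<Longrightarrow> bounded_rv (\<lambda>w. U w * W w)"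
proof -
  assume "bounded_rv U" "bounded_rv W"
  then obtain a b where *: "U \<in> borel_measurable M" "\<And>w. \<bar>U w\<bar> \<le> a"
    "W \<in> borel_measurable M" "\<And>w. \<bar>W w\<bar> \<le> b" unfolding bounded_rv_def by blast
  have "0 \<le> a" using *(2) abs_ge_zero order_trans by blast
  show ?thesis
    by (rule bounded_rvI[where b="a * b"]) (use * \<open>0 \<le> a\<close> in \<open>auto simp: abs_mult intro!: mult_mono\<close>)
qed

lemma bounded_rv_diff: "bounded_rv U \<Longrightarrow> bounded_rv W \<Longrightarrow> bounded_rv (\<lambda>w. U w - W w)"
  using bounded_rv_add[of U "\<lambda>w. - 1 * W w"] bounded_rv_mult[OF bounded_rv_const[of "- 1"], of W] by simp

lemma bounded_rv_sum:
  "finite J \<Longrightarrow> (\<And>j. j \<in> J \<Longrightarrow> bounded_rv (U j)) \<Longrightarrow> bounded_rv (\<lambda>w. \<Sum>j\<in>J. U j w)"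
  by (induction J rule: finite_induct) (use bounded_rv_const[of 0] bounded_rv_add in simp_all)

lemma bounded_rv_sin: "bounded_rv U \<Longrightarrow> bounded_rv (\<lambda>w. sin (U w))"
  and bounded_rv_cos: "bounded_rv U \<Longrightarrow> bounded_rv (\<lambda>w. cos (U w))"
  unfolding bounded_rv_def by (auto intro!: exI[of _ 1])

lemmas bounded_rv_intros = bounded_rv_const bounded_rv_add bounded_rv_mult bounded_rv_diff
  bounded_rv_sum bounded_rv_sin bounded_rv_cos

lemma abs_expectation_le:
  fixes U :: "'a \<Rightarrow> real"
  assumes "\<And>w. \<bar>U w\<bar> \<le> b"
  shows "\<bar>expectation U\<bar> \<le> b"
proof (cases "integrable M U")
  case True
  have "\<bar>expectation U\<bar> \<le> expectation (\<lambda>w. \<bar>U w\<bar>)" by (rule integral_abs_bound)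
  also have "\<dots> \<le> expectation (\<lambda>w. b)" by (intro integral_mono) (use True assms in auto)
  finally show ?thesis by (simp add: prob_space)
next
  case False
  then show ?thesis using assms[of undefined] by (simp add: not_integrable_integral_eq)
qed

end

context independent_sequence begin

lemma bounded_rv_depends_on:
  "depends_on A U \<Longrightarrow> (\<And>w. \<bar>U w\<bar> \<le> b) \<Longrightarrow> bounded_rv U"
  by (rule bounded_rvI[OF measurable_depends_on])

text \<open>
  A form of Tikhomirov's method. Writing \<open>T = near + far\<close> around an index \<open>j\<close>, the summand \<open>\<xi> j\<close> is
  independent of \<open>far 1 j\<close>, and \<open>\<xi> j * near 1 j\<close> of \<open>far 2 j\<close>. Expanding \<open>sin (s T + c)\<close> around \<open>far\<close> to
  first order therefore leaves \<open>s * E (\<xi> j * near 1 j) * F s\<close> with an error of third order in \<open>K\<close>. Summing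
  over \<open>j\<close> gives the differential equation of the Gaussian characteristic function for
  \<open>F s = E cos (s T + c)\<close>.
\<close>
lemma one_dependent_cos_bound:
  fixes \<xi> :: "nat \<Rightarrow> 'a \<Rightarrow> real"
  assumes dep: "\<And>j. j \<in> {2..n} \<Longrightarrow> depends_on {j - 1, j} (\<xi> j)"
    and bd: "\<And>j w. j \<in> {2..n} \<Longrightarrow> \<bar>\<xi> j w\<bar> \<le> K"
    and centred: "\<And>j. j \<in> {2..n} \<Longrightarrow> expectation (\<xi> j) = 0" and "K \<ge> 0"
  defines "V \<equiv> \<Sum>j=2..n. \<Sum>k\<in>{k\<in>{2..n}. k \<le> j + 1 \<and> j \<le> k + 1}. expectation (\<lambda>w. \<xi> j w * \<xi> k w)"
  shows "V \<ge> 0"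
    and "\<bar>expectation (\<lambda>w. cos ((\<Sum>j=2..n. \<xi> j w) + c)) - exp (- V / 2) * cos c\<bar> \<le> 39 * real n * K ^ 3"
proof -
  define T where "T w = (\<Sum>j=2..n. \<xi> j w)" for w
  define Nb where "Nb m j = {k\<in>{2..n}. k \<le> j + m \<and> j \<le> k + m}" for m j
  define near where "near m j w = (\<Sum>k\<in>Nb m j. \<xi> k w)" for m j w
  define far where "far m j w = (\<Sum>k\<in>{2..n} - Nb m j. \<xi> k w)" for m j w
  have T: "T w = near m j w + far m j w" for m j w
  proof -
    have "Nb m j \<subseteq> {2..n}" by (auto simp: Nb_def)
    from sum.subset_diff[OF this, of "\<lambda>k. \<xi> k w"] show ?thesis
      by (simp only: T_def near_def far_def finite_atLeastAtMost add.commute)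
  qed
  have near_bd: "\<bar>near m j w\<bar> \<le> (2 * m + 1) * K" for m j w
  proof -
    have "card (Nb m j) \<le> card {j - m..j + m}" by (rule card_mono) (auto simp: Nb_def)
    then have "card (Nb m j) \<le> 2 * m + 1" by simp
    then have c: "real (card (Nb m j)) \<le> real (2 * m + 1)" by (simp only: of_nat_le_iff)
    have "\<bar>near m j w\<bar> \<le> (\<Sum>k\<in>Nb m j. \<bar>\<xi> k w\<bar>)" unfolding near_def by (rule sum_abs)
    also have "\<dots> \<le> card (Nb m j) * K" by (rule sum_bounded_above) (auto simp: Nb_def bd)
    also have "\<dots> \<le> (2 * m + 1) * K"
      using c \<open>K \<ge> 0\<close> by (intro mult_right_mono) auto
    finally show ?thesis by (simp only: of_nat_add of_nat_mult of_nat_numeral of_nat_1)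
  qed
  have dep_far: "depends_on {i\<in>{1..}. i + m < j \<or> j + m \<le> i} (far m j)" if "m \<ge> 1" for m j
    unfolding far_def
  proof (rule depends_on_sum)
    fix k assume "k \<in> {2..n} - Nb m j"
    then show "depends_on {i\<in>{1..}. i + m < j \<or> j + m \<le> i} (\<xi> k)"
      using that by (intro depends_on_mono[OF dep]) (auto simp: Nb_def)
  qed auto
  have dep_near: "depends_on {i\<in>{1..}. j \<le> i + 2 \<and> i < j + 2} (near 1 j)" for j
    unfolding near_def
  proof (rule depends_on_sum)
    fix k assume "k \<in> Nb 1 j"
    then show "depends_on {i\<in>{1..}. j \<le> i + 2 \<and> i < j + 2} (\<xi> k)"
      by (intro depends_on_mono[OF dep]) (auto simp: Nb_def)
  qed (auto simp: Nb_def)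
  have \<xi>b: "bounded_rv (\<xi> j)" if "j \<in> {2..n}" for j
    using dep bd that by (blast intro: bounded_rv_depends_on)
  have Tb: "bounded_rv T" unfolding T_def[abs_def] by (intro bounded_rv_sum \<xi>b) auto
  have nearb: "bounded_rv (near m j)" for m j
    unfolding near_def[abs_def] by (intro bounded_rv_sum \<xi>b) (auto simp: Nb_def)
  have farb: "bounded_rv (far m j)" for m j
    unfolding far_def[abs_def] by (intro bounded_rv_sum \<xi>b) (auto simp: Nb_def)
  note b = bounded_rv_intros Tb nearb farb \<xi>b
  note bi = bounded_rv_integrable
  note E_diff = Bochner_Integration.integral_diff
  define v where "v j = expectation (\<lambda>w. \<xi> j w * near 1 j w)" for j
  have V: "V = (\<Sum>j=2..n. v j)"
    unfolding V_def
  proof (rule sum.cong[OF refl])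
    fix j assume j: "j \<in> {2..n}"
    have "v j = expectation (\<lambda>w. \<Sum>k\<in>Nb 1 j. \<xi> j w * \<xi> k w)"
      by (simp add: v_def near_def sum_distrib_left)
    also have "\<dots> = (\<Sum>k\<in>Nb 1 j. expectation (\<lambda>w. \<xi> j w * \<xi> k w))"
      by (intro Bochner_Integration.integral_sum bi b) (use j in \<open>auto simp: Nb_def\<close>)
    finally show "(\<Sum>k\<in>{k\<in>{2..n}. k \<le> j + 1 \<and> j \<le> k + 1}. expectation (\<lambda>w. \<xi> j w * \<xi> k w)) = v j"
      by (simp add: Nb_def)
  qed
  have far_uncorr: "expectation (\<lambda>w. \<xi> j w * g (far 1 j w)) = 0"
    if j: "j \<in> {2..n}" and g: "g \<in> borel_measurable borel" "\<And>w. \<bar>g (far 1 j w)\<bar> \<le> B" for j g B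
  proof -
    have "expectation (\<lambda>w. \<xi> j w * g (far 1 j w)) = expectation (\<xi> j) * expectation (\<lambda>w. g (far 1 j w))"
    proof (rule expectation_mult_depends_on[OF dep[OF j] depends_on_comp[OF dep_far g(1)] _ bd[OF j] g(2)])
      show "{j - 1, j} \<inter> {i \<in> {1..}. i + 1 < j \<or> j + 1 \<le> i} = {}" using j by auto
    qed simp
    then show ?thesis using centred[OF j] by simp
  qed
  obtain bT where bT: "\<And>w. \<bar>T w\<bar> \<le> bT" using Tb unfolding bounded_rv_def by blast
  have "bT \<ge> 0" using bT[of undefined] by linarith
  show "V \<ge> 0"
  proof -
    have "0 \<le> expectation (\<lambda>w. T w * T w)" by (intro integral_nonneg_AE) auto
    also have "\<dots> = (\<Sum>j=2..n. expectation (\<lambda>w. \<xi> j w * T w))"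
      by (subst Bochner_Integration.integral_sum[symmetric]) (auto intro!: bi b simp: T_def sum_distrib_right)
    also have "\<dots> = (\<Sum>j=2..n. v j)"
    proof (rule sum.cong[OF refl])
      fix j assume j: "j \<in> {2..n}"
      obtain B where B: "\<And>w. \<bar>far 1 j w\<bar> \<le> B" using farb[of 1 j] unfolding bounded_rv_def by blast
      have "expectation (\<lambda>w. \<xi> j w * T w) = v j + expectation (\<lambda>w. \<xi> j w * far 1 j w)"
        unfolding v_def T[of _ 1 j] distrib_left by (intro Bochner_Integration.integral_add bi b j)
      also have "expectation (\<lambda>w. \<xi> j w * far 1 j w) = 0"
        by (rule far_uncorr[OF j, of "\<lambda>x. x" B]) (use B in simp_all)
      finally show "expectation (\<lambda>w. \<xi> j w * T w) = v j" by simp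
    qed
    finally show ?thesis by (simp add: V)
  qed
  \<comment> \<open>The unknown function of the differential equation.\<close>
  define F where "F s = expectation (\<lambda>w. cos (s * T w + c))" for s
  define F' where "F' s = expectation (\<lambda>w. T w * (- sin (s * T w + c)))" for s
  have "(F has_real_derivative F' s) (at s)" for s
  proof (rule deriv_if_quadratic_remainder)
    fix h
    have "F (s + h) - F s - h * F' s = expectation (\<lambda>w. cos ((s + h) * T w + c) - cos (s * T w + c)
        - h * (T w * (0 - sin (s * T w + c))))"
      unfolding F_def F'_def
      by (subst Bochner_Integration.integral_diff, intro bi b, intro bi b,
          subst Bochner_Integration.integral_diff, intro bi b, intro bi b) simp
    also have "\<bar>\<dots>\<bar> \<le> bT\<^sup>2 * h\<^sup>2"
    proof (rule abs_expectation_le)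
      fix w
      have "\<bar>cos ((s + h) * T w + c) - cos (s * T w + c) - h * (T w * (0 - sin (s * T w + c)))\<bar> \<le> (h * T w)\<^sup>2"
        using cos_remainder[of "s * T w + c" "h * T w"] by (simp add: algebra_simps)
      also have "\<dots> \<le> bT\<^sup>2 * h\<^sup>2"
        using power_mono[OF bT[of w] abs_ge_zero, of 2]
        unfolding power_mult_distrib mult.commute[of "bT\<^sup>2"] by (intro mult_left_mono) simp_all
      finally show "\<bar>cos ((s + h) * T w + c) - cos (s * T w + c) - h * (T w * (0 - sin (s * T w + c)))\<bar> \<le> bT\<^sup>2 * h\<^sup>2" .
    qed
    finally show "\<bar>F (s + h) - F s - h * F' s\<bar> \<le> bT\<^sup>2 * h\<^sup>2" .
  qed
  moreover have "\<bar>F' s + s * V * F s\<bar> \<le> 39 * real n * K ^ 3" if s: "0 \<le> s" "s \<le> 1" for s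
  proof -
    let ?I = "\<lambda>j. expectation (\<lambda>w. \<xi> j w * sin (s * T w + c))"
    have term_bd: "\<bar>?I j - s * v j * F s\<bar> \<le> 39 * K ^ 3"
      if j: "j \<in> {2..n}" for j
    proof -
      \<comment> \<open>\<open>A\<close> is the first-order Taylor remainder; \<open>B\<close> and \<open>C\<close> measure the replacement of \<open>T\<close> by \<open>far 2 j\<close>.\<close>
      define A where "A w = \<xi> j w * (sin (s * T w + c) - sin (s * far 1 j w + c)
          - s * near 1 j w * cos (s * T w + c))" for w
      define C where "C w = cos (s * T w + c) - cos (s * far 2 j w + c)" for w
      define B where "B w = \<xi> j w * near 1 j w * C w" for w
      have eA: "expectation A = ?I j
          - s * expectation (\<lambda>w. \<xi> j w * near 1 j w * cos (s * T w + c))"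
      proof -
        have "expectation (\<lambda>w. \<xi> j w * sin (s * far 1 j w + c)) = 0"
          by (rule far_uncorr[OF j, of "\<lambda>x. sin (s * x + c)" 1]) simp_all
        moreover have "expectation A = expectation (\<lambda>w. \<xi> j w * sin (s * T w + c)
          - \<xi> j w * sin (s * far 1 j w + c) - s * (\<xi> j w * near 1 j w * cos (s * T w + c)))"
          unfolding A_def by (intro Bochner_Integration.integral_cong) (auto simp: algebra_simps)
        moreover have "\<dots> = expectation (\<lambda>w. \<xi> j w * sin (s * T w + c) - \<xi> j w * sin (s * far 1 j w + c)) - expectation (\<lambda>w. s * (\<xi> j w * near 1 j w * cos (s * T w + c)))"
          by (intro E_diff bi b j)
        moreover have "expectation (\<lambda>w. \<xi> j w * sin (s * T w + c) - \<xi> j w * sin (s * far 1 j w + c))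
            = ?I j - expectation (\<lambda>w. \<xi> j w * sin (s * far 1 j w + c))"
          by (intro E_diff bi b j)
        ultimately show ?thesis by simp
      qed
      have eC: "expectation C = F s - expectation (\<lambda>w. cos (s * far 2 j w + c))"
        unfolding C_def F_def by (intro E_diff bi b)
      have eB: "expectation B = expectation (\<lambda>w. \<xi> j w * near 1 j w * cos (s * T w + c))
          - v j * expectation (\<lambda>w. cos (s * far 2 j w + c))"
      proof -
        have "expectation (\<lambda>w. \<xi> j w * near 1 j w * cos (s * far 2 j w + c))
            = v j * expectation (\<lambda>w. cos (s * far 2 j w + c))"
          unfolding v_def
        proof (rule expectation_mult_depends_on)
          show "depends_on {i\<in>{1..}. j \<le> i + 2 \<and> i < j + 2} (\<lambda>w. \<xi> j w * near 1 j w)"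
            using j by (intro depends_on_mult dep_near depends_on_mono[OF dep[OF j]]) auto
          show "depends_on {i\<in>{1..}. i + 2 < j \<or> j + 2 \<le> i} (\<lambda>w. cos (s * far 2 j w + c))"
            by (rule depends_on_comp[OF dep_far]) simp_all
          show "\<bar>\<xi> j w * near 1 j w\<bar> \<le> K * ((2 * 1 + 1) * K)" for w
            unfolding abs_mult using bd[OF j] near_bd[of 1 j w] \<open>K \<ge> 0\<close> by (intro mult_mono) auto
          show "\<bar>cos (s * far 2 j w + c)\<bar> \<le> 1" for w by simp
        qed auto
        moreover have "expectation B = expectation (\<lambda>w. \<xi> j w * near 1 j w * cos (s * T w + c)
            - \<xi> j w * near 1 j w * cos (s * far 2 j w + c))"
          unfolding B_def C_def by (simp add: right_diff_distrib)
        moreover have "\<dots> = expectation (\<lambda>w. \<xi> j w * near 1 j w * cos (s * T w + c)) - expectation (\<lambda>w. \<xi> j w * near 1 j w * cos (s * far 2 j w + c))"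
          by (intro E_diff bi b j)
        ultimately show ?thesis by simp
      qed
      have C_bd: "\<bar>C w\<bar> \<le> s * (5 * K)" for w
      proof -
        have "\<bar>C w\<bar> \<le> \<bar>s * T w + c - (s * far 2 j w + c)\<bar>" unfolding C_def by (rule cos_Lipschitz)
        also have "\<dots> = s * \<bar>near 2 j w\<bar>" using s by (simp add: T[of w 2 j] distrib_left abs_mult)
        also have "\<dots> \<le> s * (5 * K)" using near_bd[of 2 j w] s by (intro mult_left_mono) auto
        finally show ?thesis .
      qed
      have "\<bar>expectation A\<bar> \<le> K * (s * (3 * K))\<^sup>2"
      proof (rule abs_expectation_le)
        fix w
        have eq: "s * T w + c - s * near 1 j w = s * far 1 j w + c"
          by (simp add: T[of w 1 j] algebra_simps)
        have "\<bar>sin (s * T w + c) - sin (s * far 1 j w + c) - s * near 1 j w * cos (s * T w + c)\<bar>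
            \<le> (s * near 1 j w)\<^sup>2"
          using sin_remainder[of "s * T w + c" "s * near 1 j w"] by (simp only: eq)
        also have "\<dots> = (s * \<bar>near 1 j w\<bar>)\<^sup>2" by (simp add: power_mult_distrib)
        also have "\<dots> \<le> (s * (3 * K))\<^sup>2"
          using near_bd[of 1 j w] s by (intro power_mono mult_left_mono) auto
        finally show "\<bar>A w\<bar> \<le> K * (s * (3 * K))\<^sup>2"
          unfolding A_def abs_mult using bd[OF j] \<open>K \<ge> 0\<close> by (intro mult_mono) auto
      qed
      moreover have "\<bar>expectation B\<bar> \<le> K * (3 * K) * (s * (5 * K))"
      proof (rule abs_expectation_le)
        show "\<bar>B w\<bar> \<le> K * (3 * K) * (s * (5 * K))" for w
          unfolding B_def abs_mult using bd[OF j, of w] near_bd[of 1 j w] C_bd[of w] \<open>K \<ge> 0\<close>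
          by (intro mult_mono) auto
      qed
      moreover have "\<bar>v j\<bar> \<le> K * (3 * K)" unfolding v_def
      proof (rule abs_expectation_le)
        show "\<bar>\<xi> j w * near 1 j w\<bar> \<le> K * (3 * K)" for w
          unfolding abs_mult using bd[OF j, of w] near_bd[of 1 j w] \<open>K \<ge> 0\<close>
          by (intro mult_mono) auto
      qed
      moreover have "\<bar>expectation C\<bar> \<le> s * (5 * K)" by (rule abs_expectation_le[OF C_bd])
      ultimately have "\<bar>v j * expectation C\<bar> \<le> K * (3 * K) * (s * (5 * K))"
        unfolding abs_mult using \<open>K \<ge> 0\<close> by (intro mult_mono) auto
      have "?I j - s * v j * F s
          = expectation A + s * (expectation B - v j * expectation C)"
        unfolding eA eB eC by (simp add: algebra_simps)
      also have "\<bar>\<dots>\<bar> \<le> \<bar>expectation A\<bar> + s * (\<bar>expectation B\<bar> + \<bar>v j * expectation C\<bar>)"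
      proof -
        have "\<bar>s * (expectation B - v j * expectation C)\<bar> = s * \<bar>expectation B - v j * expectation C\<bar>"
          using s by (simp add: abs_mult)
        also have "\<dots> \<le> s * (\<bar>expectation B\<bar> + \<bar>v j * expectation C\<bar>)"
          using s by (intro mult_left_mono abs_triangle_ineq4)
        finally show ?thesis by linarith
      qed
      also have "\<dots> \<le> K * (s * (3 * K))\<^sup>2 + s * (K * (3 * K) * (s * (5 * K)) + K * (3 * K) * (s * (5 * K)))"
        using s \<open>\<bar>expectation A\<bar> \<le> _\<close> \<open>\<bar>expectation B\<bar> \<le> _\<close> \<open>\<bar>v j * expectation C\<bar> \<le> _\<close>
        by (intro add_mono mult_left_mono) auto
      also have "\<dots> = s\<^sup>2 * (39 * K ^ 3)" by (simp add: power2_eq_square power3_eq_cube algebra_simps)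
      also have "\<dots> \<le> 1 * (39 * K ^ 3)"
        using s \<open>K \<ge> 0\<close> by (intro mult_right_mono) (auto simp: power_le_one)
      finally show ?thesis by simp
    qed
    have "F' s = - (\<Sum>j=2..n. ?I j)"
    proof -
      have "F' s = - expectation (\<lambda>w. \<Sum>j=2..n. \<xi> j w * sin (s * T w + c))"
        unfolding F'_def by (simp add: T_def sum_distrib_right)
      also have "expectation (\<lambda>w. \<Sum>j=2..n. \<xi> j w * sin (s * T w + c))
          = (\<Sum>j=2..n. ?I j)"
        by (intro Bochner_Integration.integral_sum bi b)
      finally show ?thesis .
    qed
    then have "F' s + s * V * F s
        = - (\<Sum>j=2..n. ?I j - s * v j * F s)"
      by (simp add: V sum_subtractf sum_distrib_left sum_distrib_right)
    also have "\<bar>\<dots>\<bar> \<le> (\<Sum>j=2..n. \<bar>?I j - s * v j * F s\<bar>)"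
      unfolding abs_minus_cancel by (rule sum_abs)
    also have "\<dots> \<le> card {2..n} * (39 * K ^ 3)" by (rule sum_bounded_above[OF term_bd])
    also have "\<dots> \<le> real n * (39 * K ^ 3)" using \<open>K \<ge> 0\<close> by (intro mult_right_mono) auto
    finally show ?thesis by simp
  qed
  ultimately have "\<bar>F 1 - exp (- V / 2) * F 0\<bar> \<le> 39 * real n * K ^ 3"
    using \<open>V \<ge> 0\<close> by (intro gaussian_ode_stability) auto
  moreover have "F 0 = cos c" by (simp add: F_def prob_space)
  moreover have "F 1 = expectation (\<lambda>w. cos ((\<Sum>j=2..n. \<xi> j w) + c))" by (simp add: F_def T_def)
  ultimately show "\<bar>expectation (\<lambda>w. cos ((\<Sum>j=2..n. \<xi> j w) + c)) - exp (- V / 2) * cos c\<bar> \<le> 39 * real n * K ^ 3"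
    by (simp only:)
qed

text \<open>
  Three consecutive noise variables have the product law of three copies of the common
  distribution, wherever the triple starts.
\<close>
lemma expectation_increments_shift:
  fixes \<phi> :: "real \<times> real \<Rightarrow> real"
  assumes ident: "\<And>j. j \<ge> 1 \<Longrightarrow> distr M borel (\<epsilon> j) = distr M borel (\<epsilon> 1)"
    and \<phi>[measurable]: "\<phi> \<in> borel_measurable borel"
  shows "expectation (\<lambda>w. \<phi> (S \<sigma> \<epsilon> (k + 2) w, S \<sigma> \<epsilon> (k + 3) w))
       = expectation (\<lambda>w. \<phi> (S \<sigma> \<epsilon> 2 w, S \<sigma> \<epsilon> 3 w))"
proof -
  define F where "F x = \<phi> (\<sigma> * (x 2 - x 1), \<sigma> * (x 3 - x 2))" for x :: "nat \<Rightarrow> real"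
  have [measurable]: "F \<in> borel_measurable (PiM {1..3} (\<lambda>_. borel))"
    unfolding F_def by (rule measurable_compose[OF _ \<phi>]) (simp add: borel_prod[symmetric])
  have meas: "\<epsilon> (i + k) \<in> borel_measurable M" if "i \<in> {1..3}" for i k
    using that by (intro measurable_noise) auto
  have law: "distr M (PiM {1..3} (\<lambda>_. borel)) (\<lambda>w. \<lambda>i\<in>{1..3}. \<epsilon> (i + k) w)
      = PiM {1..3} (\<lambda>_. distr M borel (\<epsilon> 1))" for k
  proof -
    have "indep_vars (\<lambda>_. borel) (\<lambda>i. \<epsilon> (i + k)) {1..3}"
      by (rule indep_vars_depends_on[where K="\<lambda>i. {i + k}"])
         (auto simp: disjoint_family_on_def intro: depends_on_noise)
    then have "distr M (PiM {1..3} (\<lambda>_. borel)) (\<lambda>w. \<lambda>i\<in>{1..3}. \<epsilon> (i + k) w)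
      = PiM {1..3} (\<lambda>i. distr M borel (\<epsilon> (i + k)))"
      by (subst (asm) indep_vars_iff_distr_eq_PiM') (use meas in auto)
    also have "\<dots> = PiM {1..3} (\<lambda>_. distr M borel (\<epsilon> 1))"
      by (intro PiM_cong refl ident) auto
    finally show ?thesis .
  qed
  have E: "expectation (\<lambda>w. \<phi> (S \<sigma> \<epsilon> (k + 2) w, S \<sigma> \<epsilon> (k + 3) w))
      = (\<integral>x. F x \<partial>PiM {1..3} (\<lambda>_. distr M borel (\<epsilon> 1)))" for k
  proof -
    have [measurable]: "(\<lambda>w. \<lambda>i\<in>{1..3}. \<epsilon> (i + k) w) \<in> measurable M (PiM {1..3} (\<lambda>_. borel))"
      by (intro measurable_restrict meas)
    have "(\<integral>x. F x \<partial>distr M (PiM {1..3} (\<lambda>_. borel)) (\<lambda>w. \<lambda>i\<in>{1..3}. \<epsilon> (i + k) w))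
      = expectation (\<lambda>w. F (\<lambda>i\<in>{1..3}. \<epsilon> (i + k) w))"
      by (rule integral_distr) measurable
    also have "\<dots> = expectation (\<lambda>w. \<phi> (S \<sigma> \<epsilon> (k + 2) w, S \<sigma> \<epsilon> (k + 3) w))"
      by (simp add: F_def S_def \<Delta>_def add.commute numeral_3_eq_3)
    finally show ?thesis by (simp only: law)
  qed
  from E[of k] E[of 0] show ?thesis by (simp only: add_0)
qed

end

section \<open>The Cauchy loss\<close>

text \<open>
  The first derivative of the Cauchy loss \<open>ln (1 + x\<^sup>2)\<close>.
\<close>
definition cauchy_score :: "real \<Rightarrow> real" where
  "cauchy_score x = 2 * x / (1 + x\<^sup>2)"

text \<open>
  The second derivative of the Cauchy loss. It changes sign at \<open>1\<close> and \<open>-1\<close>: the loss is not convex.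
\<close>
definition cauchy_curvature :: "real \<Rightarrow> real" where
  "cauchy_curvature x = 2 * (1 - x\<^sup>2) / (1 + x\<^sup>2)\<^sup>2"

lemma one_plus_square_pos: "0 < 1 + (x::real)\<^sup>2" "1 + (x::real)\<^sup>2 \<noteq> 0"
  by (smt (verit) zero_le_power2)+

lemma DERIV_cauchy_loss: "((\<lambda>x. ln (1 + x\<^sup>2)) has_real_derivative cauchy_score x) (at x)"
  unfolding cauchy_score_def using one_plus_square_pos[of x]
  by (auto intro!: derivative_eq_intros)

lemma DERIV_cauchy_score: "(cauchy_score has_real_derivative cauchy_curvature x) (at x)"
proof -
  have "((\<lambda>x. 2 * x / (1 + x\<^sup>2)) has_real_derivative cauchy_curvature x) (at x)"
    unfolding cauchy_curvature_def using one_plus_square_pos[of x]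
    by (auto intro!: derivative_eq_intros simp: field_simps power2_eq_square)
  then show ?thesis by (simp add: cauchy_score_def[abs_def])
qed

lemma abs_cauchy_score_le: "\<bar>cauchy_score x\<bar> \<le> 1"
proof -
  have "0 \<le> (1 - \<bar>x\<bar>)\<^sup>2" by simp
  then have "2 * \<bar>x\<bar> \<le> 1 + x\<^sup>2" by (simp add: power2_eq_square algebra_simps)
  then show ?thesis
    unfolding cauchy_score_def using one_plus_square_pos[of x] by (simp add: abs_mult)
qed

lemma abs_cauchy_curvature_le': "\<bar>cauchy_curvature x\<bar> \<le> 2 / (1 + x\<^sup>2)"
proof -
  have "\<bar>1 - x\<^sup>2\<bar> \<le> 1 + x\<^sup>2" by (simp add: abs_le_iff)
  then have "\<bar>2 * (1 - x\<^sup>2)\<bar> * (1 + x\<^sup>2) \<le> 2 * (1 + x\<^sup>2)\<^sup>2"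
    using one_plus_square_pos(1)[of x] by (simp add: power2_eq_square abs_mult mult_right_mono)
  then show ?thesis
    unfolding cauchy_curvature_def using one_plus_square_pos[of x] by (simp add: field_simps abs_mult)
qed

lemma abs_cauchy_curvature_le: "\<bar>cauchy_curvature x\<bar> \<le> 2"
proof -
  have "2 / (1 + x\<^sup>2) \<le> 2 / 1" by (rule divide_left_mono) (use one_plus_square_pos in auto)
  then show ?thesis using abs_cauchy_curvature_le'[of x] by linarith
qed

lemma cauchy_loss_Lipschitz: "\<bar>ln (1 + x\<^sup>2) - ln (1 + y\<^sup>2)\<bar> \<le> \<bar>x - y\<bar>" for x y :: real
  using Lipschitz_if_bounded_deriv[OF DERIV_cauchy_loss abs_cauchy_score_le, of x y] by simp

lemma cauchy_curvature_Lipschitz: "\<bar>cauchy_curvature x - cauchy_curvature y\<bar> \<le> 12 * \<bar>x - y\<bar>"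
proof (rule Lipschitz_if_bounded_deriv)
  fix x :: real
  let ?d = "2 * cauchy_score x * ((x\<^sup>2 - 3) / (1 + x\<^sup>2)) * (1 / (1 + x\<^sup>2))"
  note p = one_plus_square_pos[of x]
  have "((\<lambda>x. 2 * (1 - x\<^sup>2) / (1 + x\<^sup>2)\<^sup>2) has_real_derivative
      ((- 4 * x) * (1 + x\<^sup>2)\<^sup>2 - 2 * (1 - x\<^sup>2) * (2 * (1 + x\<^sup>2) * (2 * x))) / ((1 + x\<^sup>2)\<^sup>2 * (1 + x\<^sup>2)\<^sup>2)) (at x)"
    using p by (auto intro!: derivative_eq_intros)
  also have "(- 4 * x) * (1 + x\<^sup>2)\<^sup>2 - 2 * (1 - x\<^sup>2) * (2 * (1 + x\<^sup>2) * (2 * x))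
      = (1 + x\<^sup>2) * (4 * x * (x\<^sup>2 - 3))"
    by (simp add: power2_eq_square algebra_simps)
  also have "(1 + x\<^sup>2) * (4 * x * (x\<^sup>2 - 3)) / ((1 + x\<^sup>2)\<^sup>2 * (1 + x\<^sup>2)\<^sup>2)
      = ?d"
    using p by (simp add: cauchy_score_def power2_eq_square mult.assoc)
  finally show "(cauchy_curvature has_real_derivative
      ?d) (at x)"
    by (simp add: cauchy_curvature_def[abs_def])
  have "\<bar>?d\<bar> \<le> 2 * 1 * 3 * 1"
    unfolding abs_mult
  proof (intro mult_mono)
    show "\<bar>(x\<^sup>2 - 3) / (1 + x\<^sup>2)\<bar> \<le> 3" using p by (simp add: abs_le_iff field_simps)
    show "\<bar>1 / (1 + x\<^sup>2)\<bar> \<le> 1" using p by simp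
  qed (use abs_cauchy_score_le in auto)
  then show "\<bar>?d\<bar> \<le> 12" by simp
qed

lemma cauchy_score_remainder:
  "\<bar>cauchy_score (x - d) - cauchy_score x + d * cauchy_curvature x\<bar> \<le> 12 * d\<^sup>2"
  using taylor_remainder_Lipschitz[OF DERIV_cauchy_score cauchy_curvature_Lipschitz, of x "- d"] by simp

lemma measurable_cauchy [measurable]:
  "cauchy_score \<in> borel_measurable borel" "cauchy_curvature \<in> borel_measurable borel"
  unfolding cauchy_score_def cauchy_curvature_def by measurable

text \<open>
  The curvature is the derivative of the score, which vanishes at both ends of the line.
\<close>
lemma integral_cauchy_curvature:
  "integrable lborel cauchy_curvature" "(\<integral>x. cauchy_curvature x \<partial>lborel) = 0"
proof -
  have "integrable lborel (\<lambda>x::real. inverse (1 + x\<^sup>2))"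
    using integrable_inverse_1_plus_square by (simp add: set_integrable_def)
  then have "integrable lborel (\<lambda>x::real. 2 * inverse (1 + x\<^sup>2))" by simp
  then show int: "integrable lborel cauchy_curvature"
    by (rule Bochner_Integration.integrable_bound)
       (use abs_cauchy_curvature_le' in \<open>auto simp: divide_inverse abs_mult\<close>)
  have lim: "(cauchy_score \<longlongrightarrow> 0) at_top" "(cauchy_score \<longlongrightarrow> 0) at_bot"
    unfolding cauchy_score_def by real_asymp+
  have "(LBINT x=-\<infinity>..\<infinity>. cauchy_curvature x) = 0 - 0"
  proof (rule interval_integral_FTC_integrable)
    show "(cauchy_score has_vector_derivative cauchy_curvature x) (at x)" for x
      using DERIV_cauchy_score by (simp add: has_real_derivative_iff_has_vector_derivative)
    show "isCont cauchy_curvature x" for x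
      unfolding cauchy_curvature_def using one_plus_square_pos[of x] by (auto intro!: continuous_intros)
    show "set_integrable lborel (einterval (- \<infinity>) \<infinity>) cauchy_curvature"
      using int by (simp add: set_integrable_def)
    show "((cauchy_score \<circ> real_of_ereal) \<longlongrightarrow> 0) (at_right (- \<infinity>))"
      using lim(2) by (simp add: ereal_tendsto_simps)
    show "((cauchy_score \<circ> real_of_ereal) \<longlongrightarrow> 0) (at_left \<infinity>)"
      using lim(1) by (simp add: ereal_tendsto_simps)
  qed auto
  then show "(\<integral>x. cauchy_curvature x \<partial>lborel) = 0"
    by (simp add: interval_lebesgue_integral_def set_lebesgue_integral_def)
qed

text \<open>
  Since the curvature integrates to \<open>0\<close>, the density may be replaced by \<open>f - f 1\<close>. The two factors then
  have the same sign everywhere, and their product is bounded below on \<open>[c1, c2]\<close>.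
\<close>
lemma integral_cauchy_curvature_pos:
  fixes f :: "real \<Rightarrow> real"
  assumes int: "integrable lborel f" and nonneg: "\<And>x. f x \<ge> 0" and even: "\<And>x. f (- x) = f x" and "f 1 > 0"
    and out: "\<And>x. x \<ge> 1 \<Longrightarrow> f x \<le> f 1" and inn: "\<And>x. 0 \<le> x \<Longrightarrow> x \<le> 1 \<Longrightarrow> f 1 \<le> f x"
    and c: "0 < c1" "c1 < c2" "c2 < 1" "b > 0"
    and gap: "\<And>x. c1 \<le> x \<Longrightarrow> x \<le> c2 \<Longrightarrow> (1 + b) * f 1 \<le> f x"
  shows "(\<integral>x. cauchy_curvature x * f x \<partial>lborel) > 0"
proof -
  let ?k = cauchy_curvature
  have [measurable]: "f \<in> borel_measurable borel" using int by (auto dest: borel_measurable_integrable)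
  have int1: "integrable lborel (\<lambda>x. ?k x * f x)"
    by (rule Bochner_Integration.integrable_bound[OF integrable_mult_right[OF int, of 2]])
       (use abs_cauchy_curvature_le nonneg in \<open>auto simp: abs_mult intro!: mult_right_mono\<close>)
  have int2: "integrable lborel (\<lambda>x. ?k x * f 1)" using integral_cauchy_curvature(1) by simp
  have sq: "x\<^sup>2 \<le> 1 \<longleftrightarrow> \<bar>x\<bar> \<le> 1" for x :: real by (simp add: abs_square_le_1)
  have lower: "?k x * (f x - f 1) \<ge> (1 - c2\<^sup>2) / 2 * (b * f 1) * indicator {c1..c2} x" for x
  proof (cases "x \<in> {c1..c2}")
    case True
    then have x: "0 < x" "x \<le> c2" "x < 1" "c1 \<le> x" using c by auto
    have "x\<^sup>2 \<le> c2\<^sup>2" "x\<^sup>2 \<le> 1" "c2\<^sup>2 \<le> 1" using x c by (auto simp: power_mono sq)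
    have "(1 + x\<^sup>2)\<^sup>2 \<le> 2\<^sup>2" using \<open>x\<^sup>2 \<le> 1\<close> by (intro power_mono) auto
    then have "2 * (1 - c2\<^sup>2) / 4 \<le> 2 * (1 - x\<^sup>2) / (1 + x\<^sup>2)\<^sup>2"
      using \<open>x\<^sup>2 \<le> c2\<^sup>2\<close> \<open>x\<^sup>2 \<le> 1\<close> one_plus_square_pos[of x] by (intro frac_le) auto
    moreover have "2 * (1 - c2\<^sup>2) / 4 = (1 - c2\<^sup>2) / 2" by simp
    ultimately have "(1 - c2\<^sup>2) / 2 \<le> ?k x" by (simp only: cauchy_curvature_def)
    moreover have "b * f 1 \<le> f x - f 1" using gap[of x] x by (simp add: algebra_simps)
    moreover have "0 \<le> b * f 1" using c \<open>f 1 > 0\<close> by simp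
    ultimately have "(1 - c2\<^sup>2) / 2 * (b * f 1) \<le> ?k x * (f x - f 1)"
      using \<open>c2\<^sup>2 \<le> 1\<close> by (intro mult_mono) auto
    then show ?thesis using True by simp
  next
    case False
    have fa: "f x = f \<bar>x\<bar>" using even[of x] by (cases "x \<ge> 0") auto
    have "0 \<le> ?k x * (f x - f 1)"
    proof (cases "\<bar>x\<bar> \<le> 1")
      case True
      then have "0 \<le> ?k x" using sq[of x] by (simp add: cauchy_curvature_def)
      moreover have "f 1 \<le> f x" unfolding fa using inn[of "\<bar>x\<bar>"] True by simp
      ultimately show ?thesis by simp
    next
      case False
      then have "?k x \<le> 0" using sq[of x] by (simp add: cauchy_curvature_def divide_nonpos_nonneg)
      moreover have "f x \<le> f 1" unfolding fa using out[of "\<bar>x\<bar>"] False by simp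
      ultimately show ?thesis by (simp add: mult_nonpos_nonpos)
    qed
    then show ?thesis using False by simp
  qed
  have c2sq: "c2\<^sup>2 < 1" using c by (simp add: abs_square_less_1)
  have "0 < (1 - c2\<^sup>2) / 2 * (b * f 1) * (c2 - c1)" using c c2sq \<open>f 1 > 0\<close> by simp
  also have "\<dots> = (\<integral>x. (1 - c2\<^sup>2) / 2 * (b * f 1) * indicator {c1..c2} x \<partial>lborel)"
    using c by simp
  also have "\<dots> \<le> (\<integral>x. ?k x * (f x - f 1) \<partial>lborel)"
  proof (rule integral_mono)
    show "integrable lborel (\<lambda>x. ?k x * (f x - f 1))"
      using int1 int2 by (simp add: right_diff_distrib)
    show "integrable lborel (\<lambda>x. (1 - c2\<^sup>2) / 2 * (b * f 1) * indicator {c1..c2} x)"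
      by (intro integrable_mult_right integrable_real_indicator) (use c in auto)
  qed (rule lower)
  also have "\<dots> = (\<integral>x. ?k x * f x \<partial>lborel) - (\<integral>x. ?k x * f 1 \<partial>lborel)"
    unfolding right_diff_distrib using int1 int2 by (rule Bochner_Integration.integral_diff)
  also have "\<dots> = (\<integral>x. ?k x * f x \<partial>lborel)" using integral_cauchy_curvature(2) by simp
  finally show ?thesis .
qed

lemma integral_cauchy_score_even:
  fixes f :: "real \<Rightarrow> real"
  assumes even: "\<And>x. f (- x) = f x"
  shows "(\<integral>x. cauchy_score x * f x \<partial>lborel) = 0"
proof -
  have "(\<integral>x. cauchy_score x * f x \<partial>lborel) = (\<integral>x. cauchy_score (- x) * f (- x) \<partial>lborel)"
    using lborel_integral_real_affine[of "- 1" "\<lambda>x. cauchy_score x * f x" 0] by simp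
  also have "\<dots> = - (\<integral>x. cauchy_score x * f x \<partial>lborel)"
    by (simp add: even cauchy_score_def)
  finally show ?thesis by simp
qed

section \<open>The empirical loss as a deterministic function\<close>

text \<open>
  Normalised to vanish at \<open>v = 0\<close>. Differences of losses are bounded even though the loss itself is not,
  and Hoeffding's inequality needs bounded summands.
\<close>
definition mean_loss :: "(nat \<Rightarrow> real ^ 'q) \<Rightarrow> (nat \<Rightarrow> real) \<Rightarrow> nat \<Rightarrow> real ^ 'q \<Rightarrow> real" where
  "mean_loss a s n v = (1 / n) * (\<Sum>j=2..n. ln (1 + (s j - a j \<bullet> v)\<^sup>2) - ln (1 + (s j)\<^sup>2))"

definition score_vec :: "(nat \<Rightarrow> real ^ 'q) \<Rightarrow> (nat \<Rightarrow> real) \<Rightarrow> nat \<Rightarrow> real ^ 'q" where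
  "score_vec a s n = (1 / sqrt n) *\<^sub>R (\<Sum>j=2..n. cauchy_score (s j) *\<^sub>R a j)"

definition curvature_mat :: "(nat \<Rightarrow> real ^ 'q) \<Rightarrow> (nat \<Rightarrow> real) \<Rightarrow> nat \<Rightarrow> real ^ 'q ^ 'q" where
  "curvature_mat a s n = (1 / n) *\<^sub>R (\<Sum>j=2..n. cauchy_curvature (s j) *\<^sub>R outer (a j) (a j))"

lemma mean_loss_Lipschitz:
  assumes a: "\<And>j. j \<ge> 2 \<Longrightarrow> norm (a j) \<le> C" and "C \<ge> 0"
  shows "\<bar>mean_loss a s n v - mean_loss a s n w\<bar> \<le> C * norm (v - w)"
proof (cases "n = 0")
  case False
  let ?l = "\<lambda>v j. ln (1 + (s j - a j \<bullet> v)\<^sup>2)"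
  have "mean_loss a s n v - mean_loss a s n w = (1 / n) * (\<Sum>j=2..n. ?l v j - ?l w j)"
    unfolding mean_loss_def right_diff_distrib[symmetric] sum_subtractf by simp
  then have "\<bar>mean_loss a s n v - mean_loss a s n w\<bar> = (1 / n) * \<bar>\<Sum>j=2..n. ?l v j - ?l w j\<bar>"
    by (simp add: abs_mult)
  also have "\<bar>\<Sum>j=2..n. ?l v j - ?l w j\<bar> \<le> (\<Sum>j=2..n. \<bar>?l v j - ?l w j\<bar>)" by (rule sum_abs)
  also have "\<dots> \<le> (\<Sum>j=2..n. C * norm (v - w))"
  proof (rule sum_mono)
    fix j assume "j \<in> {2..n}"
    have "\<bar>?l v j - ?l w j\<bar> \<le> \<bar>s j - a j \<bullet> v - (s j - a j \<bullet> w)\<bar>" by (rule cauchy_loss_Lipschitz)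
    also have "\<dots> = \<bar>a j \<bullet> (v - w)\<bar>" by (simp add: inner_diff_right abs_minus_commute)
    also have "\<dots> \<le> norm (a j) * norm (v - w)" by (rule Cauchy_Schwarz_ineq2)
    also have "\<dots> \<le> C * norm (v - w)" using a \<open>j \<in> {2..n}\<close> by (intro mult_right_mono) auto
    finally show "\<bar>?l v j - ?l w j\<bar> \<le> C * norm (v - w)" .
  qed
  also have "\<dots> \<le> n * (C * norm (v - w))" using \<open>C \<ge> 0\<close> by (simp add: mult_right_mono)
  finally show ?thesis using False by (simp add: field_simps)
qed (simp add: mean_loss_def \<open>C \<ge> 0\<close>)

lemma mean_loss_0 [simp]: "mean_loss a s n 0 = 0"
  by (simp add: mean_loss_def)

text \<open>
  Moving from \<open>v\<close> in the direction of the score changes the loss at a rate proportional to minus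
  the squared norm of the score, which a local minimum excludes unless the score vanishes.
\<close>
lemma score_equation:
  assumes "r > 0" "n > 0" and min: "\<And>w. norm (w - v) < r \<Longrightarrow> mean_loss a s n v \<le> mean_loss a s n w"
  shows "(\<Sum>j=2..n. cauchy_score (s j - a j \<bullet> v) *\<^sub>R a j) = 0"
proof -
  define g where "g = (\<Sum>j=2..n. cauchy_score (s j - a j \<bullet> v) *\<^sub>R a j)"
  define \<phi> where "\<phi> t = (\<Sum>j=2..n. ln (1 + (s j - a j \<bullet> v - t * (a j \<bullet> g))\<^sup>2))" for t
  have "(\<phi> has_real_derivative (\<Sum>j=2..n. cauchy_score (s j - a j \<bullet> v - 0 * (a j \<bullet> g)) * (- (a j \<bullet> g)))) (at 0)"
    unfolding \<phi>_def
    by (intro DERIV_sum DERIV_chain2[OF DERIV_cauchy_loss]) (auto intro!: derivative_eq_intros)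
  also have "(\<Sum>j=2..n. cauchy_score (s j - a j \<bullet> v - 0 * (a j \<bullet> g)) * (- (a j \<bullet> g))) = - (g \<bullet> g)"
    by (subst (3) g_def) (simp add: inner_sum_left sum_negf)
  finally have D: "(\<phi> has_real_derivative - (g \<bullet> g)) (at 0)" .
  have \<phi>: "mean_loss a s n (v + t *\<^sub>R g) = (1 / n) * (\<phi> t - (\<Sum>j=2..n. ln (1 + (s j)\<^sup>2)))" for t
    by (simp add: mean_loss_def \<phi>_def sum_subtractf inner_add_right diff_diff_eq)
  have "- (g \<bullet> g) = 0"
  proof (rule DERIV_local_min[OF D])
    show "0 < r / (norm g + 1)" using \<open>r > 0\<close> by (simp add: add_nonneg_pos)
    show "\<forall>y. \<bar>0 - y\<bar> < r / (norm g + 1) \<longrightarrow> \<phi> 0 \<le> \<phi> y"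
    proof (intro allI impI)
      fix y :: real assume "\<bar>0 - y\<bar> < r / (norm g + 1)"
      then have "\<bar>y\<bar> * (norm g + 1) < r" by (simp add: pos_less_divide_eq add_nonneg_pos)
      moreover have "\<bar>y\<bar> * norm g \<le> \<bar>y\<bar> * (norm g + 1)" by (intro mult_left_mono) auto
      ultimately have "mean_loss a s n v \<le> mean_loss a s n (v + y *\<^sub>R g)" by (intro min) simp
      then have "mean_loss a s n (v + 0 *\<^sub>R g) \<le> mean_loss a s n (v + y *\<^sub>R g)" by simp
      then show "\<phi> 0 \<le> \<phi> y" unfolding \<phi> using \<open>n > 0\<close> by (simp add: divide_le_cancel)
    qed
  qed
  then show ?thesis by (simp add: g_def)
qed

text \<open>
  The remainder is quadratic in \<open>v\<close>, but one factor is kept in rescaled form: the error is a small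
  multiple of the rescaled parameter as soon as \<open>v\<close> is small.
\<close>
lemma score_linearization:
  assumes a: "\<And>j. j \<ge> 2 \<Longrightarrow> norm (a j) \<le> C" and "C \<ge> 0" "n > 0"
    and eq: "(\<Sum>j=2..n. cauchy_score (s j - a j \<bullet> v) *\<^sub>R a j) = 0"
  shows "norm (score_vec a s n - curvature_mat a s n *v (sqrt n *\<^sub>R v)) \<le> 12 * C ^ 3 * norm v * norm (sqrt n *\<^sub>R v)"
proof -
  let ?r = "\<lambda>j. cauchy_score (s j - a j \<bullet> v) - cauchy_score (s j) + (a j \<bullet> v) * cauchy_curvature (s j)"
  have rn: "sqrt n > 0" using \<open>n > 0\<close> by simp
  have G: "curvature_mat a s n *v (sqrt n *\<^sub>R v) = (1 / sqrt n) *\<^sub>R (\<Sum>j=2..n. (cauchy_curvature (s j) * (a j \<bullet> v)) *\<^sub>R a j)"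
  proof -
    have "curvature_mat a s n *v (sqrt n *\<^sub>R v)
        = (sqrt n / n) *\<^sub>R (\<Sum>j=2..n. (cauchy_curvature (s j) * (a j \<bullet> v)) *\<^sub>R a j)"
      unfolding curvature_mat_def matrix_vector_mult_scaleR scaleR_matrix_vector_assoc[symmetric]
        linear_sum[OF linear_matrix_mult_left, unfolded o_def] outer_mult_vec by simp
    also have "sqrt n / n = 1 / sqrt n" using rn by (simp add: real_div_sqrt field_simps)
    finally show ?thesis .
  qed
  have "(\<Sum>j=2..n. ?r j *\<^sub>R a j) = (\<Sum>j=2..n. cauchy_score (s j - a j \<bullet> v) *\<^sub>R a j)
      - (\<Sum>j=2..n. cauchy_score (s j) *\<^sub>R a j) + (\<Sum>j=2..n. (cauchy_curvature (s j) * (a j \<bullet> v)) *\<^sub>R a j)"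
    by (simp add: scaleR_left_diff_distrib scaleR_left_distrib sum.distrib sum_subtractf mult.commute)
  then have h: "(\<Sum>j=2..n. ?r j *\<^sub>R a j) = (\<Sum>j=2..n. (cauchy_curvature (s j) * (a j \<bullet> v)) *\<^sub>R a j)
      - (\<Sum>j=2..n. cauchy_score (s j) *\<^sub>R a j)"
    unfolding eq by simp
  have "score_vec a s n - curvature_mat a s n *v (sqrt n *\<^sub>R v) = - (1 / sqrt n) *\<^sub>R (\<Sum>j=2..n. ?r j *\<^sub>R a j)"
    unfolding G score_vec_def h by (simp only: scaleR_diff_right scaleR_minus_left minus_diff_minus minus_diff_eq)
  then have n_eq: "norm (score_vec a s n - curvature_mat a s n *v (sqrt n *\<^sub>R v))
      = (1 / sqrt n) * norm (\<Sum>j=2..n. ?r j *\<^sub>R a j)" by simp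
  have "norm (\<Sum>j=2..n. ?r j *\<^sub>R a j) \<le> (\<Sum>j=2..n. 12 * C ^ 3 * (norm v)\<^sup>2)"
  proof (rule sum_norm_le)
    fix j assume j: "j \<in> {2..n}"
    have "\<bar>a j \<bullet> v\<bar> \<le> C * norm v"
      by (rule order_trans[OF Cauchy_Schwarz_ineq2]) (use a j in \<open>auto intro!: mult_right_mono\<close>)
    then have "(a j \<bullet> v)\<^sup>2 \<le> (C * norm v)\<^sup>2" by (metis abs_ge_zero power2_abs power_mono)
    then have "\<bar>?r j\<bar> \<le> 12 * (C * norm v)\<^sup>2"
      using cauchy_score_remainder[of "s j" "a j \<bullet> v"] by linarith
    then have "\<bar>?r j\<bar> * norm (a j) \<le> 12 * (C * norm v)\<^sup>2 * C"
      using a j \<open>C \<ge> 0\<close> by (intro mult_mono) auto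
    then show "norm (?r j *\<^sub>R a j) \<le> 12 * C ^ 3 * (norm v)\<^sup>2"
      by (simp add: power2_eq_square power3_eq_cube mult_ac)
  qed
  also have "\<dots> \<le> n * (12 * C ^ 3 * (norm v)\<^sup>2)" using \<open>C \<ge> 0\<close> by (simp add: mult_right_mono)
  finally have "(1 / sqrt n) * norm (\<Sum>j=2..n. ?r j *\<^sub>R a j) \<le> (1 / sqrt n) * (n * (12 * C ^ 3 * (norm v)\<^sup>2))"
    using rn by (intro mult_left_mono) auto
  also have "(1 / sqrt n) * (n * (12 * C ^ 3 * (norm v)\<^sup>2)) = 12 * C ^ 3 * norm v * (sqrt n * norm v)"
    using rn by (simp add: field_simps power2_eq_square)
  finally show ?thesis using n_eq rn by simp
qed

text \<open>
  Two perturbations, of the matrix and of the linearised equation, each cost a quarter of the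
  coercivity constant.
\<close>
lemma norm_le_score:
  fixes \<Gamma> :: "real ^ 'q ^ 'q"
  assumes "\<rho> > 0" and pd: "\<rho> * (norm u)\<^sup>2 \<le> u \<bullet> (\<Gamma> *v u)"
    and G: "norm (G *v u - \<Gamma> *v u) \<le> \<rho> / 4 * norm u"
    and W: "norm (W - G *v u) \<le> \<rho> / 4 * norm u"
  shows "\<rho> / 2 * norm u \<le> norm W"
proof (cases "u = 0")
  case False
  have "u \<bullet> W = u \<bullet> (\<Gamma> *v u) + u \<bullet> (G *v u - \<Gamma> *v u) + u \<bullet> (W - G *v u)"
    by (simp add: inner_diff_right)
  moreover have "\<bar>u \<bullet> (G *v u - \<Gamma> *v u)\<bar> \<le> norm u * (\<rho> / 4 * norm u)"
    by (rule order_trans[OF Cauchy_Schwarz_ineq2 mult_left_mono[OF G]]) simp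
  moreover have "\<bar>u \<bullet> (W - G *v u)\<bar> \<le> norm u * (\<rho> / 4 * norm u)"
    by (rule order_trans[OF Cauchy_Schwarz_ineq2 mult_left_mono[OF W]]) simp
  moreover have "u \<bullet> W \<le> norm u * norm W" by (rule norm_cauchy_schwarz)
  ultimately have "\<rho> * (norm u)\<^sup>2 - 2 * (norm u * (\<rho> / 4 * norm u)) \<le> norm u * norm W"
    using pd by linarith
  then have "norm u * (\<rho> / 2 * norm u) \<le> norm u * norm W"
    by (simp add: power2_eq_square algebra_simps)
  then show ?thesis using False by simp
qed simp

section \<open>Exponentially small sequences\<close>

text \<open>
  Exponential bounds are needed because the exceptional events must be dominated by a Gaussian tail
  at radii up to order \<open>sqrt n\<close>.
\<close>
definition exponentially_small :: "(nat \<Rightarrow> real) \<Rightarrow> bool" where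
  "exponentially_small p \<longleftrightarrow> (\<exists>A c. c > 0 \<and> (\<forall>\<^sub>F n in sequentially. p n \<le> A * exp (- c * real n)))"

lemma exponentially_smallI:
  "c > 0 \<Longrightarrow> (\<forall>\<^sub>F n in sequentially. p n \<le> A * exp (- c * real n)) \<Longrightarrow> exponentially_small p"
  unfolding exponentially_small_def by blast

lemma exponentially_small_mono:
  assumes "exponentially_small q" "\<forall>\<^sub>F n in sequentially. p n \<le> q n"
  shows "exponentially_small p"
proof -
  obtain A c where "c > 0" and A: "\<forall>\<^sub>F n in sequentially. q n \<le> A * exp (- c * real n)"
    using assms(1) unfolding exponentially_small_def by blast
  from A assms(2) have "\<forall>\<^sub>F n in sequentially. p n \<le> A * exp (- c * real n)"
    by eventually_elim simp
  then show ?thesis by (rule exponentially_smallI[OF \<open>c > 0\<close>])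
qed

lemma exponentially_small_add:
  assumes "exponentially_small p" "exponentially_small q"
  shows "exponentially_small (\<lambda>n. p n + q n)"
proof -
  obtain A c where c: "c > 0" and A: "\<forall>\<^sub>F n in sequentially. p n \<le> A * exp (- c * real n)"
    using assms(1) unfolding exponentially_small_def by blast
  obtain A' c' where c': "c' > 0" and A': "\<forall>\<^sub>F n in sequentially. q n \<le> A' * exp (- c' * real n)"
    using assms(2) unfolding exponentially_small_def by blast
  have le: "x * exp (- d * real n) \<le> \<bar>x\<bar> * exp (- min c c' * real n)" if "min c c' \<le> d" for x d n
    using that by (intro mult_mono) (auto intro!: mult_right_mono)
  from A A' have "\<forall>\<^sub>F n in sequentially. p n + q n \<le> (\<bar>A\<bar> + \<bar>A'\<bar>) * exp (- min c c' * real n)"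
  proof eventually_elim
    case (elim n)
    then show ?case using le[of c A n] le[of c' A' n] by (simp add: distrib_right)
  qed
  then show ?thesis using c c' by (intro exponentially_smallI[of "min c c'"]) auto
qed

lemma exponentially_small_sum:
  "finite I \<Longrightarrow> (\<And>i. i \<in> I \<Longrightarrow> exponentially_small (p i)) \<Longrightarrow> exponentially_small (\<lambda>n. \<Sum>i\<in>I. p i n)"
proof (induction I rule: finite_induct)
  case empty
  show ?case by (rule exponentially_smallI[of 1 _ 0]) auto
next
  case (insert i I)
  then show ?case using exponentially_small_add[of "p i"] by simp
qed

lemma exponentially_small_tendsto:
  assumes "exponentially_small p" "\<And>n. 0 \<le> p n"
  shows "p \<longlonglongrightarrow> 0"
proof -
  obtain A c where c: "c > 0" and A: "\<forall>\<^sub>F n in sequentially. p n \<le> A * exp (- c * real n)"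
    using assms(1) unfolding exponentially_small_def by blast
  have "norm (exp (- c)) < 1" using c by simp
  then have "(\<lambda>n. A * exp (- c) ^ n) \<longlonglongrightarrow> A * 0"
    by (intro tendsto_mult tendsto_const LIMSEQ_power_zero)
  then have lim: "(\<lambda>n. A * exp (- c * real n)) \<longlonglongrightarrow> 0" by (simp only: exp_of_nat2_mult mult_zero_right)
  have "\<forall>\<^sub>F n in sequentially. 0 \<le> p n" using assms(2) by simp
  from tendsto_sandwich[OF this A tendsto_const lim] show ?thesis .
qed

section \<open>Concentration in the regression model\<close>

text \<open>
  Here \<open>a\<close> stands for the increments of the covariates, and \<open>err\<close> bounds the distance between the expected
  loss and its quadratically separated limit. The estimator is any measurable minimiser of the empirical
  loss over the closure of the parameter set.
\<close>
locale cauchy_regression = independent_sequence M \<epsilon> for M :: "'a measure" and \<epsilon> +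
  fixes \<sigma> CX lam :: real and a :: "nat \<Rightarrow> real ^ 'q" and \<Theta> :: "(real ^ 'q) set"
    and \<mu>0 :: "real ^ 'q" and \<mu>h :: "nat \<Rightarrow> 'a \<Rightarrow> real ^ 'q" and err :: "nat \<Rightarrow> real"
    and C0 D0 :: "real ^ 'q ^ 'q"
  assumes ident: "\<And>j. j \<ge> 1 \<Longrightarrow> distr M borel (\<epsilon> j) = distr M borel (\<epsilon> 1)"
    and CX: "CX > 0" "\<And>j. j \<ge> 2 \<Longrightarrow> norm (a j) \<le> CX"
    and \<Theta>: "open \<Theta>" "bounded \<Theta>" "\<mu>0 \<in> \<Theta>"
    and centred: "expectation (\<lambda>w. cauchy_score (S \<sigma> \<epsilon> 2 w)) = 0"
    and curved: "expectation (\<lambda>w. cauchy_curvature (S \<sigma> \<epsilon> 2 w)) > 0"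
    and C0: "positive_definite C0"
    and gram: "(\<lambda>n. (1 / real n) *\<^sub>R (\<Sum>j=2..n. outer (a j) (a j))) \<longlonglongrightarrow> C0"
    and cross_gram: "(\<lambda>n. (1 / (real n - 2)) *\<^sub>R (\<Sum>j=2..n-1. outer (a j) (a (j + 1)))) \<longlonglongrightarrow> D0"
    and separation: "lam > 0" "err \<longlonglongrightarrow> 0" "\<And>n \<mu>. n \<ge> 2 \<Longrightarrow> \<mu> \<in> \<Theta> \<Longrightarrow> lam * (norm (\<mu> - \<mu>0))\<^sup>2 - err n \<le>
        (1 / real n) * (\<Sum>j=2..n. expectation (\<lambda>w. ln (1 + (S \<sigma> \<epsilon> 2 w - a j \<bullet> (\<mu> - \<mu>0))\<^sup>2)
                                               - ln (1 + (S \<sigma> \<epsilon> 2 w)\<^sup>2)))"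
    and estimator_measurable: "\<And>n. n \<ge> 2 \<Longrightarrow> \<mu>h n \<in> borel_measurable M"
    and estimator: "\<And>n w. n \<ge> 2 \<Longrightarrow> w \<in> space M \<Longrightarrow> \<mu>h n w \<in> closure \<Theta>"
      "\<And>n w \<mu>. n \<ge> 2 \<Longrightarrow> w \<in> space M \<Longrightarrow> \<mu> \<in> closure \<Theta> \<Longrightarrow>
        mean_loss a (\<lambda>j. S \<sigma> \<epsilon> j w) n (\<mu>h n w - \<mu>0) \<le> mean_loss a (\<lambda>j. S \<sigma> \<epsilon> j w) n (\<mu> - \<mu>0)"
begin

abbreviation incr :: "nat \<Rightarrow> 'a \<Rightarrow> real" where "incr \<equiv> S \<sigma> \<epsilon>"
abbreviation incrs :: "'a \<Rightarrow> nat \<Rightarrow> real" where "incrs w \<equiv> \<lambda>j. incr j w"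
abbreviation score :: "nat \<Rightarrow> 'a \<Rightarrow> real ^ 'q" where "score n w \<equiv> score_vec a (incrs w) n"
abbreviation \<Sigma> :: "real ^ 'q ^ 'q" where "\<Sigma> \<equiv> Sigma0 M \<epsilon> \<sigma> C0 D0"
abbreviation curv :: "nat \<Rightarrow> 'a \<Rightarrow> real ^ 'q ^ 'q" where "curv n w \<equiv> curvature_mat a (incrs w) n"

definition \<Gamma> :: "real ^ 'q ^ 'q" where
  "\<Gamma> = expectation (\<lambda>w. cauchy_curvature (incr 2 w)) *\<^sub>R C0"

lemma depends_on_incr: "j \<ge> 2 \<Longrightarrow> depends_on {j - 1, j} (incr j)"
proof -
  assume "j \<ge> 2"
  then have "depends_on {j - 1, j} (\<lambda>w. \<sigma> * (\<epsilon> j w - \<epsilon> (j - 1) w))"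
    by (intro depends_on_comp[of _ _ "\<lambda>x. \<sigma> * x"] depends_on_diff depends_on_noise) auto
  also have "(\<lambda>w. \<sigma> * (\<epsilon> j w - \<epsilon> (j - 1) w)) = incr j" by (simp add: fun_eq_iff S_def \<Delta>_def)
  finally show ?thesis .
qed

lemma measurable_incr: "j \<ge> 2 \<Longrightarrow> incr j \<in> borel_measurable M"
  by (rule measurable_depends_on[OF depends_on_incr])

lemma expectation_incr:
  fixes \<phi> :: "real \<Rightarrow> real"
  assumes "j \<ge> 2" and [measurable]: "\<phi> \<in> borel_measurable borel"
  shows "expectation (\<lambda>w. \<phi> (incr j w)) = expectation (\<lambda>w. \<phi> (incr 2 w))"
proof -
  have "(\<lambda>(x, y). \<phi> x) \<in> borel_measurable (borel :: (real \<times> real) measure)"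
    by (simp add: borel_prod[symmetric])
  from expectation_increments_shift[OF ident this, of \<sigma> "j - 2"] have "expectation (\<lambda>w. \<phi> (incr (j - 2 + 2) w)) = expectation (\<lambda>w. \<phi> (incr 2 w))"
    by simp
  moreover have "j - 2 + 2 = j" using \<open>j \<ge> 2\<close> by auto
  ultimately show ?thesis by (simp only:)
qed

lemma expectation_incr_product:
  fixes \<phi> :: "real \<Rightarrow> real"
  assumes "j \<ge> 2" and [measurable]: "\<phi> \<in> borel_measurable borel"
  shows "expectation (\<lambda>w. \<phi> (incr j w) * \<phi> (incr (j + 1) w))
       = expectation (\<lambda>w. \<phi> (incr 2 w) * \<phi> (incr 3 w))"
proof -
  have "(\<lambda>(x, y). \<phi> x * \<phi> y) \<in> borel_measurable (borel :: (real \<times> real) measure)"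
    by (simp add: borel_prod[symmetric])
  from expectation_increments_shift[OF ident this, of \<sigma> "j - 2"]
  have "expectation (\<lambda>w. \<phi> (incr (j - 2 + 2) w) * \<phi> (incr (j - 2 + 3) w))
      = expectation (\<lambda>w. \<phi> (incr 2 w) * \<phi> (incr 3 w))" by simp
  moreover have "j - 2 + 2 = j" "j - 2 + 3 = j + 1" using \<open>j \<ge> 2\<close> by auto
  ultimately show ?thesis by (simp only:)
qed

abbreviation deviation :: "(nat \<Rightarrow> real \<Rightarrow> real) \<Rightarrow> nat \<Rightarrow> 'a \<Rightarrow> real" where
  "deviation h n w \<equiv> \<bar>(\<Sum>j=2..n. h j (incr j w)) - (\<Sum>j=2..n. expectation (\<lambda>w. h j (incr 2 w)))\<bar>"

text \<open>
  The centring is written with the first increment because all increments have the same law.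
\<close>
lemma increment_concentration:
  fixes h :: "nat \<Rightarrow> real \<Rightarrow> real"
  assumes [measurable]: "\<And>j. h j \<in> borel_measurable borel"
    and bd: "\<And>j x. j \<ge> 2 \<Longrightarrow> \<bar>h j x\<bar> \<le> K" and "K > 0" "t > 0" "n \<ge> 2"
  shows "prob {w\<in>space M. t * n \<le> deviation h n w}
         \<le> 4 * exp (- (t\<^sup>2 / (8 * K\<^sup>2)) * n)"
proof -
  have "prob {w\<in>space M. t * n \<le> \<bar>(\<Sum>j=2..n. h j (incr j w)) - (\<Sum>j=2..n. expectation (\<lambda>w. h j (incr j w)))\<bar>}
      \<le> 4 * exp (- (t * n)\<^sup>2 / (8 * K\<^sup>2 * n))"
  proof (rule Hoeffding_one_dependent)
    fix j assume "j \<in> {2..n}"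
    then have "j \<ge> 2" by simp
    then show "depends_on {j - 1, j} (\<lambda>w. h j (incr j w))"
      by (rule depends_on_comp[OF depends_on_incr assms(1)])
    show "\<bar>h j (incr j w)\<bar> \<le> K" for w using bd \<open>j \<ge> 2\<close> .
  qed (use assms(3-5) in auto)
  also have "(\<Sum>j=2..n. expectation (\<lambda>w. h j (incr j w))) = (\<Sum>j=2..n. expectation (\<lambda>w. h j (incr 2 w)))"
    by (intro sum.cong refl expectation_incr) auto
  also have "- (t * n)\<^sup>2 / (8 * K\<^sup>2 * n) = - (t\<^sup>2 / (8 * K\<^sup>2)) * n"
    using \<open>n \<ge> 2\<close> \<open>K > 0\<close> by (simp add: field_simps power2_eq_square)
  finally show ?thesis .
qed

lemma loss_term_bound:
  assumes "j \<ge> 2" "norm v \<le> R"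
  shows "\<bar>ln (1 + (x - a j \<bullet> v)\<^sup>2) - ln (1 + x\<^sup>2)\<bar> \<le> CX * R"
proof -
  have "\<bar>ln (1 + (x - a j \<bullet> v)\<^sup>2) - ln (1 + x\<^sup>2)\<bar> \<le> \<bar>x - a j \<bullet> v - x\<bar>" by (rule cauchy_loss_Lipschitz)
  also have "\<dots> \<le> norm (a j) * norm v" using Cauchy_Schwarz_ineq2[of "a j" v] by simp
  also have "\<dots> \<le> CX * R" using CX assms by (intro mult_mono) auto
  finally show ?thesis .
qed

lemma closure_radius:
  obtains R where "R > 0" "\<And>\<mu>. \<mu> \<in> closure \<Theta> \<Longrightarrow> norm (\<mu> - \<mu>0) \<le> R"
proof -
  have "bounded (closure \<Theta>)" using \<Theta>(2) by (rule bounded_closure)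
  then obtain b where b: "\<And>\<mu>. \<mu> \<in> closure \<Theta> \<Longrightarrow> norm \<mu> \<le> b" by (auto simp: bounded_iff)
  have "norm (\<mu> - \<mu>0) \<le> \<bar>b\<bar> + norm \<mu>0 + 1" if "\<mu> \<in> closure \<Theta>" for \<mu>
    using norm_triangle_ineq4[of \<mu> \<mu>0] b[OF that] by linarith
  then show ?thesis by (intro that[of "\<bar>b\<bar> + norm \<mu>0 + 1"]) (auto intro: add_nonneg_pos)
qed

lemma measurable_incr_sum:
  fixes h :: "nat \<Rightarrow> real \<Rightarrow> real"
  assumes [measurable]: "\<And>j. h j \<in> borel_measurable borel"
  shows "(\<lambda>w. \<Sum>j=2..n. h j (incr j w)) \<in> borel_measurable M"
proof (rule borel_measurable_sum)
  fix j assume "j \<in> {2..n}"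
  then have [measurable]: "incr j \<in> borel_measurable M" by (intro measurable_incr) auto
  show "(\<lambda>w. h j (incr j w)) \<in> borel_measurable M" by measurable
qed

lemma measurable_score_vec: "(\<lambda>w. score n w) \<in> borel_measurable M"
  unfolding score_vec_def
proof (intro borel_measurable_scaleR borel_measurable_const borel_measurable_sum)
  fix j assume "j \<in> {2..n}"
  then have [measurable]: "incr j \<in> borel_measurable M" by (intro measurable_incr) auto
  show "(\<lambda>w. cauchy_score (incr j w)) \<in> borel_measurable M" by measurable
qed

lemma measurable_curvature_mat: "(\<lambda>w. curv n w $ i $ k) \<in> borel_measurable M"
proof -
  have "(\<lambda>w. \<Sum>j=2..n. cauchy_curvature (incr j w) * (a j $ i * a j $ k)) \<in> borel_measurable M"
    by (rule measurable_incr_sum[of "\<lambda>j s. cauchy_curvature s * (a j $ i * a j $ k)"]) measurable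
  then have "(\<lambda>w. (1 / real n) * (\<Sum>j=2..n. cauchy_curvature (incr j w) * (a j $ i * a j $ k))) \<in> borel_measurable M"
    by measurable
  then show ?thesis by (simp add: curvature_mat_def)
qed

text \<open>
  At a net point near an estimate that is far from \<open>\<mu>0\<close>, the expected loss is bounded below while the
  empirical loss is almost nonpositive, since the estimator does at least as well as \<open>\<mu>0\<close>. So the two deviate by a
  fixed amount at one of finitely many nonrandom points.
\<close>
lemma estimator_exponentially_consistent:
  assumes "\<delta> > 0"
  shows "exponentially_small (\<lambda>n. prob {w\<in>space M. \<delta> \<le> norm (\<mu>h n w - \<mu>0)})"
proof -
  obtain R where R: "R > 0" "\<And>\<mu>. \<mu> \<in> closure \<Theta> \<Longrightarrow> norm (\<mu> - \<mu>0) \<le> R" using closure_radius by blast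
  \<comment> \<open>At distance \<open>\<delta> / 2\<close> the separation is \<open>4 \<kappa>\<close>: one \<open>\<kappa>\<close> pays for \<open>err\<close>, one for the mesh, and two are left.\<close>
  define \<kappa> where "\<kappa> = lam * \<delta>\<^sup>2 / 16"
  have \<kappa>: "\<kappa> > 0" using separation(1) \<open>\<delta> > 0\<close> by (simp add: \<kappa>_def)
  \<comment> \<open>The mesh keeps a net point at distance at least \<open>\<delta> / 2\<close> from \<open>\<mu>0\<close> and changes the loss by at most \<open>\<kappa>\<close>.\<close>
  define \<eta> where "\<eta> = min (\<delta> / 2) (\<kappa> / CX)"
  have \<eta>: "\<eta> > 0" "\<eta> \<le> \<delta> / 2" "CX * \<eta> \<le> \<kappa>"
    using \<open>\<delta> > 0\<close> \<kappa> CX(1) by (auto simp: \<eta>_def min_def field_simps)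
  have "compact (closure \<Theta>)" using \<Theta>(2) by (simp add: compact_closure)
  moreover have "closure \<Theta> \<subseteq> (\<Union>x\<in>\<Theta>. ball x \<eta>)"
    using \<eta>(1) by (auto simp: closure_approachable dist_commute)
  ultimately obtain net where net: "net \<subseteq> \<Theta>" "finite net" "closure \<Theta> \<subseteq> (\<Union>x\<in>net. ball x \<eta>)"
    using compactE_image[of "closure \<Theta>" \<Theta> "\<lambda>x. ball x \<eta>"] by auto
  define h where "h x j s = ln (1 + (s - a j \<bullet> (x - \<mu>0))\<^sup>2) - ln (1 + s\<^sup>2)" for x j s
  have [measurable]: "h x j \<in> borel_measurable borel" for x j unfolding h_def by measurable
  define E where "E x n = {w\<in>space M. (2 * \<kappa>) * n \<le> deviation (h x) n w}" for x n
  have mE: "E x n \<in> sets M" for x n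
  proof -
    have [measurable]: "(\<lambda>w. \<Sum>j=2..n. h x j (incr j w)) \<in> borel_measurable M"
      by (rule measurable_incr_sum) measurable
    show ?thesis unfolding E_def by measurable
  qed
  have "exponentially_small (\<lambda>n. \<Sum>x\<in>net. prob (E x n))"
  proof (rule exponentially_small_sum[OF net(2)])
    fix x assume "x \<in> net"
    then have "norm (x - \<mu>0) \<le> R" using net(1) closure_subset R(2) by blast
    then have "\<forall>\<^sub>F n in sequentially. prob (E x n) \<le> 4 * exp (- ((2 * \<kappa>)\<^sup>2 / (8 * (CX * R)\<^sup>2)) * real n)"
      unfolding E_def
      by (intro eventually_sequentiallyI[of 2] increment_concentration)
         (use \<kappa> CX(1) R(1) in \<open>auto simp: h_def intro!: loss_term_bound\<close>)
    then show "exponentially_small (\<lambda>n. prob (E x n))"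
      by (rule exponentially_smallI[rotated]) (use \<kappa> CX(1) R(1) in auto)
  qed
  moreover have "\<forall>\<^sub>F n in sequentially. prob {w\<in>space M. \<delta> \<le> norm (\<mu>h n w - \<mu>0)} \<le> (\<Sum>x\<in>net. prob (E x n))"
    using order_tendstoD(2)[OF separation(2) \<kappa>] eventually_ge_at_top[of 2]
  proof eventually_elim
    case (elim n)
    have "{w\<in>space M. \<delta> \<le> norm (\<mu>h n w - \<mu>0)} \<subseteq> (\<Union>x\<in>net. E x n)"
    proof
      fix w assume "w \<in> {w\<in>space M. \<delta> \<le> norm (\<mu>h n w - \<mu>0)}"
      then have w: "w \<in> space M" and far: "\<delta> \<le> norm (\<mu>h n w - \<mu>0)" by auto
      have "\<mu>h n w \<in> closure \<Theta>" using estimator(1) elim w by auto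
      then obtain x where x: "x \<in> net" "dist x (\<mu>h n w) < \<eta>" using net(3) by auto
      let ?m = "\<Sum>j=2..n. expectation (\<lambda>w. h x j (incr 2 w))"
      have near: "norm ((x - \<mu>0) - (\<mu>h n w - \<mu>0)) \<le> \<eta>" using x(2) by (simp add: dist_norm)
      have "\<delta> / 2 \<le> norm (x - \<mu>0)"
        using near far \<eta>(2) norm_triangle_ineq2[of "\<mu>h n w - \<mu>0" "x - \<mu>0"]
        by (simp add: norm_minus_commute)
      then have "(\<delta> / 2)\<^sup>2 \<le> (norm (x - \<mu>0))\<^sup>2" using \<open>\<delta> > 0\<close> by (intro power_mono) auto
      then have "4 * \<kappa> \<le> lam * (norm (x - \<mu>0))\<^sup>2"
        using separation(1) by (simp add: \<kappa>_def power2_eq_square field_simps)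
      moreover have "lam * (norm (x - \<mu>0))\<^sup>2 - err n \<le> (1 / n) * ?m"
        unfolding h_def using separation(3) elim(2) x(1) net(1) by blast
      ultimately have 1: "3 * \<kappa> \<le> (1 / n) * ?m"
        using elim(1) by linarith
      have "\<bar>mean_loss a (incrs w) n (x - \<mu>0) - mean_loss a (incrs w) n (\<mu>h n w - \<mu>0)\<bar>
          \<le> CX * norm ((x - \<mu>0) - (\<mu>h n w - \<mu>0))"
        by (rule mean_loss_Lipschitz) (use CX in auto)
      also have "\<dots> \<le> CX * \<eta>" using near CX(1) by (intro mult_left_mono) auto
      finally have "mean_loss a (incrs w) n (x - \<mu>0) \<le> mean_loss a (incrs w) n (\<mu>h n w - \<mu>0) + \<kappa>"
        using \<eta>(3) by linarith
      moreover have "mean_loss a (incrs w) n (\<mu>h n w - \<mu>0) \<le> 0"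
        using estimator(2)[OF elim(2) w, of \<mu>0] \<Theta>(3) closure_subset by auto
      ultimately have 2: "(1 / n) * (\<Sum>j=2..n. h x j (incr j w)) \<le> \<kappa>"
        by (simp add: mean_loss_def h_def)
      have "2 * \<kappa> \<le> (1 / n) * (?m - (\<Sum>j=2..n. h x j (incr j w)))"
        using 1 2 unfolding right_diff_distrib by linarith
      then have "(2 * \<kappa>) * n \<le> ?m - (\<Sum>j=2..n. h x j (incr j w))"
        using elim(2) by (simp add: field_simps)
      then have "w \<in> E x n" unfolding E_def using w by simp
      then show "w \<in> (\<Union>x\<in>net. E x n)" using x(1) by blast
    qed
    then have "prob {w\<in>space M. \<delta> \<le> norm (\<mu>h n w - \<mu>0)} \<le> prob (\<Union>x\<in>net. E x n)"
      using mE net(2) by (intro finite_measure_mono) auto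
    also have "\<dots> \<le> (\<Sum>x\<in>net. prob (E x n))"
      using mE net(2) by (intro finite_measure_subadditive_finite) auto
    finally show ?case .
  qed
  ultimately show ?thesis by (rule exponentially_small_mono)
qed

text \<open>
  The expectation of the curvature matrix is a multiple of the Gram matrix, which converges; the
  fluctuations are controlled entry by entry.
\<close>
lemma curvature_concentration:
  assumes "\<eta> > 0"
  shows "exponentially_small (\<lambda>n. prob {w\<in>space M. \<exists>i k. \<eta> < \<bar>(curv n w - \<Gamma>) $ i $ k\<bar>})"
proof -
  define \<gamma> where "\<gamma> = expectation (\<lambda>w. cauchy_curvature (incr 2 w))"
  define E where "E p n = {w\<in>space M. \<eta> < \<bar>(curv n w - \<Gamma>) $ fst p $ snd p\<bar>}" for p n
  have mE: "E p n \<in> sets M" for p n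
  proof -
    note [measurable] = measurable_curvature_mat
    show ?thesis unfolding E_def vector_minus_component by measurable
  qed
  have "exponentially_small (\<lambda>n. \<Sum>p\<in>UNIV. prob (E p n))"
  proof (rule exponentially_small_sum)
    fix p :: "'q \<times> 'q"
    define i k where "i = fst p" and "k = snd p"
    define h where "h j s = cauchy_curvature s * (a j $ i * a j $ k)" for j s
    have [measurable]: "h j \<in> borel_measurable borel" for j unfolding h_def by measurable
    have hb: "\<bar>h j s\<bar> \<le> 2 * CX\<^sup>2" if "j \<ge> 2" for j s
    proof -
      have "\<bar>a j $ l\<bar> \<le> CX" for l using component_le_norm_cart[of "a j" l] CX(2)[OF that] by linarith
      then have "\<bar>a j $ i\<bar> * \<bar>a j $ k\<bar> \<le> CX * CX" using CX(1) by (intro mult_mono) auto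
      then show ?thesis
        unfolding h_def abs_mult[of "cauchy_curvature s"] abs_mult[of "a j $ i"] power2_eq_square
        by (rule mult_mono[OF abs_cauchy_curvature_le]) auto
    qed
    have Eh: "expectation (\<lambda>w. h j (incr 2 w)) = \<gamma> * (a j $ i * a j $ k)" for j
      by (simp add: h_def \<gamma>_def)
    have "(\<lambda>n. ((1 / real n) *\<^sub>R (\<Sum>j=2..n. outer (a j) (a j))) $ i $ k) \<longlonglongrightarrow> C0 $ i $ k"
      by (intro tendsto_vec_nth gram)
    then have "(\<lambda>n. \<gamma> * ((1 / real n) * (\<Sum>j=2..n. a j $ i * a j $ k))) \<longlonglongrightarrow> \<gamma> * C0 $ i $ k"
      by (intro tendsto_mult tendsto_const) simp
    from tendstoD[OF this, of "\<eta> / 2"]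
    have ev: "\<forall>\<^sub>F n in sequentially. \<bar>\<gamma> * ((1 / real n) * (\<Sum>j=2..n. a j $ i * a j $ k)) - \<gamma> * C0 $ i $ k\<bar> < \<eta> / 2"
      using \<open>\<eta> > 0\<close> by (simp add: dist_real_def)
    have "\<forall>\<^sub>F n in sequentially. prob (E p n) \<le> 4 * exp (- ((\<eta> / 2)\<^sup>2 / (8 * (2 * CX\<^sup>2)\<^sup>2)) * real n)"
      using ev eventually_ge_at_top[of 2]
    proof eventually_elim
      case (elim n)
      let ?D = "\<lambda>w. (\<Sum>j=2..n. h j (incr j w)) - (\<Sum>j=2..n. expectation (\<lambda>w. h j (incr 2 w)))"
      have "E p n \<subseteq> {w\<in>space M. (\<eta> / 2) * n \<le> deviation h n w}"
      proof
        fix w assume "w \<in> E p n"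
        then have w: "w \<in> space M" "\<eta> < \<bar>(curv n w - \<Gamma>) $ i $ k\<bar>"
          by (auto simp: E_def i_def k_def)
        have "(curv n w - \<Gamma>) $ i $ k
            = (1 / n) * ?D w + (\<gamma> * ((1 / real n) * (\<Sum>j=2..n. a j $ i * a j $ k)) - \<gamma> * C0 $ i $ k)"
          unfolding Eh by (simp add: curvature_mat_def \<Gamma>_def h_def flip: \<gamma>_def)
             (simp add: sum_distrib_left[symmetric] diff_divide_distrib)
        then have "\<eta> / 2 < \<bar>(1 / n) * ?D w\<bar>" using w(2) elim(1) by linarith
        then have "\<eta> / 2 < (1 / n) * deviation h n w" by (simp add: abs_mult)
        then have "(\<eta> / 2) * n \<le> deviation h n w" using elim(2) by (simp add: field_simps)
        then show "w \<in> {w\<in>space M. (\<eta> / 2) * n \<le> deviation h n w}" using w(1) by simp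
      qed
      then have "prob (E p n) \<le> prob {w\<in>space M. (\<eta> / 2) * n \<le> deviation h n w}"
      proof (rule finite_measure_mono)
        have [measurable]: "(\<lambda>w. \<Sum>j=2..n. h j (incr j w)) \<in> borel_measurable M"
          by (rule measurable_incr_sum) measurable
        show "{w\<in>space M. (\<eta> / 2) * n \<le> deviation h n w} \<in> sets M" by measurable
      qed
      also have "\<dots> \<le> 4 * exp (- ((\<eta> / 2)\<^sup>2 / (8 * (2 * CX\<^sup>2)\<^sup>2)) * real n)"
        by (rule increment_concentration) (use hb \<open>\<eta> > 0\<close> CX(1) elim(2) in auto)
      finally show ?case .
    qed
    then show "exponentially_small (\<lambda>n. prob (E p n))"
      by (rule exponentially_smallI[rotated]) (use \<open>\<eta> > 0\<close> CX(1) in auto)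
  qed simp
  moreover have "prob {w\<in>space M. \<exists>i k. \<eta> < \<bar>(curv n w - \<Gamma>) $ i $ k\<bar>} \<le> (\<Sum>p\<in>UNIV. prob (E p n))" for n
  proof -
    have "{w\<in>space M. \<exists>i k. \<eta> < \<bar>(curv n w - \<Gamma>) $ i $ k\<bar>} = (\<Union>p\<in>UNIV. E p n)"
      by (auto simp: E_def) blast
    also have "prob \<dots> \<le> (\<Sum>p\<in>UNIV. prob (E p n))"
      using mE by (intro finite_measure_subadditive_finite) auto
    finally show ?thesis .
  qed
  ultimately show ?thesis by (rule exponentially_small_mono[OF _ always_eventually[OF allI]])
qed

end

section \<open>Tails of the estimation error\<close>

context cauchy_regression begin

abbreviation scaled :: "nat \<Rightarrow> 'a \<Rightarrow> real ^ 'q" where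
  "scaled n w \<equiv> sqrt (real n) *\<^sub>R (\<mu>h n w - \<mu>0)"
abbreviation tail :: "nat \<Rightarrow> real \<Rightarrow> real" where
  "tail n r \<equiv> prob {w\<in>space M. r < norm (scaled n w)}"

lemma expectation_score: "j \<ge> 2 \<Longrightarrow> expectation (\<lambda>w. cauchy_score (incr j w)) = 0"
  using expectation_incr[of j cauchy_score] centred by simp

text \<open>
  If the norm exceeds \<open>r\<close>, then some coordinate is at least \<open>r / q\<close> in absolute value.
\<close>
lemma score_tail:
  assumes "n \<ge> 2" "r > 0"
  shows "prob {w\<in>space M. r < norm (score n w)}
         \<le> 4 * real CARD('q) * exp (- (r / real CARD('q))\<^sup>2 / (8 * CX\<^sup>2))"
proof -
  define q where "q = real CARD('q)"
  have "q > 0" by (simp add: q_def)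
  define t where "t = r / q / sqrt n"
  have "sqrt n > 0" using \<open>n \<ge> 2\<close> by simp
  then have t: "t > 0" "t * n = (r / q) * sqrt n" "t\<^sup>2 * n = (r / q)\<^sup>2"
    using \<open>r > 0\<close> \<open>q > 0\<close> by (simp_all add: t_def power_divide field_simps)
  define E where "E i = {w\<in>space M. r / q \<le> \<bar>score n w $ i\<bar>}" for i
  have mE: "E i \<in> sets M" for i
  proof -
    note [measurable] = measurable_score_vec
    show ?thesis unfolding E_def by measurable
  qed
  have pE: "prob (E i) \<le> 4 * exp (- (r / q)\<^sup>2 / (8 * CX\<^sup>2))" for i
  proof -
    define h where "h j s = cauchy_score s * a j $ i" for j s
    have [measurable]: "h j \<in> borel_measurable borel" for j unfolding h_def by measurable
    have bd: "\<bar>h j s\<bar> \<le> CX" if "j \<ge> 2" for j s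
    proof -
      have "\<bar>a j $ i\<bar> \<le> CX" using component_le_norm_cart[of "a j" i] CX(2)[OF that] by linarith
      then have "\<bar>cauchy_score s\<bar> * \<bar>a j $ i\<bar> \<le> 1 * CX"
        by (rule mult_mono[OF abs_cauchy_score_le]) auto
      then show ?thesis by (simp add: h_def abs_mult)
    qed
    have mean: "expectation (\<lambda>w. h j (incr 2 w)) = 0" for j using centred by (simp add: h_def)
    have "E i = {w\<in>space M. t * n \<le> deviation h n w}"
      unfolding E_def mean t(2) using \<open>sqrt n > 0\<close>
      by (simp add: score_vec_def h_def pos_le_divide_eq)
    also have "prob \<dots> \<le> 4 * exp (- (t\<^sup>2 / (8 * CX\<^sup>2)) * n)"
      by (rule increment_concentration) (use bd CX(1) t(1) \<open>n \<ge> 2\<close> in auto)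
    also have "- (t\<^sup>2 / (8 * CX\<^sup>2)) * n = - (r / q)\<^sup>2 / (8 * CX\<^sup>2)" by (simp add: t(3)[symmetric])
    finally show ?thesis .
  qed
  have "{w\<in>space M. r < norm (score n w)} \<subseteq> (\<Union>i\<in>UNIV. E i)"
  proof
    fix w assume w: "w \<in> {w\<in>space M. r < norm (score n w)}"
    show "w \<in> (\<Union>i\<in>UNIV. E i)"
    proof (rule ccontr)
      assume "w \<notin> (\<Union>i\<in>UNIV. E i)"
      then have "\<bar>score n w $ i\<bar> \<le> r / q" for i using w by (auto simp: E_def not_le less_imp_le)
      then have "(\<Sum>i\<in>UNIV. \<bar>score n w $ i\<bar>) \<le> (\<Sum>i\<in>(UNIV :: 'q set). r / q)" by (intro sum_mono)
      also have "\<dots> = r" using \<open>q > 0\<close> by (simp add: q_def)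
      finally show False using w norm_le_l1_cart[of "score n w"] by auto
    qed
  qed
  then have "prob {w\<in>space M. r < norm (score n w)} \<le> prob (\<Union>i\<in>UNIV. E i)"
    using mE by (intro finite_measure_mono) auto
  also have "\<dots> \<le> (\<Sum>i\<in>UNIV. prob (E i))" using mE by (intro finite_measure_subadditive_finite) auto
  also have "\<dots> \<le> (\<Sum>i\<in>(UNIV :: 'q set). 4 * exp (- (r / q)\<^sup>2 / (8 * CX\<^sup>2)))" by (intro sum_mono pE)
  finally show ?thesis by (simp add: q_def)
qed

lemma \<Gamma>_positive_definite:
  obtains \<rho> where "\<rho> > 0" "\<And>x. \<rho> * (norm x)\<^sup>2 \<le> x \<bullet> (\<Gamma> *v x)"
proof -
  obtain \<rho>0 where \<rho>0: "\<rho>0 > 0" "\<And>x. \<rho>0 * (norm x)\<^sup>2 \<le> x \<bullet> (C0 *v x)"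
    using positive_definite_lower_bound[OF C0] by blast
  let ?\<gamma> = "expectation (\<lambda>w. cauchy_curvature (incr 2 w))"
  show ?thesis
  proof (rule that)
    show "0 < ?\<gamma> * \<rho>0" using curved \<rho>0(1) by simp
    fix x
    have "?\<gamma> * (\<rho>0 * (norm x)\<^sup>2) \<le> ?\<gamma> * (x \<bullet> (C0 *v x))"
      using curved \<rho>0(2) by (intro mult_left_mono) auto
    then show "?\<gamma> * \<rho>0 * (norm x)\<^sup>2 \<le> x \<bullet> (\<Gamma> *v x)"
      by (simp add: \<Gamma>_def mult.assoc flip: scaleR_matrix_vector_assoc)
  qed
qed

abbreviation expands :: "nat \<Rightarrow> 'a \<Rightarrow> bool" where
  "expands n w \<equiv> norm (score n w - curv n w *v scaled n w)
     \<le> 12 * CX ^ 3 * norm (\<mu>h n w - \<mu>0) * norm (scaled n w)"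

text \<open>
  An estimate in a ball around \<open>\<mu>0\<close> that lies inside the parameter set is an interior minimiser, hence
  satisfies the score equation.
\<close>
lemma estimator_linearization:
  obtains \<delta> where "\<delta> > 0" "\<And>n w. n \<ge> 2 \<Longrightarrow> w \<in> space M \<Longrightarrow> norm (\<mu>h n w - \<mu>0) < \<delta> \<Longrightarrow> expands n w"
proof -
  obtain \<delta> where \<delta>: "\<delta> > 0" "ball \<mu>0 \<delta> \<subseteq> \<Theta>" using \<Theta>(1,3) open_contains_ball by blast
  show ?thesis
  proof (rule that[OF \<delta>(1)])
    fix n w assume n: "n \<ge> 2" and w: "w \<in> space M" and near: "norm (\<mu>h n w - \<mu>0) < \<delta>"
    show "expands n w"
    proof (rule score_linearization)
      show "(\<Sum>j=2..n. cauchy_score (incr j w - a j \<bullet> (\<mu>h n w - \<mu>0)) *\<^sub>R a j) = 0"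
      proof (rule score_equation[where n=n])
        show "\<delta> - norm (\<mu>h n w - \<mu>0) > 0" using near by simp
        fix v assume v: "norm (v - (\<mu>h n w - \<mu>0)) < \<delta> - norm (\<mu>h n w - \<mu>0)"
        have "norm v < \<delta>" using v norm_triangle_ineq2[of v "\<mu>h n w - \<mu>0"] by linarith
        then have "\<mu>0 + v \<in> closure \<Theta>"
          using \<delta>(2) closure_subset[of \<Theta>] by (auto simp: dist_norm subset_iff)
        then show "mean_loss a (incrs w) n (\<mu>h n w - \<mu>0) \<le> mean_loss a (incrs w) n v"
          using estimator(2)[OF n w, of "\<mu>0 + v"] by simp
      qed (use n in auto)
    qed (use CX n in auto)
  qed
qed

text \<open>
  Consistency and curvature concentration are used together: off one exponentially small event, the score is
  the limiting curvature matrix applied to the rescaled error, up to two small errors.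
\<close>
lemma linearization_off_rare_event:
  assumes "\<delta> > 0" "\<eta> > 0"
  obtains rare where "\<And>n. n \<ge> 2 \<Longrightarrow> rare n \<in> sets M" "exponentially_small (\<lambda>n. prob (rare n))"
    "\<And>n w. n \<ge> 2 \<Longrightarrow> w \<in> space M - rare n \<Longrightarrow> norm (\<mu>h n w - \<mu>0) < \<delta>"
    "\<And>n w. n \<ge> 2 \<Longrightarrow> w \<in> space M - rare n \<Longrightarrow> expands n w"
    "\<And>n w. n \<ge> 2 \<Longrightarrow> w \<in> space M - rare n \<Longrightarrow>
      norm (curv n w *v scaled n w - \<Gamma> *v scaled n w) \<le> \<eta> * norm (scaled n w)"
proof -
  define q where "q = real CARD('q)"
  have "q > 0" by (simp add: q_def)
  obtain \<delta>0 where \<delta>0: "\<delta>0 > 0" "\<And>n w. n \<ge> 2 \<Longrightarrow> w \<in> space M \<Longrightarrow> norm (\<mu>h n w - \<mu>0) < \<delta>0 \<Longrightarrow> expands n w"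
    using estimator_linearization by blast
  define E1 where "E1 n = {w\<in>space M. min \<delta>0 \<delta> \<le> norm (\<mu>h n w - \<mu>0)}" for n
  define E2 where "E2 n = {w\<in>space M. \<exists>i k. \<eta> / (q * q) < \<bar>(curv n w - \<Gamma>) $ i $ k\<bar>}" for n
  have m: "E1 n \<in> sets M" "E2 n \<in> sets M" if "n \<ge> 2" for n
  proof -
    note [measurable] = estimator_measurable[OF that] measurable_curvature_mat
    show "E1 n \<in> sets M" "E2 n \<in> sets M" unfolding E1_def E2_def vector_minus_component by measurable
  qed
  have small: "exponentially_small (\<lambda>n. prob (E1 n) + prob (E2 n))"
    unfolding E1_def E2_def
    by (intro exponentially_small_add estimator_exponentially_consistent curvature_concentration)
       (use \<delta>0(1) assms \<open>q > 0\<close> in auto)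
  show ?thesis
  proof (rule that[of "\<lambda>n. E1 n \<union> E2 n"])
    show "exponentially_small (\<lambda>n. prob (E1 n \<union> E2 n))"
      by (rule exponentially_small_mono[OF small], rule eventually_sequentiallyI[of 2])
         (intro measure_Un_le m)
    fix n :: nat and w assume n: "n \<ge> 2" and "w \<in> space M - (E1 n \<union> E2 n)"
    then have w: "w \<in> space M" "w \<notin> E1 n \<union> E2 n" by auto
    have near: "norm (\<mu>h n w - \<mu>0) < min \<delta>0 \<delta>" using w by (auto simp: E1_def not_le)
    then show "norm (\<mu>h n w - \<mu>0) < \<delta>" by simp
    show "expands n w"
      using \<delta>0(2)[OF n w(1)] near by simp
    have "norm ((curv n w - \<Gamma>) *v scaled n w) \<le> q * q * (\<eta> / (q * q)) * norm (scaled n w)"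
      unfolding q_def by (rule norm_matrix_mult_le) (use w in \<open>auto simp: E2_def q_def not_less\<close>)
    then show "norm (curv n w *v scaled n w - \<Gamma> *v scaled n w) \<le> \<eta> * norm (scaled n w)"
      using \<open>q > 0\<close> by (simp add: matrix_vector_mult_diff_rdistrib)
  qed (use m in blast)
qed

text \<open>
  Off an exponentially small event the rescaled error is at most \<open>2 / \<rho>\<close> times the score, which is
  sub-Gaussian. The probability of the rare event depends on \<open>n\<close> and not on \<open>r\<close>, but the error never
  exceeds \<open>sqrt n * R\<close>, so only radii with \<open>n \<ge> r\<^sup>2 / R\<^sup>2\<close> matter.
\<close>
lemma subgaussian_tail:
  obtains A c where "c > 0"
    "\<And>n r. n \<ge> 2 \<Longrightarrow> r > 0 \<Longrightarrow> tail n r \<le> A * exp (- c * r\<^sup>2)"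
proof -
  define q where "q = real CARD('q)"
  have "q > 0" by (simp add: q_def)
  obtain R where R: "R > 0" "\<And>\<mu>. \<mu> \<in> closure \<Theta> \<Longrightarrow> norm (\<mu> - \<mu>0) \<le> R" using closure_radius by blast
  obtain \<rho> where \<rho>: "\<rho> > 0" "\<And>x. \<rho> * (norm x)\<^sup>2 \<le> x \<bullet> (\<Gamma> *v x)" using \<Gamma>_positive_definite by blast
  \<comment> \<open>The radius \<open>\<delta>\<close> makes the linearisation error at most a quarter of the coercivity bound.\<close>
  define \<delta> where "\<delta> = \<rho> / (48 * CX ^ 3)"
  have \<delta>: "\<delta> > 0" "12 * CX ^ 3 * \<delta> = \<rho> / 4" using \<rho>(1) CX(1) by (auto simp: \<delta>_def)
  have "\<rho> / 4 > 0" using \<rho>(1) by simp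
  obtain rare where mR: "\<And>n. n \<ge> 2 \<Longrightarrow> rare n \<in> sets M" and rare: "exponentially_small (\<lambda>n. prob (rare n))"
    and off: "\<And>n w. n \<ge> 2 \<Longrightarrow> w \<in> space M - rare n \<Longrightarrow> norm (\<mu>h n w - \<mu>0) < \<delta>"
      "\<And>n w. n \<ge> 2 \<Longrightarrow> w \<in> space M - rare n \<Longrightarrow> expands n w"
      "\<And>n w. n \<ge> 2 \<Longrightarrow> w \<in> space M - rare n \<Longrightarrow>
        norm (curv n w *v scaled n w - \<Gamma> *v scaled n w) \<le> \<rho> / 4 * norm (scaled n w)"
    by (rule linearization_off_rare_event[OF \<delta>(1) \<open>\<rho> / 4 > 0\<close>]) (rule that)
  obtain A c n0 where c: "c > 0" and A: "\<And>n. n \<ge> n0 \<Longrightarrow> prob (rare n) \<le> A * exp (- c * real n)"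
    using rare unfolding exponentially_small_def eventually_sequentially by blast
  \<comment> \<open>The first rate absorbs the rare event, the second is that of the score.\<close>
  define d where "d = min (c / R\<^sup>2) ((\<rho> / (2 * q))\<^sup>2 / (8 * CX\<^sup>2))"
  have d: "d > 0" using c R(1) \<rho>(1) \<open>q > 0\<close> CX(1) by (simp add: d_def)
  have bound: "tail n r
      \<le> (\<bar>A\<bar> + 4 * q + exp (d * (real n0 * R\<^sup>2))) * exp (- d * r\<^sup>2)"
    if n: "n \<ge> 2" and r: "r > 0" for n r
  proof -
    note [measurable] = estimator_measurable[OF n] measurable_score_vec
    have le: "norm (scaled n w) \<le> sqrt n * R" if "w \<in> space M" for w
      using R(2)[OF estimator(1)[OF n that]] by (simp add: mult_left_mono)
    \<comment> \<open>Radii above \<open>sqrt n * R\<close> are never reached, and those below it are bounded for the finitely many \<open>n < n0\<close>.\<close>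
    consider "r > sqrt n * R" | "r \<le> sqrt n * R" "n < n0" | "r \<le> sqrt n * R" "n \<ge> n0" by linarith
    then show ?thesis
    proof cases
      case 1
      then have "{w\<in>space M. r < norm (scaled n w)} = {}"
        using le by (auto simp: not_less) (metis le less_le_trans not_less order_less_imp_le)
      then have "tail n r = 0" by (simp only: measure_empty)
      then show ?thesis using \<open>q > 0\<close> by (simp only:) (simp add: add_nonneg_nonneg)
    next
      case 2
      have "r\<^sup>2 \<le> (sqrt n * R)\<^sup>2" using 2(1) r by (intro power_mono) auto
      also have "\<dots> = n * R\<^sup>2" by (simp add: power_mult_distrib)
      also have "\<dots> \<le> n0 * R\<^sup>2" using 2(2) by (intro mult_right_mono) auto
      finally have "d * r\<^sup>2 \<le> d * (n0 * R\<^sup>2)" using d by simp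
      then have "1 \<le> exp (d * (n0 * R\<^sup>2)) * exp (- d * r\<^sup>2)" by (simp add: exp_add[symmetric])
      also have "\<dots> \<le> (\<bar>A\<bar> + 4 * q + exp (d * (real n0 * R\<^sup>2))) * exp (- d * r\<^sup>2)"
        using \<open>q > 0\<close> by (intro mult_right_mono) auto
      finally show ?thesis using order_trans[OF prob_le_1] by blast
    next
      case 3
      let ?B = "{w\<in>space M. \<rho> / 2 * r < norm (score n w)}"
      have mB: "?B \<in> sets M" by measurable
      have "{w\<in>space M. r < norm (scaled n w)} \<subseteq> rare n \<union> ?B"
      proof
        fix w assume "w \<in> {w\<in>space M. r < norm (scaled n w)}"
        then have w: "w \<in> space M" and big: "r < norm (scaled n w)" by auto
        have "\<rho> / 2 * norm (scaled n w) \<le> norm (score n w)"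
          if "w \<notin> rare n"
        proof (rule norm_le_score[OF \<rho>(1) \<rho>(2)])
          have w': "w \<in> space M - rare n" using w that by blast
          have "12 * CX ^ 3 * norm (\<mu>h n w - \<mu>0) \<le> 12 * CX ^ 3 * \<delta>"
            using off(1)[OF n w'] CX(1) by (intro mult_left_mono) auto
          also note \<delta>(2)
          finally have "12 * CX ^ 3 * norm (\<mu>h n w - \<mu>0) * norm (scaled n w) \<le> \<rho> / 4 * norm (scaled n w)"
            by (rule mult_right_mono) simp
          then show "norm (score n w - curv n w *v scaled n w) \<le> \<rho> / 4 * norm (scaled n w)"
            using off(2)[OF n w'] by linarith
          show "norm (curv n w *v scaled n w - \<Gamma> *v scaled n w) \<le> \<rho> / 4 * norm (scaled n w)"
            by (rule off(3)[OF n w'])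
        qed
        moreover have "\<rho> / 2 * r < \<rho> / 2 * norm (scaled n w)" using big \<rho>(1) by simp
        ultimately show "w \<in> rare n \<union> ?B" using w by fastforce
      qed
      then have "tail n r \<le> prob (rare n \<union> ?B)"
        using mR[OF n] mB by (intro finite_measure_mono) auto
      also have "\<dots> \<le> prob (rare n) + prob ?B"
        using mR[OF n] mB by (intro measure_Un_le) auto
      also have "prob (rare n) \<le> \<bar>A\<bar> * exp (- d * r\<^sup>2)"
      proof -
        have "r\<^sup>2 \<le> (sqrt n * R)\<^sup>2" using 3(1) r by (intro power_mono) auto
        then have "r\<^sup>2 \<le> n * R\<^sup>2" by (simp add: power_mult_distrib)
        then have "d * r\<^sup>2 \<le> (c / R\<^sup>2) * (n * R\<^sup>2)" using d c R(1) by (intro mult_mono) (auto simp: d_def)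
        also have "\<dots> = c * n" using R(1) by simp
        finally have "A * exp (- c * n) \<le> \<bar>A\<bar> * exp (- d * r\<^sup>2)" by (intro mult_mono) auto
        with A[OF 3(2)] show ?thesis by linarith
      qed
      also have "prob ?B \<le> 4 * q * exp (- d * r\<^sup>2)"
      proof -
        have "d * r\<^sup>2 \<le> (\<rho> / (2 * q))\<^sup>2 / (8 * CX\<^sup>2) * r\<^sup>2" by (intro mult_right_mono) (auto simp: d_def)
        also have "\<dots> = (\<rho> / 2 * r / q)\<^sup>2 / (8 * CX\<^sup>2)" by (simp add: power_mult_distrib power_divide)
        finally have "exp (- (\<rho> / 2 * r / q)\<^sup>2 / (8 * CX\<^sup>2)) \<le> exp (- d * r\<^sup>2)" by simp
        then have "4 * q * exp (- (\<rho> / 2 * r / q)\<^sup>2 / (8 * CX\<^sup>2)) \<le> 4 * q * exp (- d * r\<^sup>2)"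
          using \<open>q > 0\<close> by (intro mult_left_mono) auto
        moreover have "prob ?B \<le> 4 * q * exp (- (\<rho> / 2 * r / q)\<^sup>2 / (8 * CX\<^sup>2))"
          unfolding q_def by (rule score_tail[OF n]) (use \<rho>(1) r in auto)
        ultimately show ?thesis by linarith
      qed
      finally have "tail n r \<le> (\<bar>A\<bar> + 4 * q) * exp (- d * r\<^sup>2)"
        by (simp add: distrib_right)
      also have "\<dots> \<le> (\<bar>A\<bar> + 4 * q + exp (d * (real n0 * R\<^sup>2))) * exp (- d * r\<^sup>2)"
        by (intro mult_right_mono) auto
      finally show ?thesis .
    qed
  qed
  show ?thesis by (rule that[OF d bound])
qed

text \<open>
  As \<open>ln r \<le> r\<close>, the exponent \<open>L ln r - c r\<^sup>2\<close> is at most the maximum \<open>L\<^sup>2 / (4 c)\<close> of \<open>L r - c r\<^sup>2\<close>.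
\<close>
lemma tail_moment_bound:
  assumes "L > 0"
  obtains C where "\<And>n r. n \<ge> 2 \<Longrightarrow> r > 0 \<Longrightarrow>
    tail n r * r powr L \<le> C"
proof -
  obtain A c where c: "c > 0" and A: "\<And>n r. n \<ge> 2 \<Longrightarrow> r > 0 \<Longrightarrow>
      tail n r \<le> A * exp (- c * r\<^sup>2)"
    by (rule subgaussian_tail) (rule that)
  have "tail n r * r powr L \<le> \<bar>A\<bar> * exp (L\<^sup>2 / (4 * c))"
    if n: "n \<ge> 2" and r: "r > 0" for n r
  proof -
    have "(2 * c * r - L)\<^sup>2 = L\<^sup>2 - (L * r - c * r\<^sup>2) * (4 * c)"
      by (simp add: power2_eq_square algebra_simps)
    then have "(L * r - c * r\<^sup>2) * (4 * c) \<le> L\<^sup>2" using zero_le_power2[of "2 * c * r - L"] by linarith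
    then have "L * r - c * r\<^sup>2 \<le> L\<^sup>2 / (4 * c)" using c by (simp add: pos_le_divide_eq)
    moreover have "L * ln r \<le> L * r" using \<open>L > 0\<close> ln_bound[of r] r by simp
    ultimately have "- c * r\<^sup>2 + L * ln r \<le> L\<^sup>2 / (4 * c)" by linarith
    then have e: "exp (- c * r\<^sup>2) * r powr L \<le> exp (L\<^sup>2 / (4 * c))"
      using r by (simp add: powr_def exp_add[symmetric])
    have "tail n r * r powr L \<le> A * exp (- c * r\<^sup>2) * r powr L"
      by (intro mult_right_mono A n r) simp
    also have "\<dots> = A * (exp (- c * r\<^sup>2) * r powr L)" by simp
    also have "\<dots> \<le> \<bar>A\<bar> * exp (L\<^sup>2 / (4 * c))" using e by (intro mult_mono) auto
    finally show ?thesis .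
  qed
  then show ?thesis by (rule that)
qed

end

section \<open>Asymptotic normality\<close>

context cauchy_regression begin

text \<open>
  With \<open>r\<close> chosen so that the rescaled error exceeds \<open>r\<close> only rarely, the linearisation error is of order
  \<open>r\<^sup>2 / sqrt n\<close> and the curvature matrix contributes \<open>r\<close> times its distance from the limit.
\<close>
lemma estimator_approximated_by_score:
  assumes "e > 0"
  shows "(\<lambda>n. prob {w\<in>space M. e < norm (score n w - \<Gamma> *v scaled n w)}) \<longlonglongrightarrow> 0"
proof (rule LIMSEQ_I)
  fix p :: real assume "p > 0"
  obtain C where C: "\<And>n r. n \<ge> 2 \<Longrightarrow> r > 0 \<Longrightarrow>
      tail n r * r powr 1 \<le> C"
    by (rule tail_moment_bound[OF zero_less_one]) (rule that)
  have "p / 2 > 0" using \<open>p > 0\<close> by simp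
  obtain r where r: "r > 0" "\<And>n. n \<in> {2..} \<Longrightarrow> tail n r \<le> p / 2"
    by (rule tight_from_tail_bound[of "{2..}" tail C, OF _ \<open>p / 2 > 0\<close>])
       (use C in auto)
  define \<eta> where "\<eta> = e / (2 * r)"
  have \<eta>: "\<eta> > 0" "\<eta> * r = e / 2" using \<open>e > 0\<close> r(1) by (auto simp: \<eta>_def)
  obtain rare where mR: "\<And>n. n \<ge> 2 \<Longrightarrow> rare n \<in> sets M" and rare: "exponentially_small (\<lambda>n. prob (rare n))"
    and off: "\<And>n w. n \<ge> 2 \<Longrightarrow> w \<in> space M - rare n \<Longrightarrow> expands n w"
      "\<And>n w. n \<ge> 2 \<Longrightarrow> w \<in> space M - rare n \<Longrightarrow>
        norm (curv n w *v scaled n w - \<Gamma> *v scaled n w) \<le> \<eta> * norm (scaled n w)"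
    by (rule linearization_off_rare_event[OF zero_less_one \<eta>(1)]) (rule that)
  have "(\<lambda>n. prob (rare n)) \<longlonglongrightarrow> 0" using rare by (rule exponentially_small_tendsto) simp
  then have ev1: "\<forall>\<^sub>F n in sequentially. prob (rare n) < p / 2"
    using \<open>p / 2 > 0\<close> by (rule order_tendstoD)
  have "(\<lambda>n. 12 * CX ^ 3 * r * r * (1 / sqrt (real n))) \<longlonglongrightarrow> 12 * CX ^ 3 * r * r * 0"
    by (intro tendsto_mult tendsto_const) real_asymp
  then have ev2: "\<forall>\<^sub>F n in sequentially. 12 * CX ^ 3 * r * r * (1 / sqrt (real n)) < e / 2"
    by (rule order_tendstoD) (use \<open>e > 0\<close> in simp)
  have "\<forall>\<^sub>F n in sequentially. norm (prob {w\<in>space M. e < norm (score n w - \<Gamma> *v scaled n w)} - 0) < p"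
    using ev1 ev2 eventually_ge_at_top[of 2]
  proof eventually_elim
    case (elim n)
    note n = elim(3)
    note [measurable] = estimator_measurable[OF n]
    let ?B = "{w\<in>space M. r < norm (scaled n w)}"
    have m: "rare n \<in> sets M" "?B \<in> sets M" using mR[OF n] by measurable
    have "{w\<in>space M. e < norm (score n w - \<Gamma> *v scaled n w)} \<subseteq> rare n \<union> ?B"
    proof (rule ccontr)
      assume "\<not> {w\<in>space M. e < norm (score n w - \<Gamma> *v scaled n w)} \<subseteq> rare n \<union> ?B"
      then obtain w where w: "w \<in> space M - rare n" "e < norm (score n w - \<Gamma> *v scaled n w)" "w \<notin> ?B" by blast
      have u: "norm (scaled n w) \<le> r" using w(1,3) by (auto simp: not_less)
      have "norm (\<mu>h n w - \<mu>0) = norm (scaled n w) * (1 / sqrt n)" using n by simp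
      also have "\<dots> \<le> r * (1 / sqrt n)" using u by (intro mult_right_mono) auto
      finally have v: "norm (\<mu>h n w - \<mu>0) \<le> r * (1 / sqrt n)" .
      have "norm (score n w - curv n w *v scaled n w) \<le> 12 * CX ^ 3 * norm (\<mu>h n w - \<mu>0) * norm (scaled n w)"
        by (rule off(1)[OF n w(1)])
      also have "\<dots> \<le> 12 * CX ^ 3 * (r * (1 / sqrt n)) * r"
        using u v CX(1) r(1) by (intro mult_mono mult_left_mono) auto
      also have "\<dots> < e / 2" using elim(2) by (simp add: mult_ac)
      finally have 1: "norm (score n w - curv n w *v scaled n w) < e / 2" .
      have "norm (curv n w *v scaled n w - \<Gamma> *v scaled n w) \<le> \<eta> * norm (scaled n w)"
        by (rule off(2)[OF n w(1)])
      also have "\<dots> \<le> \<eta> * r" using u \<eta>(1) by (intro mult_left_mono) auto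
      finally have 2: "norm (curv n w *v scaled n w - \<Gamma> *v scaled n w) \<le> e / 2"
        by (simp only: \<eta>(2))
      have "norm (score n w - \<Gamma> *v scaled n w) < e"
        using norm_triangle_ineq[of "score n w - curv n w *v scaled n w"
            "curv n w *v scaled n w - \<Gamma> *v scaled n w"] 1 2
        by simp
      then show False using w(2) by simp
    qed
    then have "prob {w\<in>space M. e < norm (score n w - \<Gamma> *v scaled n w)} \<le> prob (rare n \<union> ?B)"
      using m by (intro finite_measure_mono) auto
    also have "\<dots> \<le> prob (rare n) + prob ?B" using m by (intro measure_Un_le) auto
    also have "\<dots> < p" using elim(1) r(2)[of n] n by simp
    finally show ?case by simp
  qed
  then show "\<exists>N. \<forall>n\<ge>N. norm (prob {w\<in>space M. e < norm (score n w - \<Gamma> *v scaled n w)} - 0) < p"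
    by (simp only: eventually_sequentially)
qed

text \<open>
  By stationarity all variances and all neighbour covariances of the score terms coincide, so the
  variance of the projected score is a combination of the two Gram averages, whose limits make up
  \<open>Sigma0\<close>. As a limit of variances the form is nonnegative; this is what makes \<open>Sigma0\<close> a
  covariance matrix.
\<close>
lemma score_clt:
  fixes \<tau> :: "real ^ 'q"
  shows "0 \<le> \<tau> \<bullet> (\<Sigma> *v \<tau>)"
    and "(\<lambda>n. expectation (\<lambda>w. cos (\<tau> \<bullet> score n w + c)))
           \<longlonglongrightarrow> exp (- (\<tau> \<bullet> (\<Sigma> *v \<tau>)) / 2) * cos c"
proof -
  let ?G = "\<lambda>n. (1 / real n) *\<^sub>R (\<Sum>j=2..n. outer (a j) (a j))" and ?D = "\<lambda>n. (1 / (real n - 2)) *\<^sub>R (\<Sum>j=2..n-1. outer (a j) (a (j + 1)))"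
  define \<kappa>0 where "\<kappa>0 = expectation (\<lambda>w. cauchy_score (incr 2 w) * cauchy_score (incr 2 w))"
  define \<kappa>1 where "\<kappa>1 = expectation (\<lambda>w. cauchy_score (incr 2 w) * cauchy_score (incr 3 w))"
  define \<xi> where "\<xi> n j w = cauchy_score (incr j w) * ((a j \<bullet> \<tau>) / sqrt (real n))" for n j w
  define g where "g n j k = expectation (\<lambda>w. \<xi> n j w * \<xi> n k w)" for n j k
  define V where "V n = (\<Sum>j=2..n. \<Sum>k\<in>{k\<in>{2..n}. k \<le> j + 1 \<and> j \<le> k + 1}. g n j k)" for n
  define qf where "qf A = \<tau> \<bullet> (A *v \<tau>)" for A :: "real ^ 'q ^ 'q"
  define K where "K n = CX * norm \<tau> / sqrt (real n)" for n
  have qf: "bounded_linear qf" unfolding qf_def[abs_def] by (rule bounded_linear_quadratic_form)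
  have qf_outer: "qf (outer x y) = (x \<bullet> \<tau>) * (y \<bullet> \<tau>)" for x y
    by (simp add: qf_def outer_mult_vec inner_commute)
  have clt: "V n \<ge> 0 \<and> \<bar>expectation (\<lambda>w. cos (\<tau> \<bullet> score n w + c)) - exp (- V n / 2) * cos c\<bar>
      \<le> 39 * real n * K n ^ 3" for n c
  proof -
    have dep: "depends_on {j - 1, j} (\<xi> n j)" if "j \<in> {2..n}" for j
      unfolding \<xi>_def[abs_def]
      by (rule depends_on_comp[of _ _ "\<lambda>s. cauchy_score s * ((a j \<bullet> \<tau>) / sqrt (real n))", OF depends_on_incr])
         (use that in auto)
    have bd: "\<bar>\<xi> n j w\<bar> \<le> K n" if "j \<in> {2..n}" for j w
    proof -
      have "\<bar>a j \<bullet> \<tau>\<bar> \<le> norm (a j) * norm \<tau>" by (rule Cauchy_Schwarz_ineq2)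
      also have "\<dots> \<le> CX * norm \<tau>" using CX(2) that by (intro mult_right_mono) auto
      finally have "\<bar>(a j \<bullet> \<tau>) / sqrt (real n)\<bar> \<le> K n" by (simp add: K_def divide_right_mono)
      then have "\<bar>cauchy_score (incr j w)\<bar> * \<bar>(a j \<bullet> \<tau>) / sqrt (real n)\<bar> \<le> 1 * K n"
        by (rule mult_mono[OF abs_cauchy_score_le]) auto
      then show ?thesis unfolding \<xi>_def abs_mult by simp
    qed
    have mean: "expectation (\<xi> n j) = 0" if "j \<in> {2..n}" for j
      unfolding \<xi>_def[abs_def] using expectation_score[of j] that by simp
    have "K n \<ge> 0" using CX(1) by (simp add: K_def)
    have sum: "(\<Sum>j=2..n. \<xi> n j w) = \<tau> \<bullet> score n w" for w
      by (simp add: score_vec_def \<xi>_def inner_sum_right sum_divide_distrib inner_commute)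
    show ?thesis
      using one_dependent_cos_bound(1)[of n "\<xi> n" "K n", OF dep bd mean \<open>K n \<ge> 0\<close>]
        one_dependent_cos_bound(2)[of n "\<xi> n" "K n" c, OF dep bd mean \<open>K n \<ge> 0\<close>]
      unfolding sum V_def g_def by simp
  qed
  have g0: "g n j j = \<kappa>0 * ((a j \<bullet> \<tau>) * (a j \<bullet> \<tau>)) / n" if "j \<ge> 2" for n j
  proof -
    have "g n j j = expectation (\<lambda>w. cauchy_score (incr j w) * cauchy_score (incr j w) * ((a j \<bullet> \<tau>) * (a j \<bullet> \<tau>) / n))"
      unfolding g_def \<xi>_def by (intro Bochner_Integration.integral_cong) (auto simp: field_simps)
    also have "\<dots> = \<kappa>0 * ((a j \<bullet> \<tau>) * (a j \<bullet> \<tau>) / n)"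
      using expectation_incr[OF that, of "\<lambda>s. cauchy_score s * cauchy_score s"]
      by (simp add: \<kappa>0_def)
    finally show ?thesis by simp
  qed
  have g1: "g n j (j + 1) = \<kappa>1 * ((a j \<bullet> \<tau>) * (a (j + 1) \<bullet> \<tau>)) / n" if "j \<ge> 2" for n j
  proof -
    have "g n j (j + 1) = expectation (\<lambda>w. cauchy_score (incr j w) * cauchy_score (incr (j + 1) w) * ((a j \<bullet> \<tau>) * (a (j + 1) \<bullet> \<tau>) / n))"
      unfolding g_def \<xi>_def by (intro Bochner_Integration.integral_cong) (auto simp: field_simps)
    also have "\<dots> = \<kappa>1 * ((a j \<bullet> \<tau>) * (a (j + 1) \<bullet> \<tau>) / n)"
      using expectation_incr_product[OF that, of cauchy_score] by (simp add: \<kappa>1_def)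
    finally show ?thesis by simp
  qed
  have gs: "g n (j + 1) j = g n j (j + 1)" for n j by (simp add: g_def mult.commute)
  have V: "V n = \<kappa>0 * qf (?G n)
      + 2 * \<kappa>1 * ((real n - 2) / real n) * qf (?D n)"
    if "n \<ge> 3" for n
  proof -
    have lin: "linear qf" using qf by (rule bounded_linear.linear)
    have "V n = (\<Sum>j=2..n. \<kappa>0 * ((a j \<bullet> \<tau>) * (a j \<bullet> \<tau>)) / n)
        + (\<Sum>j=2..n-1. 2 * (\<kappa>1 * ((a j \<bullet> \<tau>) * (a (j + 1) \<bullet> \<tau>)) / n))"
      unfolding V_def sum_neighbours gs by (intro arg_cong2[where f="(+)"] sum.cong) (auto simp: g0 g1[unfolded Suc_eq_plus1[symmetric]])
    also have "\<dots> = \<kappa>0 * ((1 / n) * (\<Sum>j=2..n. (a j \<bullet> \<tau>) * (a j \<bullet> \<tau>)))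
        + 2 * \<kappa>1 * ((1 / n) * (\<Sum>j=2..n-1. (a j \<bullet> \<tau>) * (a (j + 1) \<bullet> \<tau>)))"
      by (simp add: sum_distrib_left sum_divide_distrib mult.assoc)
    also have "(1 / real n) * (\<Sum>j=2..n-1. (a j \<bullet> \<tau>) * (a (j + 1) \<bullet> \<tau>))
        = ((real n - 2) / real n) * ((1 / (real n - 2)) * (\<Sum>j=2..n-1. (a j \<bullet> \<tau>) * (a (j + 1) \<bullet> \<tau>)))"
      using that by simp
    finally show ?thesis
      by (simp add: linear_scale[OF lin] linear_sum[OF lin] qf_outer mult.assoc)
  qed
  have "(\<lambda>n. \<kappa>0 * qf (?G n)
      + 2 * \<kappa>1 * ((real n - 2) / real n) * qf (?D n))
      \<longlonglongrightarrow> \<kappa>0 * qf C0 + 2 * \<kappa>1 * 1 * qf D0"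
    by (intro tendsto_add tendsto_mult tendsto_const bounded_linear.tendsto[OF qf] gram cross_gram) real_asymp
  moreover have "\<forall>\<^sub>F n in sequentially. \<kappa>0 * qf (?G n)
      + 2 * \<kappa>1 * ((real n - 2) / real n) * qf (?D n) = V n"
    using eventually_ge_at_top[of 3] by eventually_elim (rule V[symmetric])
  ultimately have "V \<longlonglongrightarrow> \<kappa>0 * qf C0 + 2 * \<kappa>1 * 1 * qf D0" by (rule Lim_transform_eventually)
  also have "\<kappa>0 * qf C0 + 2 * \<kappa>1 * 1 * qf D0 = \<tau> \<bullet> (\<Sigma> *v \<tau>)"
  proof -
    have k0: "\<kappa>0 = 4 * expectation (\<lambda>w. (incr 2 w / (1 + (incr 2 w)\<^sup>2))\<^sup>2)"
      unfolding \<kappa>0_def by (subst integral_mult_right_zero[symmetric])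
        (intro Bochner_Integration.integral_cong, auto simp: cauchy_score_def power2_eq_square)
    have k1: "\<kappa>1 = 4 * expectation (\<lambda>w. incr 2 w / (1 + (incr 2 w)\<^sup>2) * (incr 3 w / (1 + (incr 3 w)\<^sup>2)))"
      unfolding \<kappa>1_def by (subst integral_mult_right_zero[symmetric])
        (intro Bochner_Integration.integral_cong, auto simp: cauchy_score_def)
    have lin: "linear qf" using qf by (rule bounded_linear.linear)
    have tr: "qf (transpose D0) = qf D0"
      unfolding qf_def inner_transpose_mult by (rule inner_commute)
    have "\<tau> \<bullet> (\<Sigma> *v \<tau>) = qf (\<kappa>0 *\<^sub>R C0 + \<kappa>1 *\<^sub>R (D0 + transpose D0))"
      by (simp add: Sigma0_def qf_def k0 k1)
    also have "\<dots> = \<kappa>0 * qf C0 + \<kappa>1 * (qf D0 + qf (transpose D0))"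
      by (simp add: linear_add[OF lin] linear_scale[OF lin])
    finally show ?thesis by (simp add: tr)
  qed
  finally have Vlim: "V \<longlonglongrightarrow> \<tau> \<bullet> (\<Sigma> *v \<tau>)" .
  show "0 \<le> \<tau> \<bullet> (\<Sigma> *v \<tau>)"
    by (rule LIMSEQ_le_const[OF Vlim]) (use clt in blast)
  have "(\<lambda>n. 39 * (CX * norm \<tau>) ^ 3 * (1 / sqrt (real n))) \<longlonglongrightarrow> 39 * (CX * norm \<tau>) ^ 3 * 0"
    by (intro tendsto_mult tendsto_const) real_asymp
  then have errlim: "(\<lambda>n. 39 * (CX * norm \<tau>) ^ 3 * (1 / sqrt (real n))) \<longlonglongrightarrow> 0" by simp
  have "(\<lambda>n. expectation (\<lambda>w. cos (\<tau> \<bullet> score n w + c)) - exp (- V n / 2) * cos c) \<longlonglongrightarrow> 0"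
  proof (rule Lim_null_comparison[OF always_eventually[OF allI] errlim])
    fix n
    have "39 * real n * K n ^ 3 = 39 * (CX * norm \<tau>) ^ 3 * (1 / sqrt (real n))"
      by (cases "n = 0") (simp_all add: K_def power_divide power3_eq_cube field_simps)
    then show "norm (expectation (\<lambda>w. cos (\<tau> \<bullet> score n w + c)) - exp (- V n / 2) * cos c)
        \<le> 39 * (CX * norm \<tau>) ^ 3 * (1 / sqrt (real n))"
      using clt[of n c] by simp
  qed
  moreover have "(\<lambda>n. exp (- V n / 2) * cos c) \<longlonglongrightarrow> exp (- (\<tau> \<bullet> (\<Sigma> *v \<tau>)) / 2) * cos c"
    by (intro tendsto_intros Vlim) simp
  ultimately have "(\<lambda>n. (expectation (\<lambda>w. cos (\<tau> \<bullet> score n w + c)) - exp (- V n / 2) * cos c)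
      + exp (- V n / 2) * cos c) \<longlonglongrightarrow> 0 + exp (- (\<tau> \<bullet> (\<Sigma> *v \<tau>)) / 2) * cos c"
    by (rule tendsto_add)
  then show "(\<lambda>n. expectation (\<lambda>w. cos (\<tau> \<bullet> score n w + c)))
           \<longlonglongrightarrow> exp (- (\<tau> \<bullet> (\<Sigma> *v \<tau>)) / 2) * cos c" by simp
qed

lemma invertible_\<Gamma>: "invertible \<Gamma>"
proof -
  obtain \<rho> where \<rho>: "\<rho> > 0" "\<And>x. \<rho> * (norm x)\<^sup>2 \<le> x \<bullet> (\<Gamma> *v x)" using \<Gamma>_positive_definite by blast
  have "x = 0" if "\<Gamma> *v x = 0" for x
  proof -
    have "\<rho> * (norm x)\<^sup>2 \<le> 0" using \<rho>(2)[of x] that by simp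
    then show "x = 0" using \<rho>(1) by (simp add: mult_le_0_iff)
  qed
  then show ?thesis by (simp add: invertible_left_inverse matrix_left_invertible_ker)
qed

lemma \<Gamma>_inv: "\<Gamma> ** matrix_inv \<Gamma> = mat 1"
  using someI_ex[OF invertible_\<Gamma>[unfolded invertible_def]] unfolding matrix_inv_def by blast

lemma transpose_\<Gamma>: "transpose \<Gamma> = \<Gamma>"
  using C0 by (simp add: \<Gamma>_def positive_definite_def transpose_def vec_eq_iff)

lemma transpose_\<Gamma>_inv: "transpose (matrix_inv \<Gamma>) = matrix_inv \<Gamma>"
proof -
  have "transpose (matrix_inv \<Gamma>) ** \<Gamma> = transpose (\<Gamma> ** matrix_inv \<Gamma>)"
    by (simp add: matrix_transpose_mul transpose_\<Gamma>)
  also have "\<dots> = mat 1" by (simp add: \<Gamma>_inv transpose_mat)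
  finally have "transpose (matrix_inv \<Gamma>) ** \<Gamma> ** matrix_inv \<Gamma> = matrix_inv \<Gamma>" by simp
  then show ?thesis by (simp add: matrix_mul_assoc[symmetric] \<Gamma>_inv)
qed

lemma transpose_Sigma0: "transpose (\<Sigma>) = \<Sigma>"
  using C0 by (simp add: Sigma0_def positive_definite_def transpose_def vec_eq_iff add.commute)

text \<open>
  As \<open>\<Gamma>\<close> is symmetric, \<open>t \<bullet> u = (\<Gamma>\<inverse> t) \<bullet> (\<Gamma> u)\<close>; so the limit of the score in direction \<open>\<Gamma>\<inverse> t\<close> carries over.
\<close>
lemma rescaled_error_cos_limit:
  "(\<lambda>n. expectation (\<lambda>w. cos (t \<bullet> scaled n w + c)))
     \<longlonglongrightarrow> exp (- ((matrix_inv \<Gamma> *v t) \<bullet> (\<Sigma> *v (matrix_inv \<Gamma> *v t))) / 2) * cos c"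
proof -
  define \<tau> where "\<tau> = matrix_inv \<Gamma> *v t"
  have t: "t \<bullet> u = \<tau> \<bullet> (\<Gamma> *v u)" for u
  proof -
    have "\<tau> \<bullet> (\<Gamma> *v u) = (\<Gamma> *v \<tau>) \<bullet> u"
      using inner_transpose_mult[of \<tau> \<Gamma> u] by (simp add: transpose_\<Gamma>)
    also have "\<Gamma> *v \<tau> = t"
      by (simp add: \<tau>_def matrix_vector_mul_assoc \<Gamma>_inv)
    finally show ?thesis by simp
  qed
  let ?E = "\<lambda>n. expectation (\<lambda>w. cos (t \<bullet> scaled n w + c))"
  let ?W = "\<lambda>n. expectation (\<lambda>w. cos (\<tau> \<bullet> score n w + c))"
  have "(\<lambda>n. ?E n - ?W n) \<longlonglongrightarrow> 0"
  proof (rule LIMSEQ_I)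
    fix p :: real assume "p > 0"
    define e where "e = p / (2 * (norm \<tau> + 1))"
    have nt: "norm \<tau> + 1 > 0" by (simp add: add_nonneg_pos)
    then have e: "e > 0" "norm \<tau> * e \<le> p / 2" "p / 2 > 0"
      using \<open>p > 0\<close> by (auto simp: e_def field_simps)
    define A where "A n = {w\<in>space M. e < norm (score n w - \<Gamma> *v scaled n w)}" for n
    have "(\<lambda>n. 2 * prob (A n)) \<longlonglongrightarrow> 2 * 0"
      unfolding A_def by (intro tendsto_mult tendsto_const estimator_approximated_by_score e(1))
    then have "\<forall>\<^sub>F n in sequentially. 2 * prob (A n) < p / 2"
      by (rule order_tendstoD) (use e(3) in simp)
    then have "\<forall>\<^sub>F n in sequentially. norm (?E n - ?W n - 0) < p"
      using eventually_ge_at_top[of 2]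
    proof eventually_elim
      case (elim n)
      note n = elim(2)
      note [measurable] = estimator_measurable[OF n] measurable_score_vec
      have mG: "(\<lambda>w. \<Gamma> *v scaled n w) \<in> borel_measurable M"
        by (rule measurable_compose[of _ _ borel "(*v) \<Gamma>"])
           (auto intro!: borel_measurable_continuous_onI linear_continuous_on
              linear_conv_bounded_linear[THEN iffD1] matrix_vector_mul_linear)
      note [measurable] = mG
      have "\<bar>?E n - ?W n\<bar> \<le> p / 2 + 2 * prob (A n)"
      proof (rule cos_expectation_close)
        fix w assume w: "w \<in> space M" "w \<notin> A n"
        have "\<bar>t \<bullet> scaled n w + c - (\<tau> \<bullet> score n w + c)\<bar>
            = \<bar>\<tau> \<bullet> (\<Gamma> *v scaled n w - score n w)\<bar>"
          unfolding t by (simp add: inner_diff_right)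
        also have "\<dots> \<le> norm \<tau> * norm (\<Gamma> *v scaled n w - score n w)"
          by (rule Cauchy_Schwarz_ineq2)
        also have "\<dots> \<le> norm \<tau> * e"
          using w by (intro mult_left_mono) (auto simp: A_def not_less norm_minus_commute)
        also note e(2)
        finally show "\<bar>t \<bullet> scaled n w + c - (\<tau> \<bullet> score n w + c)\<bar> \<le> p / 2" .
      next
        show "(\<lambda>w. t \<bullet> scaled n w + c) \<in> borel_measurable M" by measurable
        show "(\<lambda>w. \<tau> \<bullet> score n w + c) \<in> borel_measurable M" by measurable
        show "A n \<in> sets M" unfolding A_def by measurable
      qed (rule e(3))
      then show ?case using elim(1) by simp
    qed
    then show "\<exists>N. \<forall>n\<ge>N. norm (?E n - ?W n - 0) < p" by (simp only: eventually_sequentially)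
  qed
  from tendsto_add[OF this score_clt(2)[of \<tau> c]] show ?thesis by (simp add: \<tau>_def)
qed

theorem asymptotic_normality:
  "\<exists>N. normal_law 0 (matrix_inv \<Gamma> ** \<Sigma> ** matrix_inv \<Gamma>) N \<and>
     converges_in_law M scaled N"
proof -
  let ?G = "matrix_inv \<Gamma>"
  obtain B :: "real ^ 'q ^ 'q" where B: "B ** transpose B = \<Sigma>"
    using psd_factorization[OF transpose_Sigma0 score_clt(1)] by blast
  define A where "A = ?G ** B"
  define N where "N = distr std_normal_vec borel (\<lambda>z. 0 + A *v z)"
  have "A ** transpose A = ?G ** (B ** transpose B) ** ?G"
    by (simp add: A_def matrix_transpose_mul transpose_\<Gamma>_inv matrix_mul_assoc)
  then have law: "normal_law 0 (?G ** \<Sigma> ** ?G) N"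
    unfolding normal_law_def N_def B by blast
  interpret Z: prob_space "std_normal_vec :: (real ^ 'q) measure" by (rule prob_space_std_normal_vec)
  have mA: "(\<lambda>z. 0 + A *v z) \<in> measurable std_normal_vec borel"
    unfolding measurable_cong_sets[OF sets_std_normal_vec refl] add_0
    by (intro borel_measurable_continuous_onI linear_continuous_on
              linear_conv_bounded_linear[THEN iffD1] matrix_vector_mul_linear)
  have N: "prob_space N" "sets N = sets borel"
    unfolding N_def using Z.prob_space_distr[OF mA] by simp_all
  have N_cos: "(\<integral>x. cos (t \<bullet> x + c) \<partial>N)
      = exp (- ((?G *v t) \<bullet> (\<Sigma> *v (?G *v t))) / 2) * cos c" for t c
  proof -
    have "(\<integral>x. cos (t \<bullet> x + c) \<partial>N) = (\<integral>z. cos (t \<bullet> (0 + A *v z) + c) \<partial>std_normal_vec)"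
      unfolding N_def by (rule integral_distr[OF mA]) simp
    also have "\<dots> = (\<integral>z. cos ((transpose A *v t) \<bullet> z + c) \<partial>std_normal_vec)"
    proof -
      have "t \<bullet> (A *v z) = (transpose A *v t) \<bullet> z" for z
        using inner_transpose_mult[of z A t] by (metis inner_commute)
      then show ?thesis by (simp only: add_0)
    qed
    also have "\<dots> = exp (- (norm (transpose A *v t))\<^sup>2 / 2) * cos c" by (rule std_normal_vec_cos)
    also have "(norm (transpose A *v t))\<^sup>2 = (?G *v t) \<bullet> (\<Sigma> *v (?G *v t))"
    proof -
      have "transpose A *v t = transpose B *v (?G *v t)"
        by (simp add: A_def matrix_transpose_mul transpose_\<Gamma>_inv matrix_vector_mul_assoc)
      then have "(norm (transpose A *v t))\<^sup>2 = (transpose B *v (?G *v t)) \<bullet> (transpose B *v (?G *v t))"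
        by (simp add: power2_norm_eq_inner)
      also have "\<dots> = (B *v (transpose B *v (?G *v t))) \<bullet> (?G *v t)" by (rule inner_transpose_mult)
      also have "B *v (transpose B *v (?G *v t)) = \<Sigma> *v (?G *v t)"
        by (simp only: matrix_vector_mul_assoc B matrix_mul_assoc)
      finally show ?thesis by (simp only: inner_commute)
    qed
    finally show ?thesis .
  qed
  have "converges_in_law M scaled N"
  proof (rule converges_in_law_cosI)
    show "prob_space M" by (rule prob_space_axioms)
    show "\<forall>\<^sub>F n in sequentially. scaled n \<in> borel_measurable M"
    proof (rule eventually_sequentiallyI[of 2])
      fix n :: nat assume "2 \<le> n"
      note [measurable] = estimator_measurable[OF this]
      show "scaled n \<in> borel_measurable M" by measurable
    qed
    show "(\<lambda>n. expectation (\<lambda>w. cos (t \<bullet> scaled n w + c))) \<longlonglongrightarrow> (\<integral>x. cos (t \<bullet> x + c) \<partial>N)" for t c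
      unfolding N_cos by (rule rescaled_error_cos_limit)
    fix e :: real assume "e > 0"
    obtain C where C: "\<And>n r. n \<ge> 2 \<Longrightarrow> r > 0 \<Longrightarrow>
        tail n r * r powr 1 \<le> C"
      by (rule tail_moment_bound[OF zero_less_one]) (rule that)
    obtain r where r: "r > 0" "\<And>n. n \<in> {2..} \<Longrightarrow> tail n r \<le> e"
      by (rule tight_from_tail_bound[of "{2..}" tail C, OF _ \<open>e > 0\<close>])
         (use C in auto)
    then show "\<exists>r. \<forall>\<^sub>F n in sequentially. tail n r \<le> e"
      by (intro exI[of _ r] eventually_sequentiallyI[of 2]) simp
  qed (rule N)+
  with law show ?thesis by blast
qed

end

section \<open>The limit theorem\<close>

text \<open>
  The extended suprema of the hypotheses enter through the real bounds that their finiteness provides.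
\<close>
lemma real_bound_of_ereal:
  fixes T :: ereal
  assumes "T < \<infinity>" "\<And>i. i \<in> I \<Longrightarrow> ereal (g i) \<le> T"
  obtains K where "\<And>i. i \<in> I \<Longrightarrow> g i \<le> K"
proof (rule that)
  fix i assume "i \<in> I"
  then show "g i \<le> real_of_ereal T" using assms by (cases T) force+
qed

theorem theorem2p4:
  fixes M :: "'a measure"
    and X :: "nat \<Rightarrow> real ^ 'q"
    and \<epsilon> Y :: "nat \<Rightarrow> 'a \<Rightarrow> real"
    and \<mu>\<^sub>0 :: "real ^ 'q"
    and \<sigma>\<^sub>0 C\<^sub>X \<beta>\<^sub>1 \<beta>\<^sub>2 lam c\<^sub>1 c\<^sub>2 b :: real
    and \<Theta> :: "(real ^ 'q) set"
    and C\<^sub>0 D\<^sub>0 :: "real ^ 'q ^ 'q"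
    and YY :: "real ^ 'q \<Rightarrow> real"
    and f :: "real \<Rightarrow> real"
    and \<mu>h :: "nat \<Rightarrow> 'a \<Rightarrow> real ^ 'q"
  assumes M: "prob_space M"
    and Theta: "open \<Theta>" "convex \<Theta>" "bounded \<Theta>" "\<mu>\<^sub>0 \<in> \<Theta>"
    and sigma: "\<sigma>\<^sub>0 > 0"
    and indep: "prob_space.indep_vars M (\<lambda>_. borel) \<epsilon> {1..}"
    and ident: "\<And>j. j \<ge> 1 \<Longrightarrow> distr M borel (\<epsilon> j) = distr M borel (\<epsilon> 1)"
    and model: "\<And>j \<omega>. j \<ge> 1 \<Longrightarrow> \<omega> \<in> space M \<Longrightarrow> Y j \<omega> = X j \<bullet> \<mu>\<^sub>0 + \<sigma>\<^sub>0 * \<epsilon> j \<omega>"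
    and cond1: "C\<^sub>X > 0" "(SUP j\<in>{2..}. ereal (norm (\<Delta> X j))) < ereal C\<^sub>X"
    and cond2: "positive_definite C\<^sub>0" "0 < \<beta>\<^sub>1" "\<beta>\<^sub>1 < 1/2"
      "(SUP n\<in>{2..}. ereal (norm ((real n powr \<beta>\<^sub>1) *\<^sub>R
          ((1 / real n) *\<^sub>R (\<Sum>j=2..n. outer (\<Delta> X j) (\<Delta> X j)) - C\<^sub>0)))) < \<infinity>"
    and cond3: "(\<lambda>n. (1 / (real n - 2)) *\<^sub>R (\<Sum>j=2..n-1. outer (\<Delta> X j) (\<Delta> X (j+1))))
                  \<longlonglongrightarrow> D\<^sub>0"
    and cond4: "continuous_on \<Theta> YY" "0 \<le> \<beta>\<^sub>2" "\<beta>\<^sub>2 < 1/2"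
      "(SUP n\<in>{2..}. SUP \<mu>\<in>\<Theta>. ereal \<bar>real n powr (1/2 - \<beta>\<^sub>2)
          * (Ystar M X \<epsilon> \<sigma>\<^sub>0 \<mu>\<^sub>0 n \<mu> - YY \<mu>)\<bar>) < \<infinity>"
      "lam > 0"
      "\<And>\<mu>. \<mu> \<in> \<Theta> \<Longrightarrow> YY \<mu> = YY \<mu> - YY \<mu>\<^sub>0 \<and> YY \<mu> - YY \<mu>\<^sub>0 \<le> - lam * (norm (\<mu> - \<mu>\<^sub>0))\<^sup>2"
    and cond5: "\<And>K. K > 0 \<Longrightarrow> integrable M (\<lambda>\<omega>. \<bar>ln (1 + (\<epsilon> 1 \<omega>)\<^sup>2)\<bar> powr K)"
      "distributed M lborel (S \<sigma>\<^sub>0 \<epsilon> 2) (\<lambda>x. ennreal (f x))" "\<And>x. f x \<ge> 0" "\<And>x. f (- x) = f x"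
      "f 1 > 0"
      "(SUP x\<in>{1..}. ereal (f x)) \<le> ereal (f 1)" "ereal (f 1) \<le> (INF x\<in>{0..1}. ereal (f x))"
      "0 < c\<^sub>1" "c\<^sub>1 < c\<^sub>2" "c\<^sub>2 < 1" "b > 0"
      "ereal ((1 + b) * f 1) \<le> (INF x\<in>{c\<^sub>1..c\<^sub>2}. ereal (f x))"
    and estimator: "\<And>n. n \<ge> 2 \<Longrightarrow> CQMLE M \<Theta> X Y n (\<mu>h n)"
  shows "invertible (Gamma0 M \<epsilon> \<sigma>\<^sub>0 C\<^sub>0) \<and>
    (\<exists>N. normal_law 0 (matrix_inv (Gamma0 M \<epsilon> \<sigma>\<^sub>0 C\<^sub>0) ** Sigma0 M \<epsilon> \<sigma>\<^sub>0 C\<^sub>0 D\<^sub>0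
                         ** matrix_inv (Gamma0 M \<epsilon> \<sigma>\<^sub>0 C\<^sub>0)) N \<and>
         converges_in_law M (\<lambda>n \<omega>. sqrt (real n) *\<^sub>R (\<mu>h n \<omega> - \<mu>\<^sub>0)) N) \<and>
    (\<forall>L>0. (SUP r\<in>{0<..}. SUP n\<in>{2..}.
        ereal (measure M {\<omega> \<in> space M. norm (sqrt (real n) *\<^sub>R (\<mu>h n \<omega> - \<mu>\<^sub>0)) > r} * r powr L)) < \<infinity>)"
proof -
  interpret prob_space M by (rule M)
  have null: "(\<lambda>n. K * real n powr - \<beta>) \<longlonglongrightarrow> 0" if "\<beta> > 0" for K \<beta>
    by (intro tendsto_mult_right_zero tendsto_neg_powr filterlim_real_sequentially) (use that in simp)
  have dX: "norm (\<Delta> X j) \<le> C\<^sub>X" if "j \<ge> 2" for j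
  proof -
    have "ereal (norm (\<Delta> X j)) \<le> (SUP j\<in>{2..}. ereal (norm (\<Delta> X j)))" using that by (intro SUP_upper) simp
    then have "ereal (norm (\<Delta> X j)) < ereal C\<^sub>X" using cond1(2) by (rule le_less_trans)
    then show ?thesis by simp
  qed
  have gram: "(\<lambda>n. (1 / real n) *\<^sub>R (\<Sum>j=2..n. outer (\<Delta> X j) (\<Delta> X j))) \<longlonglongrightarrow> C\<^sub>0"
  proof -
    let ?G = "\<lambda>n. (1 / real n) *\<^sub>R (\<Sum>j=2..n. outer (\<Delta> X j) (\<Delta> X j)) - C\<^sub>0"
    obtain K where K: "\<And>n. n \<in> {2..} \<Longrightarrow> norm ((real n powr \<beta>\<^sub>1) *\<^sub>R ?G n) \<le> K"
      by (rule real_bound_of_ereal[OF cond2(4)]) (rule SUP_upper, assumption, rule that)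
    have "?G \<longlonglongrightarrow> 0"
    proof (rule Lim_null_comparison[OF eventually_sequentiallyI[of 2] null[OF cond2(2)]])
      fix n :: nat assume n: "2 \<le> n"
      then have "real n powr \<beta>\<^sub>1 * norm (?G n) \<le> K" using K[of n] by simp
      then show "norm (?G n) \<le> K * real n powr - \<beta>\<^sub>1"
        using n by (simp add: powr_minus field_simps)
    qed
    then show ?thesis by (rule LIM_zero_cancel)
  qed
  let ?g = "\<lambda>p. \<bar>real (fst p) powr (1/2 - \<beta>\<^sub>2) * (Ystar M X \<epsilon> \<sigma>\<^sub>0 \<mu>\<^sub>0 (fst p) (snd p) - YY (snd p))\<bar>"
  obtain K where K: "\<And>p. p \<in> {2..} \<times> \<Theta> \<Longrightarrow> ?g p \<le> K"
  proof (rule real_bound_of_ereal[OF cond4(4)])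
    fix p :: "nat \<times> (real ^ 'q)" assume "p \<in> {2..} \<times> \<Theta>"
    then show "ereal (?g p)
        \<le> (SUP n\<in>{2..}. SUP \<mu>\<in>\<Theta>. ereal \<bar>real n powr (1/2 - \<beta>\<^sub>2) * (Ystar M X \<epsilon> \<sigma>\<^sub>0 \<mu>\<^sub>0 n \<mu> - YY \<mu>)\<bar>)"
      by (intro SUP_upper2[of "fst p"] SUP_upper2[of "snd p"]) auto
  qed (rule that)
  have sep: "lam * (norm (\<mu> - \<mu>\<^sub>0))\<^sup>2 - K * real n powr - (1/2 - \<beta>\<^sub>2)
      \<le> (1 / real n) * (\<Sum>j=2..n. expectation (\<lambda>\<omega>. ln (1 + (S \<sigma>\<^sub>0 \<epsilon> 2 \<omega> - \<Delta> X j \<bullet> (\<mu> - \<mu>\<^sub>0))\<^sup>2)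
                                               - ln (1 + (S \<sigma>\<^sub>0 \<epsilon> 2 \<omega>)\<^sup>2)))"
    if "n \<ge> 2" "\<mu> \<in> \<Theta>" for n \<mu>
  proof -
    have "real n powr (1/2 - \<beta>\<^sub>2) * \<bar>Ystar M X \<epsilon> \<sigma>\<^sub>0 \<mu>\<^sub>0 n \<mu> - YY \<mu>\<bar> \<le> K"
      using K[of "(n, \<mu>)"] that by (simp add: abs_mult)
    then have "\<bar>Ystar M X \<epsilon> \<sigma>\<^sub>0 \<mu>\<^sub>0 n \<mu> - YY \<mu>\<bar> \<le> K * real n powr - (1/2 - \<beta>\<^sub>2)"
      using that by (simp only: powr_minus) (simp add: field_simps)
    moreover have "YY \<mu> \<le> - lam * (norm (\<mu> - \<mu>\<^sub>0))\<^sup>2" using cond4(6)[OF that(2)] by linarith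
    ultimately show ?thesis unfolding Ystar_def by simp
  qed
  have fint: "integrable lborel f"
    using distributed_integrable[OF cond5(2), of "\<lambda>x. 1"] cond5(3) by simp
  have f_score: "expectation (\<lambda>\<omega>. cauchy_score (S \<sigma>\<^sub>0 \<epsilon> 2 \<omega>)) = 0"
    using distributed_integral[OF cond5(2), of cauchy_score] cond5(3) integral_cauchy_score_even[of f] cond5(4)
    by (simp add: mult.commute)
  have f_out: "f x \<le> f 1" if "x \<ge> 1" for x
  proof -
    have "ereal (f x) \<le> (SUP x\<in>{1..}. ereal (f x))" using that by (intro SUP_upper) simp
    also note cond5(6)
    finally show ?thesis by simp
  qed
  have f_in: "f 1 \<le> f x" if "0 \<le> x" "x \<le> 1" for x
  proof -
    note cond5(7)
    also have "(INF x\<in>{0..1}. ereal (f x)) \<le> ereal (f x)" using that by (intro INF_lower) simp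
    finally show ?thesis by simp
  qed
  have f_gap: "(1 + b) * f 1 \<le> f x" if "c\<^sub>1 \<le> x" "x \<le> c\<^sub>2" for x
  proof -
    note cond5(12)
    also have "(INF x\<in>{c\<^sub>1..c\<^sub>2}. ereal (f x)) \<le> ereal (f x)" using that by (intro INF_lower) simp
    finally show ?thesis by simp
  qed
  have "(\<integral>x. cauchy_curvature x * f x \<partial>lborel) > 0"
    by (rule integral_cauchy_curvature_pos[OF fint cond5(3,4,5) f_out f_in cond5(8-11) f_gap])
  then have f_curv: "expectation (\<lambda>\<omega>. cauchy_curvature (S \<sigma>\<^sub>0 \<epsilon> 2 \<omega>)) > 0"
    using distributed_integral[OF cond5(2), of cauchy_curvature] cond5(3) by (simp add: mult.commute)
  have H: "H X (\<lambda>j. Y j \<omega>) n \<mu> = - (real n * mean_loss (\<Delta> X) (\<lambda>j. S \<sigma>\<^sub>0 \<epsilon> j \<omega>) n (\<mu> - \<mu>\<^sub>0))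
      - (\<Sum>j=2..n. ln (1 + (S \<sigma>\<^sub>0 \<epsilon> j \<omega>)\<^sup>2))" if \<omega>: "\<omega> \<in> space M" and n: "n \<ge> 2" for \<omega> n \<mu>
  proof -
    have "H X (\<lambda>j. Y j \<omega>) n \<mu> = (\<Sum>j=2..n. - ln (1 + (S \<sigma>\<^sub>0 \<epsilon> j \<omega> - \<Delta> X j \<bullet> (\<mu> - \<mu>\<^sub>0))\<^sup>2))"
      unfolding H_def
    proof (rule sum.cong[OF refl])
      fix j assume "j \<in> {2..n}"
      then have "1 \<le> j" "1 \<le> j - 1" by auto
      then have "\<Delta> (\<lambda>j. Y j \<omega>) j - \<Delta> X j \<bullet> \<mu> = S \<sigma>\<^sub>0 \<epsilon> j \<omega> - \<Delta> X j \<bullet> (\<mu> - \<mu>\<^sub>0)"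
        using model[of j \<omega>] model[of "j - 1" \<omega>] \<omega>
        by (simp add: \<Delta>_def S_def algebra_simps inner_diff_left inner_diff_right)
      then show "ln (1 / (1 + (\<Delta> (\<lambda>j. Y j \<omega>) j - \<Delta> X j \<bullet> \<mu>)\<^sup>2))
          = - ln (1 + (S \<sigma>\<^sub>0 \<epsilon> j \<omega> - \<Delta> X j \<bullet> (\<mu> - \<mu>\<^sub>0))\<^sup>2)"
        by (simp add: ln_div one_plus_square_pos)
    qed
    then show ?thesis using n by (simp add: mean_loss_def sum_subtractf sum_negf)
  qed
  interpret cauchy_regression M \<epsilon> \<sigma>\<^sub>0 C\<^sub>X lam "\<Delta> X" \<Theta> \<mu>\<^sub>0 \<mu>h "\<lambda>n. K * real n powr - (1/2 - \<beta>\<^sub>2)" C\<^sub>0 D\<^sub>0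
  proof
    show "indep_vars (\<lambda>_. borel) \<epsilon> {1..}" by (rule indep)
    show "(\<lambda>n. K * real n powr - (1/2 - \<beta>\<^sub>2)) \<longlonglongrightarrow> 0" using cond4(3) by (intro null) simp
    fix n :: nat assume n: "n \<ge> 2"
    note est = estimator[OF n, unfolded CQMLE_def]
    show "\<mu>h n \<in> borel_measurable M" using est by blast
    fix \<omega> assume \<omega>: "\<omega> \<in> space M"
    show "\<mu>h n \<omega> \<in> closure \<Theta>" using est \<omega> by blast
    fix \<mu> assume "\<mu> \<in> closure \<Theta>"
    then have "H X (\<lambda>j. Y j \<omega>) n \<mu> \<le> H X (\<lambda>j. Y j \<omega>) n (\<mu>h n \<omega>)" using est \<omega> by blast
    then show "mean_loss (\<Delta> X) (\<lambda>j. S \<sigma>\<^sub>0 \<epsilon> j \<omega>) n (\<mu>h n \<omega> - \<mu>\<^sub>0) \<le> mean_loss (\<Delta> X) (\<lambda>j. S \<sigma>\<^sub>0 \<epsilon> j \<omega>) n (\<mu> - \<mu>\<^sub>0)"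
      unfolding H[OF \<omega> n] using n by simp
  qed (fact ident cond1(1) dX Theta f_score f_curv cond2(1) gram cond3 cond4(5) sep)+
  have \<Gamma>: "\<Gamma> = Gamma0 M \<epsilon> \<sigma>\<^sub>0 C\<^sub>0"
  proof -
    have "expectation (\<lambda>\<omega>. cauchy_curvature (S \<sigma>\<^sub>0 \<epsilon> 2 \<omega>))
        = 2 * expectation (\<lambda>\<omega>. (1 - (S \<sigma>\<^sub>0 \<epsilon> 2 \<omega>)\<^sup>2) / (1 + (S \<sigma>\<^sub>0 \<epsilon> 2 \<omega>)\<^sup>2)\<^sup>2)"
      by (subst integral_mult_right_zero[symmetric])
        (intro Bochner_Integration.integral_cong, auto simp: cauchy_curvature_def)
    then show ?thesis by (simp add: \<Gamma>_def Gamma0_def)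
  qed
  have tail: "(SUP r\<in>{0<..}. SUP n\<in>{2..}.
      ereal (measure M {\<omega> \<in> space M. norm (sqrt (real n) *\<^sub>R (\<mu>h n \<omega> - \<mu>\<^sub>0)) > r} * r powr L)) < \<infinity>"
    if "L > 0" for L
  proof -
    obtain C where C: "\<And>n r. n \<ge> 2 \<Longrightarrow> r > 0 \<Longrightarrow>
        prob {\<omega>\<in>space M. r < norm (scaled n \<omega>)} * r powr L \<le> C"
      by (rule tail_moment_bound[OF \<open>L > 0\<close>]) (rule that)
    have "(SUP r\<in>{0<..}. SUP n\<in>{2..}.
      ereal (measure M {\<omega> \<in> space M. norm (sqrt (real n) *\<^sub>R (\<mu>h n \<omega> - \<mu>\<^sub>0)) > r} * r powr L)) \<le> ereal C"
      by (intro SUP_least) (use C in simp)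
    then show ?thesis by (rule le_less_trans) simp
  qed
  show ?thesis
    using invertible_\<Gamma> asymptotic_normality tail unfolding \<Gamma> by blast
qed

end
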